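(* Let $\mu$ and $\mu^*$ be the leaf distributions (distributions over $\{-1,1\}^n$) of two tree-structured Ising models, each with $n$ leaves labeled $1,\dots,n$. Assume that $|\mathbb{E}_{\mu}[x_i x_j] - \mathbb{E}_{\mu^*}[x_i x_j]| \le \epsilon$ for all pairs of distinct leaves $i,j$, and let $D$ be the minimum of the diameters of the two underlying trees. Then: (1) (Same topology) If $\mu$ and $\mu^*$ are defined on the same tree, then $\mathrm{TV}(\mu,\mu^* ) \le 2n^2\epsilon$. (2) (Different topologies) If $\mu$ and $\mu^*$ are defined on different trees, then $\mathrm{TV}(\mu,\mu^* ) \le C D n^5 \epsilon$, where $C>0$ is an absolute constant.
   Context: A tree-structured Ising model is given by an undirected tree $T=(V,E)$ whose leaves are labeled $1,\dots,n$ and whose internal nodes are labeled $n+1,\dots,n+n'$ (standing assumption: every non-leaf node has degree $3$), together with edge weights $\theta_{ij}\in[-1,1]$ for $(i,j)\in E$. Each node $i$ receives a spin $x_i\in\{-1,1\}$ with $\Pr[x_1,\dots,x_{n+n'}] \propto \prod_{(i,j)\in E} \frac{1+\theta_{ij}x_ix_j}{2}$. The leaf distribution is the marginal of this distribution on $(x_1,\dots,x_n)$. For any two nodes $i,j$, $\mathbb{E}[x_ix_j]=\prod_{(k,l)\in P_{ij}}\theta_{kl}$, where $P_{ij}$ is the path between $i$ and $j$. $\mathrm{TV}(\mu,\nu)=\frac12\sum_x|\mu(x)-\nu(x)|$. *)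

theory Defs
  imports Complex_Main "HOL-Library.FuncSet"
begin

section \<open>Trees on the node set {1..N}\<close>

text \<open>An undirected graph is given by its edge set E, each edge being a 2-element set of nodes.\<close>

definition adj :: "nat set set \<Rightarrow> (nat \<times> nat) set" where
  "adj E = {(u, v). {u, v} \<in> E}"

definition degree :: "nat set set \<Rightarrow> nat \<Rightarrow> nat" where
  "degree E i = card {e \<in> E. i \<in> e}"

definition connected_graph :: "nat set \<Rightarrow> nat set set \<Rightarrow> bool" where
  "connected_graph V E \<longleftrightarrow> (\<forall>u\<in>V. \<forall>v\<in>V. (u, v) \<in> (adj E)\<^sup>*)"

text \<open>Acyclic: every edge is a bridge (its endpoints are disconnected once it is removed).\<close>
definition acyclic_graph :: "nat set set \<Rightarrow> bool" where
  "acyclic_graph E \<longleftrightarrow> (\<forall>e\<in>E. \<forall>u v. e = {u, v} \<longrightarrow> (u, v) \<notin> (adj (E - {e}))\<^sup>*)"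

definition is_tree :: "nat set \<Rightarrow> nat set set \<Rightarrow> bool" where
  "is_tree V E \<longleftrightarrow> finite V \<and> V \<noteq> {}
     \<and> E \<subseteq> {{u, v} | u v. u \<in> V \<and> v \<in> V \<and> u \<noteq> v}
     \<and> connected_graph V E \<and> acyclic_graph E"

text \<open>Graph distance: number of edges on a shortest (in a tree: the unique) path.\<close>
definition graph_dist :: "nat set set \<Rightarrow> nat \<Rightarrow> nat \<Rightarrow> nat" where
  "graph_dist E u v = (LEAST k. (u, v) \<in> (adj E) ^^ k)"

definition diameter :: "nat set \<Rightarrow> nat set set \<Rightarrow> nat" where
  "diameter V E = Max {graph_dist E u v | u v. u \<in> V \<and> v \<in> V}"

section \<open>Tree-structured Ising models\<close>

text \<open>A tree-structured Ising model with leaves 1..n, internal nodes n+1..n+n',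
  edge set E and edge weights theta.\<close>
definition tree_ising :: "nat \<Rightarrow> nat \<Rightarrow> nat set set \<Rightarrow> (nat set \<Rightarrow> real) \<Rightarrow> bool" where
  "tree_ising n n' E \<theta> \<longleftrightarrow> is_tree {1..n+n'} E
     \<and> (\<forall>i\<in>{1..n}. degree E i \<le> 1)
     \<and> (\<forall>i\<in>{n+1..n+n'}. degree E i = 3)
     \<and> (\<forall>e\<in>E. -1 \<le> \<theta> e \<and> \<theta> e \<le> 1)"

text \<open>Spin configurations on a node set (extensional functions into {-1,1}).\<close>
definition spins :: "nat set \<Rightarrow> (nat \<Rightarrow> real) set" where
  "spins A = A \<rightarrow>\<^sub>E {-1, 1}"

text \<open>Unnormalized weight: product over edges {i,j} of (1 + theta_ij x_i x_j)/2.\<close>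
definition ising_weight :: "nat set set \<Rightarrow> (nat set \<Rightarrow> real) \<Rightarrow> (nat \<Rightarrow> real) \<Rightarrow> real" where
  "ising_weight E \<theta> x = (\<Prod>e\<in>E. (1 + \<theta> e * (\<Prod>k\<in>e. x k)) / 2)"

definition ising_prob :: "nat \<Rightarrow> nat set set \<Rightarrow> (nat set \<Rightarrow> real) \<Rightarrow> (nat \<Rightarrow> real) \<Rightarrow> real" where
  "ising_prob N E \<theta> x =
     ising_weight E \<theta> x / (\<Sum>z\<in>spins {1..N}. ising_weight E \<theta> z)"

text \<open>Leaf distribution: marginal on the leaves 1..n.\<close>
definition leaf_dist :: "nat \<Rightarrow> nat \<Rightarrow> nat set set \<Rightarrow> (nat set \<Rightarrow> real) \<Rightarrow> (nat \<Rightarrow> real) \<Rightarrow> real" where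
  "leaf_dist n n' E \<theta> y =
     (\<Sum>x\<in>{x \<in> spins {1..n+n'}. restrict x {1..n} = y}. ising_prob (n+n') E \<theta> x)"

definition leaf_corr :: "nat \<Rightarrow> ((nat \<Rightarrow> real) \<Rightarrow> real) \<Rightarrow> nat \<Rightarrow> nat \<Rightarrow> real" where
  "leaf_corr n \<mu> i j = (\<Sum>y\<in>spins {1..n}. \<mu> y * y i * y j)"

definition tv_dist :: "nat \<Rightarrow> ((nat \<Rightarrow> real) \<Rightarrow> real) \<Rightarrow> ((nat \<Rightarrow> real) \<Rightarrow> real) \<Rightarrow> real" where
  "tv_dist n \<mu> \<nu> = (1/2) * (\<Sum>y\<in>spins {1..n}. \<bar>\<mu> y - \<nu> y\<bar>)"

end

(*
The density of the leaf spins of a tree model is assembled from even and odd parts of subtrees: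
cutting an edge (u,v) of weight t gives p = p_U p_W + t q_U q_W, and q is an even combination of the
same kind.

Equal topologies. Write alpha_ij for the correlations. Along any smooth path of edge weights the leaf
density moves by the sum of alpha_ij' y_i y_j rho_ij, where rho_ij >= 0 has mean at most 1. Along the
geometric interpolation of the weights each alpha_ij is monotone, so the L1 distance is at most the
sum of |alpha_ij - alpha*_ij|. If edge signs disagree, flipping hidden spins moves the disagreement to
a set F of leaves; correlations across F are then at most epsilon, and flipping F changes the law by at
most twice their sum.

Different topologies. Seen from the other leaves X, a cherry (a,b) of the second tree satisfies
E[y_b f] = r E[y_a f] with |r| <= 1 and E[y_a y_b f] = alpha*_ab E[f] for functions f of X. In the first
tree both identities hold up to errors controlled by |alpha_bm - r alpha_am| and by the 2x2 minors
alpha_am alpha_bm' - alpha_am' alpha_bm, without any small denominator. Hence b can be reattached to a,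
the two leaves are merged into a cluster, and one recurses. The intermediate densities may be signed;
their L1 norms on every set of leaves are bounded by the induction hypothesis for that set, and products
of such bounds stay bounded because the error bound is superadditive.
*)
theory Submission
  imports Defs
begin

text \<open>The obstacle with different trees is that comparing odd parts invites division by
  correlations, which may be tiny or 0. So a cluster is stored as a pair \<open>P\<close>,
  \<open>Q\<close> that is only ever multiplied out; \<open>Q\<close> need not be dominated by
  \<open>P\<close>, but its norm bound grows just additively under merging. Norms are bounded by exp
  g, g being the error bound itself: norms multiply across a cut, and exp turns products into sums
  of g. If 27 \<epsilon> n^5 > 1 the claim is trivial; otherwise g \<le> 1 and exp g \<le> 3. A
  merge costs 12 = 3 * 2 * 2 for replacing b by a multiple of a, and 15 = 3 * 4 + 3 for the product
  of the spins of a and b, each times \<epsilon> N^4, where N is the total of the norm bounds: two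
  powers of N come from \<open>Q a\<close> and \<open>Q b\<close>, two from a double sum over
  leaves. At most n - 1 merges yield n^5. With equal trees the geometric interpolation is chosen
  because it turns every correlation into a fixed sign times the exponential of an affine function
  of time. In L1 the change of moduli costs n^2 \<epsilon> and the flip 2 n^2 \<epsilon>, that is
  3/2 n^2 \<epsilon> in total variation.\<close>

section \<open>Spin expectations on trees\<close>

text \<open>On a tree the total mass is 1 (lemma \<open>ex_one\<close>), so \<open>ex\<close> is the expectation under the Ising law.\<close>

definition ex :: "nat set \<Rightarrow> nat set set \<Rightarrow> (nat set \<Rightarrow> real) \<Rightarrow> ((nat \<Rightarrow> real) \<Rightarrow> real) \<Rightarrow> real" where
  "ex V E \<theta> f = (\<Sum>x\<in>spins V. (\<Prod>e\<in>E. 1 + \<theta> e * (\<Prod>k\<in>e. x k)) * f x) / 2 ^ card V"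

text \<open>Configurations are functions on all of \<open>nat\<close>; the set of coordinates that a
  function reads takes the place of a sigma-algebra when independence across a cut is used.\<close>

definition dep :: "nat set \<Rightarrow> ((nat \<Rightarrow> real) \<Rightarrow> real) \<Rightarrow> bool" where
  "dep U f \<longleftrightarrow> (\<forall>x y. (\<forall>k\<in>U. x k = y k) \<longrightarrow> f x = f y)"

definition cor :: "nat set \<Rightarrow> nat set set \<Rightarrow> (nat set \<Rightarrow> real) \<Rightarrow> nat \<Rightarrow> nat \<Rightarrow> real" where
  "cor V E \<theta> i j = ex V E \<theta> (\<lambda>x. x i * x j)"

text \<open>Trees with a root, generated by hanging a tree \<open>W\<close> with root \<open>v\<close> below the root \<open>u\<close> of \<open>U\<close>;
  no degree condition is imposed.\<close>

inductive rtree :: "nat set \<Rightarrow> nat set set \<Rightarrow> nat \<Rightarrow> bool" where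
  single: "rtree {u} {} u"
| join: "rtree U EU u \<Longrightarrow> rtree W EW v \<Longrightarrow> U \<inter> W = {} \<Longrightarrow>
    rtree (U \<union> W) (insert {u, v} (EU \<union> EW)) u"

lemma depD: "dep U f \<Longrightarrow> (\<And>k. k \<in> U \<Longrightarrow> x k = y k) \<Longrightarrow> f x = f y"
  by (auto simp: dep_def)

lemma dep_mono: "dep U f \<Longrightarrow> U \<subseteq> V \<Longrightarrow> dep V f"
  unfolding dep_def by blast

lemma dep_const [simp]: "dep U (\<lambda>x. c)" by (auto simp: dep_def)
lemma dep_coord: "k \<in> U \<Longrightarrow> dep U (\<lambda>x. x k)" by (auto simp: dep_def)
lemma dep_mult: "dep U f \<Longrightarrow> dep U g \<Longrightarrow> dep U (\<lambda>x. f x * g x)"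
  unfolding dep_def by metis
lemma dep_add: "dep U f \<Longrightarrow> dep U g \<Longrightarrow> dep U (\<lambda>x. f x + g x)"
  unfolding dep_def by metis
lemma dep_diff: "dep U f \<Longrightarrow> dep U g \<Longrightarrow> dep U (\<lambda>x. f x - g x)"
  unfolding dep_def by metis
lemma dep_abs: "dep U f \<Longrightarrow> dep U (\<lambda>x. \<bar>f x\<bar>)"
  unfolding dep_def by metis
lemma dep_prod: "(\<And>l. l \<in> L \<Longrightarrow> dep U (f l)) \<Longrightarrow> dep U (\<lambda>x. \<Prod>l\<in>L. f l x)"
  unfolding dep_def by (intro allI impI prod.cong) auto
lemma spins_finite [simp]: "finite V \<Longrightarrow> finite (spins V)"
  by (auto simp: spins_def intro!: finite_PiE)

lemma card_spins: "finite V \<Longrightarrow> card (spins V) = 2 ^ card V"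
  by (simp add: spins_def card_PiE numeral_2_eq_2)

lemma spins_value: "x \<in> spins V \<Longrightarrow> k \<in> V \<Longrightarrow> x k = -1 \<or> x k = 1"
  unfolding spins_def by (auto dest!: PiE_mem)

lemma spins_abs: "x \<in> spins V \<Longrightarrow> k \<in> V \<Longrightarrow> \<bar>x k\<bar> = 1"
  using spins_value by fastforce

lemma spins_square: "x \<in> spins V \<Longrightarrow> k \<in> V \<Longrightarrow> x k * x k = 1"
  using spins_value by fastforce

text \<open>Fubini for configurations: an extensional function on a disjoint union is a pair of
  restrictions. Outside \<open>U\<close> the glued function reads \<open>z\<close>, which is
  \<open>undefined\<close> outside \<open>W\<close>, as extensionality requires.\<close>

lemma sum_spins_Un:
  assumes "U \<inter> W = {}"
  shows "(\<Sum>x\<in>spins (U \<union> W). F x) =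
    (\<Sum>y\<in>spins U. \<Sum>z\<in>spins W. F (\<lambda>k. if k \<in> U then y k else z k))"
proof -
  have "(\<Sum>y\<in>spins U. \<Sum>z\<in>spins W. F (\<lambda>k. if k \<in> U then y k else z k))
     = (\<Sum>(y, z)\<in>spins U \<times> spins W. F (\<lambda>k. if k \<in> U then y k else z k))"
    by (rule sum.cartesian_product)
  also have "\<dots> = (\<Sum>x\<in>spins (U \<union> W). F x)"
  proof (rule sum.reindex_bij_witness[where
        i = "\<lambda>x. (restrict x U, restrict x W)" and
        j = "\<lambda>(y, z). (\<lambda>k. if k \<in> U then y k else z k)"], goal_cases)
    case (1 p)
    obtain y z where p: "p = (y, z)" by force
    have "y \<in> extensional U" "z \<in> extensional W" using 1 p by (auto simp: spins_def PiE_def)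
    then show ?case using p assms
      by (auto simp: fun_eq_iff restrict_def extensional_def)
  next
    case (2 p)
    obtain y z where p: "p = (y, z)" "y \<in> spins U" "z \<in> spins W" using 2 by auto
    have "(\<lambda>k. if k \<in> U then y k else z k) \<in> spins (U \<union> W)"
      unfolding spins_def
    proof (rule PiE_I)
      fix k assume "k \<in> U \<union> W"
      then show "(if k \<in> U then y k else z k) \<in> {-1, 1}"
        using spins_value[OF p(2), of k] spins_value[OF p(3), of k] by auto
    next
      fix k assume "k \<notin> U \<union> W"
      then show "(if k \<in> U then y k else z k) = undefined"
        using p(3) by (auto simp: spins_def)
    qed
    then show ?case using p by simp
  next
    case (3 x)
    then show ?case by (auto simp: fun_eq_iff spins_def PiE_def extensional_def)
  next
    case (4 x)
    then show ?case by (auto simp: spins_def PiE_def extensional_def)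
  next
    case (5 p)
    then show ?case by auto
  qed
  finally show ?thesis by simp
qed

section \<open>Gluing trees and changing the root\<close>

lemma rtree_props:
  assumes "rtree V E u"
  shows "finite V" "finite E" "u \<in> V" "e \<in> E \<Longrightarrow> e \<subseteq> V \<and> card e = 2"
proof -
  have "finite V \<and> finite E \<and> u \<in> V \<and> (\<forall>e\<in>E. e \<subseteq> V \<and> card e = 2)"
    using assms
  proof induction
    case (join U EU u W EW v)
    then have "u \<noteq> v" by auto
    then have "card {u, v} = 2" by simp
    with join show ?case by auto
  qed auto
  then show "finite V" "finite E" "u \<in> V" "e \<in> E \<Longrightarrow> e \<subseteq> V \<and> card e = 2" by auto
qed

text \<open>\<open>join\<close> hangs a subtree only below the root. A subtree hung at another node
  can be pushed into the component containing that node, so the generated class is closed under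
  attaching anywhere.\<close>

lemma rtree_attach:
  assumes "rtree U EU w" "u \<in> U" "rtree W EW v" "U \<inter> W = {}"
  shows "rtree (U \<union> W) (insert {u, v} (EU \<union> EW)) w"
  using assms
proof induction
  case (single w)
  then show ?case using rtree.join[OF rtree.single] by fastforce
next
  case (join U1 E1 w U2 E2 x)
  show ?case
  proof (cases "u \<in> U1")
    case True
    then have "rtree (U1 \<union> W) (insert {u, v} (E1 \<union> EW)) w" using join by blast
    from rtree.join[OF this join.hyps(2)] join
    have "rtree (U1 \<union> W \<union> U2) (insert {w, x} (insert {u, v} (E1 \<union> EW) \<union> E2)) w" by blast
    then show ?thesis by (simp add: Un_ac insert_commute)
  next
    case False
    then have "rtree (U2 \<union> W) (insert {u, v} (E2 \<union> EW)) x" using join by blast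
    from rtree.join[OF join.hyps(1) this] join
    have "rtree (U1 \<union> (U2 \<union> W)) (insert {w, x} (E1 \<union> (insert {u, v} (E2 \<union> EW)))) w" by blast
    then show ?thesis by (simp add: Un_ac insert_commute)
  qed
qed

text \<open>If the new root lies in the hanging part, the joining edge is read backwards: the old
  part then hangs at \<open>v\<close>, in general not the new root, which is the situation of
  \<open>rtree_attach\<close>.\<close>

lemma rtree_reroot:
  assumes "rtree V E u" "w \<in> V"
  shows "rtree V E w"
  using assms
proof (induction arbitrary: w)
  case (single u)
  then show ?case by (auto intro: rtree.single)
next
  case (join U EU u W EW v)
  show ?case
  proof (cases "w \<in> U")
    case True
    with join show ?thesis using rtree_attach[of U EU w u W EW v] rtree_props(3) by blast
  next
    case False
    with join have "rtree W EW w" by auto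
    from rtree_attach[OF this rtree_props(3)[OF join.hyps(2)] join.hyps(1)] join
    have "rtree (W \<union> U) (insert {v, u} (EW \<union> EU)) w" by blast
    then show ?thesis by (simp add: Un_ac insert_commute)
  qed
qed

section \<open>Expectations under gluing and sign changes\<close>

lemma ex_cong: "(\<And>x. x \<in> spins V \<Longrightarrow> f x = g x) \<Longrightarrow> ex V E \<theta> f = ex V E \<theta> g"
  unfolding ex_def by (intro arg_cong2[of _ _ _ _ "(/)"] sum.cong) auto

lemma ex_add: "ex V E \<theta> (\<lambda>x. f x + g x) = ex V E \<theta> f + ex V E \<theta> g"
  unfolding ex_def by (simp add: algebra_simps sum.distrib add_divide_distrib)

lemma ex_diff: "ex V E \<theta> (\<lambda>x. f x - g x) = ex V E \<theta> f - ex V E \<theta> g"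
  unfolding ex_def by (simp add: algebra_simps sum_subtractf diff_divide_distrib)

lemma ex_cmult: "ex V E \<theta> (\<lambda>x. c * f x) = c * ex V E \<theta> f"
  unfolding ex_def by (simp add: sum_distrib_left algebra_simps sum_divide_distrib)

lemma ex_nonneg:
  assumes "rtree V E u" "\<And>e. e \<in> E \<Longrightarrow> \<bar>\<theta> e\<bar> \<le> 1" "\<And>x. x \<in> spins V \<Longrightarrow> 0 \<le> f x"
  shows "0 \<le> ex V E \<theta> f"
  unfolding ex_def
proof (intro divide_nonneg_nonneg sum_nonneg mult_nonneg_nonneg prod_nonneg)
  fix x e assume x: "x \<in> spins V" and e: "e \<in> E"
  have "\<bar>\<Prod>k\<in>e. x k\<bar> = (\<Prod>k\<in>e. \<bar>x k\<bar>)" by (rule abs_prod)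
  also have "\<dots> = 1" using rtree_props(4)[OF assms(1) e] spins_abs[OF x] by (intro prod.neutral) blast
  finally have "\<bar>\<theta> e * (\<Prod>k\<in>e. x k)\<bar> \<le> 1" using assms(2)[OF e] by (simp add: abs_mult)
  then show "0 \<le> 1 + \<theta> e * (\<Prod>k\<in>e. x k)" by linarith
qed (use assms in auto)

text \<open>The joining edge contributes the factor \<open>1 + \<theta> {u, v} * x u * x v\<close>,
  and all other factors read one side only. Its two summands give the even and the odd
  product.\<close>

lemma ex_join:
  assumes U: "rtree U EU u" and W: "rtree W EW v" and UW: "U \<inter> W = {}"
    and f: "dep U f" and g: "dep W g"
  shows "ex (U \<union> W) (insert {u, v} (EU \<union> EW)) \<theta> (\<lambda>x. f x * g x)
    = ex U EU \<theta> f * ex W EW \<theta> g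
      + \<theta> {u, v} * ex U EU \<theta> (\<lambda>x. x u * f x) * ex W EW \<theta> (\<lambda>x. x v * g x)"
proof -
  note pU = rtree_props[OF U] and pW = rtree_props[OF W]
  define A where "A = (\<lambda>y. \<Prod>e\<in>EU. 1 + \<theta> e * (\<Prod>k\<in>e. y k))"
  define B where "B = (\<lambda>z. \<Prod>e\<in>EW. 1 + \<theta> e * (\<Prod>k\<in>e. z k))"
  have disjE: "EU \<inter> EW = {}"
  proof -
    have False if "e \<in> EU" "e \<in> EW" for e
      using pU(4)[OF that(1)] pW(4)[OF that(2)] UW by (auto simp: card_2_iff)
    then show ?thesis by blast
  qed
  have notin: "{u, v} \<notin> EU \<union> EW" using pU(4) pW(4) UW pU(3) pW(3) by blast
  have uv: "u \<noteq> v" using UW pU(3) pW(3) by blast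
  have fact: "(\<Prod>e\<in>insert {u, v} (EU \<union> EW). 1 + \<theta> e * (\<Prod>k\<in>e. x k)) * (f x * g x)
     = (A y * f y) * (B z * g z) + \<theta> {u, v} * (A y * (y u * f y)) * (B z * (z v * g z))"
    if x: "x = (\<lambda>k. if k \<in> U then y k else z k)" for x y z
  proof -
    have xU: "x k = y k" if "k \<in> U" for k using x that by auto
    have xW: "x k = z k" if "k \<in> W" for k using x that UW by auto
    have 1: "(\<Prod>e\<in>EU. 1 + \<theta> e * (\<Prod>k\<in>e. x k)) = A y"
      unfolding A_def using pU(4) xU by (intro prod.cong refl arg_cong2[of _ _ _ _ "(+)"] arg_cong2[of _ _ _ _ "(*)"]) blast
    have 2: "(\<Prod>e\<in>EW. 1 + \<theta> e * (\<Prod>k\<in>e. x k)) = B z"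
      unfolding B_def using pW(4) xW by (intro prod.cong refl arg_cong2[of _ _ _ _ "(+)"] arg_cong2[of _ _ _ _ "(*)"]) blast
    have 3: "f x = f y" using f xU by (auto intro: depD)
    have 4: "g x = g z" using g xW by (auto intro: depD)
    have 5: "x u = y u" "x v = z v" using xU xW pU(3) pW(3) by auto
    show ?thesis using pU(2) pW(2) notin uv
      by (simp add: prod.union_disjoint[OF _ _ disjE] 1 2 3 4 5 algebra_simps)
  qed
  have "(\<Sum>x\<in>spins (U \<union> W). (\<Prod>e\<in>insert {u, v} (EU \<union> EW). 1 + \<theta> e * (\<Prod>k\<in>e. x k)) * (f x * g x))
    = (\<Sum>y\<in>spins U. \<Sum>z\<in>spins W. (A y * f y) * (B z * g z) + \<theta> {u, v} * (A y * (y u * f y)) * (B z * (z v * g z)))"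
    unfolding sum_spins_Un[OF UW] using fact by simp
  also have "\<dots> = (\<Sum>y\<in>spins U. A y * f y) * (\<Sum>z\<in>spins W. B z * g z)
     + \<theta> {u, v} * (\<Sum>y\<in>spins U. A y * (y u * f y)) * (\<Sum>z\<in>spins W. B z * (z v * g z))"
    by (simp only: sum.distrib sum_product sum_distrib_left[of "\<theta> {u, v}"])
  finally show ?thesis
    unfolding ex_def using pU(1) pW(1) UW
    by (simp add: card_Un_disjoint power_add A_def B_def field_simps)
qed

text \<open>Gauge transformation: multiplying the spins by fixed signs is an involution of the
  configurations, and it multiplies each edge weight by the signs at its two ends.\<close>

lemma ex_gauge:
  assumes V: "\<And>e. e \<in> E \<Longrightarrow> e \<subseteq> V" and f: "dep V f" and h: "\<And>k. k \<in> V \<Longrightarrow> h k = -1 \<or> h k = (1::real)"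
  shows "ex V E \<theta> (\<lambda>x. f (\<lambda>k. h k * x k)) = ex V E (\<lambda>e. \<theta> e * (\<Prod>k\<in>e. h k)) f"
proof -
  have hh: "h k * (h k * c) = c" if "k \<in> V" for k c using h[OF that] by auto
  let ?T = "\<lambda>x. \<lambda>k\<in>V. h k * x k"
  have T: "?T x \<in> spins V" if "x \<in> spins V" for x
    unfolding spins_def
  proof (rule PiE_I)
    fix k assume "k \<in> V"
    then show "?T x k \<in> {-1, 1}" using h[of k] spins_value[OF that, of k] by auto
  qed simp
  have "(\<Sum>x\<in>spins V. (\<Prod>e\<in>E. 1 + \<theta> e * (\<Prod>k\<in>e. h k) * (\<Prod>k\<in>e. x k)) * f x)
      = (\<Sum>x\<in>spins V. (\<Prod>e\<in>E. 1 + \<theta> e * (\<Prod>k\<in>e. x k)) * f (\<lambda>k. h k * x k))"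
  proof (rule sum.reindex_bij_witness[where i = ?T and j = ?T], goal_cases)
    case (1 x) then show ?case using hh by (auto simp: fun_eq_iff spins_def PiE_def extensional_def)
  next
    case (2 x) then show ?case by (rule T)
  next
    case (3 x) then show ?case using hh by (auto simp: fun_eq_iff spins_def PiE_def extensional_def)
  next
    case (4 x) then show ?case by (rule T)
  next
    case (5 x)
    have "(\<Prod>k\<in>e. ?T x k) = (\<Prod>k\<in>e. h k) * (\<Prod>k\<in>e. x k)" if "e \<in> E" for e
      unfolding prod.distrib[symmetric] using V[OF that] by (intro prod.cong) auto
    moreover have "f (\<lambda>k. h k * ?T x k) = f x"
      using hh by (intro depD[OF f]) auto
    ultimately show ?case by (auto intro!: prod.cong simp: mult.assoc)
  qed
  then show ?thesis unfolding ex_def by simp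
qed

text \<open>Global spin flip: every edge has two ends, so the gauge with all signs -1 leaves the
  weights unchanged.\<close>

lemma ex_odd:
  assumes V: "rtree V E r" and f: "dep V f" and odd: "\<And>x. f (\<lambda>k. - x k) = - f x"
  shows "ex V E \<theta> f = 0"
proof -
  have "ex V E \<theta> (\<lambda>x. f (\<lambda>k. -1 * x k)) = ex V E (\<lambda>e. \<theta> e * (\<Prod>k\<in>e. -1)) f"
    by (rule ex_gauge[OF _ f]) (use rtree_props(4)[OF V] in auto)
  also have "\<dots> = ex V E \<theta> f"
    unfolding ex_def using rtree_props(4)[OF V]
    by (intro arg_cong2[of _ _ _ _ "(/)"] sum.cong arg_cong2[of _ _ _ _ "(*)"] prod.cong) auto
  finally have "ex V E \<theta> (\<lambda>x. - f x) = ex V E \<theta> f" by (simp add: odd)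
  then show ?thesis using ex_cmult[of V E \<theta> "-1" f] by simp
qed

lemma ex_coord: "rtree V E r \<Longrightarrow> v \<in> V \<Longrightarrow> ex V E \<theta> (\<lambda>x. x v) = 0"
  by (rule ex_odd) (auto intro: dep_coord)

text \<open>The odd product in \<open>ex_join\<close> vanishes because a single spin has mean 0, so
  total masses multiply.\<close>

lemma ex_one: "rtree V E u \<Longrightarrow> ex V E \<theta> (\<lambda>x. 1) = 1"
proof (induction rule: rtree.induct)
  case (single u)
  show ?case by (simp add: ex_def card_spins)
next
  case (join U EU u W EW v)
  then show ?case
    using ex_join[OF join.hyps, of "\<lambda>x. 1" "\<lambda>x. 1" \<theta>] ex_coord[of U EU u u \<theta>] rtree_props(3)[OF join.hyps(1)]
    by simp
qed

lemma ex_join_left: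
  assumes "rtree U EU u" "rtree W EW v" "U \<inter> W = {}" "dep U f"
  shows "ex (U \<union> W) (insert {u, v} (EU \<union> EW)) \<theta> f = ex U EU \<theta> f"
  using ex_join[OF assms, of "\<lambda>x. 1" \<theta>] ex_one[OF assms(2)] ex_coord[OF assms(2) rtree_props(3)[OF assms(2)]]
  by simp

lemma ex_join_right:
  assumes "rtree U EU u" "rtree W EW v" "U \<inter> W = {}" "dep W g"
  shows "ex (U \<union> W) (insert {u, v} (EU \<union> EW)) \<theta> g = ex W EW \<theta> g"
  using ex_join[OF assms(1-3), of "\<lambda>x. 1" g \<theta>] assms(4) ex_one[OF assms(1)]
    ex_coord[OF assms(1) rtree_props(3)[OF assms(1)]]
  by simp

section \<open>Correlations and paths\<close>

lemma cor_sym: "cor V E \<theta> i j = cor V E \<theta> j i"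
  by (simp add: cor_def mult.commute)

lemma cor_refl: "rtree V E u \<Longrightarrow> i \<in> V \<Longrightarrow> cor V E \<theta> i i = 1"
  using ex_one[of V E u \<theta>] ex_cong[of V "\<lambda>x. x i * x i" "\<lambda>x. 1"] by (simp add: cor_def spins_square)

lemma cor_join:
  assumes "rtree U EU u" "rtree W EW v" "U \<inter> W = {}"
  defines "V \<equiv> U \<union> W" and "E \<equiv> insert {u, v} (EU \<union> EW)"
  shows "i \<in> U \<Longrightarrow> j \<in> U \<Longrightarrow> cor V E \<theta> i j = cor U EU \<theta> i j"
    and "i \<in> W \<Longrightarrow> j \<in> W \<Longrightarrow> cor V E \<theta> i j = cor W EW \<theta> i j"
    and "i \<in> U \<Longrightarrow> j \<in> W \<Longrightarrow> cor V E \<theta> i j = cor U EU \<theta> i u * \<theta> {u, v} * cor W EW \<theta> v j"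
proof -
  show "i \<in> U \<Longrightarrow> j \<in> U \<Longrightarrow> cor V E \<theta> i j = cor U EU \<theta> i j" unfolding V_def E_def cor_def
    by (rule ex_join_left[OF assms(1-3)]) (intro dep_mult dep_coord)
  show "i \<in> W \<Longrightarrow> j \<in> W \<Longrightarrow> cor V E \<theta> i j = cor W EW \<theta> i j" unfolding V_def E_def cor_def
    by (rule ex_join_right[OF assms(1-3)]) (intro dep_mult dep_coord)
  show "cor V E \<theta> i j = cor U EU \<theta> i u * \<theta> {u, v} * cor W EW \<theta> v j" if "i \<in> U" "j \<in> W"
    unfolding V_def E_def cor_def
    using ex_join[OF assms(1-3), of "\<lambda>x. x i" "\<lambda>x. x j" \<theta>] that
      ex_coord[OF assms(1)]
    by (simp add: dep_coord mult.commute[of "_ i"])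
qed

text \<open>The walk from \<open>i\<close> over \<open>j\<close> to \<open>k\<close> consists of the
  path from \<open>i\<close> to \<open>k\<close> and a detour to \<open>j\<close> traversed in both
  directions; \<open>\<kappa>\<close> is the squared correlation along the detour. This form avoids
  dividing by a correlation.\<close>

lemma cor_mult:
  assumes "rtree V E r" "\<And>e. e \<in> E \<Longrightarrow> \<bar>\<theta> e\<bar> \<le> 1" "i \<in> V" "j \<in> V" "k \<in> V"
  shows "\<exists>\<kappa>. 0 \<le> \<kappa> \<and> \<kappa> \<le> 1 \<and> cor V E \<theta> i j * cor V E \<theta> j k = \<kappa> * cor V E \<theta> i k"
  using assms
proof (induction arbitrary: i j k)
  case (single u)
  then show ?case by (intro exI[of _ 1]) (simp add: cor_refl[OF rtree.single])
next
  case (join U EU u W EW v)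
  let ?V = "U \<union> W" and ?E = "insert {u, v} (EU \<union> EW)"
  let ?a = "cor U EU \<theta>" and ?b = "cor W EW \<theta>" and ?g = "cor ?V ?E \<theta>"
  note J = cor_join[OF join.hyps(1-3), of _ _ \<theta>]
  have uU: "u \<in> U" and vW: "v \<in> W" using join.hyps rtree_props(3) by auto
  have t: "\<bar>\<theta> {u, v}\<bar> \<le> 1" using join.prems(1) by auto
  have t2: "\<theta> {u, v} * \<theta> {u, v} \<le> 1" "0 \<le> \<theta> {u, v} * \<theta> {u, v}"
    using t by (auto simp: abs_le_square_iff power2_eq_square[symmetric] abs_square_le_1)
  have IHU: "\<exists>\<kappa>. 0 \<le> \<kappa> \<and> \<kappa> \<le> 1 \<and> ?a i j * ?a j k = \<kappa> * ?a i k"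
    if "i \<in> U" "j \<in> U" "k \<in> U" for i j k using join.IH(1)[OF _ that] join.prems(1) by auto
  have IHW: "\<exists>\<kappa>. 0 \<le> \<kappa> \<and> \<kappa> \<le> 1 \<and> ?b i j * ?b j k = \<kappa> * ?b i k"
    if "i \<in> W" "j \<in> W" "k \<in> W" for i j k using join.IH(2)[OF _ that] join.prems(1) by auto
  have W1: "0 \<le> ?b v j * ?b v j \<and> ?b v j * ?b v j \<le> 1" if "j \<in> W" for j
    using IHW[OF vW that vW] by (auto simp: cor_sym[of W EW \<theta> j v] cor_refl[OF join.hyps(2) vW])
  have U1: "0 \<le> ?a j u * ?a j u \<and> ?a j u * ?a j u \<le> 1" if "j \<in> U" for j
    using IHU[OF uU that uU] by (auto simp: cor_sym[of U EU \<theta> u j] cor_refl[OF join.hyps(1) uU])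
  define t where "t = \<theta> {u, v}"
  have unit: "0 \<le> x * y * z \<and> x * y * z \<le> 1"
    if "0 \<le> x" "x \<le> 1" "0 \<le> y" "y \<le> 1" "0 \<le> z" "z \<le> 1" for x y z :: real
    using that by (auto intro!: mult_le_one mult_nonneg_nonneg)
  have JS: "?g i j = ?a j u * t * ?b v i" if "i \<in> W" "j \<in> U" for i j
    using J(3)[OF that(2,1)] cor_sym[of ?V ?E \<theta> i j] by (simp add: t_def)
  have J3: "?g i j = ?a i u * t * ?b v j" if "i \<in> U" "j \<in> W" for i j
    using J(3)[OF that] by (simp add: t_def)
  consider "i \<in> U" "j \<in> U" "k \<in> U" | "i \<in> U" "j \<in> U" "k \<in> W" | "i \<in> U" "j \<in> W" "k \<in> U" | "i \<in> U" "j \<in> W" "k \<in> W"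
    | "i \<in> W" "j \<in> U" "k \<in> U" | "i \<in> W" "j \<in> U" "k \<in> W" | "i \<in> W" "j \<in> W" "k \<in> U" | "i \<in> W" "j \<in> W" "k \<in> W"
    using join.prems by blast
  then show ?case
  proof cases
    case 1 then show ?thesis using IHU[OF 1] J(1) by simp
  next
    case 8 then show ?thesis using IHW[OF 8] J(2) by simp
  next
    case 2
    obtain \<kappa> where \<kappa>: "0 \<le> \<kappa>" "\<kappa> \<le> 1" "?a i j * ?a j u = \<kappa> * ?a i u" using IHU[OF 2(1,2) uU] by blast
    have "?g i j * ?g j k = (?a i j * ?a j u) * t * ?b v k"
      using 2 J3 J(1) by simp
    also have "\<dots> = \<kappa> * ?g i k" unfolding \<kappa> using 2 J3 by simp
    finally show ?thesis using \<kappa> by blast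
  next
    case 5
    obtain \<kappa> where \<kappa>: "0 \<le> \<kappa>" "\<kappa> \<le> 1" "?a k j * ?a j u = \<kappa> * ?a k u" using IHU[OF 5(3,2) uU] by blast
    have "?g i j * ?g j k = (?a k j * ?a j u) * t * ?b v i"
      using 5 JS J(1) cor_sym[of U EU \<theta> j k] by simp
    also have "\<dots> = \<kappa> * ?g i k" unfolding \<kappa> using 5 JS by simp
    finally show ?thesis using \<kappa> by blast
  next
    case 4
    obtain \<kappa> where \<kappa>: "0 \<le> \<kappa>" "\<kappa> \<le> 1" "?b v j * ?b j k = \<kappa> * ?b v k" using IHW[OF vW 4(2,3)] by blast
    have "?g i j * ?g j k = (?b v j * ?b j k) * t * ?a i u"
      using 4 J3 J(2) by simp
    also have "\<dots> = \<kappa> * ?g i k" unfolding \<kappa> using 4 J3 by simp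
    finally show ?thesis using \<kappa> by blast
  next
    case 7
    obtain \<kappa> where \<kappa>: "0 \<le> \<kappa>" "\<kappa> \<le> 1" "?b v j * ?b j i = \<kappa> * ?b v i" using IHW[OF vW 7(2,1)] by blast
    have "?g i j * ?g j k = (?b v j * ?b j i) * t * ?a k u"
      using 7 JS J(2) cor_sym[of W EW \<theta> i j] by simp
    also have "\<dots> = \<kappa> * ?g i k" unfolding \<kappa> using 7 JS by simp
    finally show ?thesis using \<kappa> by blast
  next
    case 3
    obtain \<kappa> where \<kappa>: "0 \<le> \<kappa>" "\<kappa> \<le> 1" "?a i u * ?a u k = \<kappa> * ?a i k" using IHU[OF 3(1) uU 3(3)] by blast
    \<comment> \<open>The joining edge and the way from \<open>v\<close> to \<open>j\<close> are
      traversed back and forth, so they enter squared.\<close>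
    let ?c = "t * t * (?b v j * ?b v j)"
    have "?g i j * ?g j k = ?c * (?a i u * ?a u k)"
      using 3 J3 JS cor_sym[of U EU \<theta> k u] by simp
    also have "\<dots> = (?c * \<kappa>) * ?g i k" unfolding \<kappa> using 3 J(1) by simp
    finally show ?thesis using unit[of "t * t" _ \<kappa>, OF _ _ _ _ \<kappa>(1,2)] t2 W1[OF 3(2)]
      unfolding t_def by blast
  next
    case 6
    obtain \<kappa> where \<kappa>: "0 \<le> \<kappa>" "\<kappa> \<le> 1" "?b i v * ?b v k = \<kappa> * ?b i k" using IHW[OF 6(1) vW 6(3)] by blast
    let ?c = "t * t * (?a j u * ?a j u)"
    have "?g i j * ?g j k = ?c * (?b i v * ?b v k)"
      using 6 J3 JS cor_sym[of W EW \<theta> i v] by simp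
    also have "\<dots> = (?c * \<kappa>) * ?g i k" unfolding \<kappa> using 6 J(2) by simp
    finally show ?thesis using unit[of "t * t" _ \<kappa>, OF _ _ _ _ \<kappa>(1,2)] t2 U1[OF 6(2)]
      unfolding t_def by blast
  qed
qed

text \<open>An edge on the path from \<open>a\<close> to \<open>b\<close>, oriented so that
  \<open>u\<close> is on the side of \<open>a\<close>, together with the two components that its
  removal leaves, each rooted at its end of the edge.\<close>

definition split_at :: "nat set \<Rightarrow> nat set set \<Rightarrow> nat \<Rightarrow> nat \<Rightarrow> nat \<Rightarrow> nat \<Rightarrow> nat set \<Rightarrow> nat set set \<Rightarrow> nat set \<Rightarrow> nat set set \<Rightarrow> bool" where
  "split_at V E a b u v U EU W EW \<longleftrightarrow> rtree U EU u \<and> rtree W EW v \<and> U \<inter> W = {} \<and> V = U \<union> W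
     \<and> E = insert {u, v} (EU \<union> EW) \<and> a \<in> U \<and> b \<in> W"

definition path_step :: "nat set \<Rightarrow> nat set set \<Rightarrow> nat \<Rightarrow> nat \<Rightarrow> (nat \<times> nat) set" where
  "path_step V E a b = {(u, v). \<exists>U EU W EW. split_at V E a b u v U EU W EW}"

text \<open>The path is a chain whose every step carries its own cut of the tree, so an induction
  over the reflexive transitive closure has the two sides available at each edge.\<close>

lemma path_exists:
  assumes "rtree V E a" "b \<in> V"
  shows "(a, b) \<in> (path_step V E a b)\<^sup>*"
  using assms
proof (induction arbitrary: b)
  case (single u)
  then show ?case by simp
next
  case (join U EU a W EW v)
  let ?V = "U \<union> W" and ?E = "insert {a, v} (EU \<union> EW)"
  show ?case
  proof (cases "b \<in> U")
    case True
    have "path_step U EU a b \<subseteq> path_step ?V ?E a b"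
    proof clarify
      fix x y assume "(x, y) \<in> path_step U EU a b"
      then obtain U1 E1 U2 E2 where s: "split_at U EU a b x y U1 E1 U2 E2" by (auto simp: path_step_def)
      have "rtree (U1 \<union> W) (insert {a, v} (E1 \<union> EW)) x"
        using s join.hyps by (intro rtree_attach) (auto simp: split_at_def)
      then have "split_at ?V ?E a b x y (U1 \<union> W) (insert {a, v} (E1 \<union> EW)) U2 E2"
        using s join.hyps unfolding split_at_def by auto
      then show "(x, y) \<in> path_step ?V ?E a b" by (auto simp: path_step_def)
    qed
    with join.IH(1)[OF True] show ?thesis using rtrancl_mono by blast
  next
    case False
    then have b: "b \<in> W" using join.prems by auto
    have sub: "path_step W EW v b \<subseteq> path_step ?V ?E a b"
    proof clarify
      fix x y assume "(x, y) \<in> path_step W EW v b"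
      then obtain W1 E1 W2 E2 where s: "split_at W EW v b x y W1 E1 W2 E2" by (auto simp: path_step_def)
      \<comment> \<open>\<open>W1\<close> is the side containing \<open>v\<close>, so attaching
        \<open>U\<close> to it keeps \<open>a\<close> on the near side of the cut.\<close>
      have "rtree (W1 \<union> U) (insert {v, a} (E1 \<union> EU)) x"
        using s join.hyps by (intro rtree_attach) (auto simp: split_at_def)
      then have "split_at ?V ?E a b x y (W1 \<union> U) (insert {v, a} (E1 \<union> EU)) W2 E2"
        using s join.hyps rtree_props(3)[OF join.hyps(1)] unfolding split_at_def
        by (auto simp: insert_commute)
      then show "(x, y) \<in> path_step ?V ?E a b" by (auto simp: path_step_def)
    qed
    have "split_at ?V ?E a b a v U EU W EW"
      using join.hyps b rtree_props(3)[OF join.hyps(1)] by (auto simp: split_at_def)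
    then have "(a, v) \<in> path_step ?V ?E a b" by (auto simp: path_step_def)
    moreover have "(v, b) \<in> (path_step ?V ?E a b)\<^sup>*"
      using join.IH(2)[OF b] rtrancl_mono[OF sub] by blast
    ultimately show ?thesis by (rule converse_rtrancl_into_rtrancl)
  qed
qed

section \<open>Norms of densities built from leaf clusters\<close>

definition mean :: "nat set \<Rightarrow> ((nat \<Rightarrow> real) \<Rightarrow> real) \<Rightarrow> real" where
  "mean S f = (\<Sum>w\<in>spins S. f w) / 2 ^ card S"

definition nrm :: "nat set \<Rightarrow> ((nat \<Rightarrow> real) \<Rightarrow> real) \<Rightarrow> real" where
  "nrm S f = mean S (\<lambda>w. \<bar>f w\<bar>)"

text \<open>With \<open>p = 1\<close> and \<open>q = y\<close> a leaf vector, the expectation of \<open>leafprod L p q\<close> is the density at \<open>y\<close> of the spins on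
  \<open>L\<close> with respect to the uniform law. A pair \<open>(1, 0)\<close> removes a leaf, other pairs replace a leaf by a cluster of leaves.\<close>

definition leafprod :: "nat set \<Rightarrow> (nat \<Rightarrow> real) \<Rightarrow> (nat \<Rightarrow> real) \<Rightarrow> (nat \<Rightarrow> real) \<Rightarrow> real" where
  "leafprod L p q x = (\<Prod>l\<in>L. p l + x l * q l)"

lemma mean_mult:
  assumes S: "finite S" and f: "dep C f" "C \<subseteq> S" and g: "dep D g" "D \<subseteq> S" and CD: "C \<inter> D = {}"
  shows "mean S (\<lambda>w. f w * g w) = mean S f * mean S g"
proof -
  let ?R = "S - C"
  have S': "S = C \<union> ?R" "C \<inter> ?R = {}" using f by auto
  have fin: "finite C" "finite ?R" using S S' by (auto intro: finite_subset)
  have card: "card S = card C + card ?R"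
    using card_Un_disjoint[OF fin S'(2)] S'(1) by simp
  have F: "f (\<lambda>k. if k \<in> C then y k else z k) = f y" for y z by (intro depD[OF f(1)]) auto
  have G: "g (\<lambda>k. if k \<in> C then y k else z k) = g z" for y z using CD by (intro depD[OF g(1)]) auto
  have sum: "(\<Sum>w\<in>spins S. h w) = (\<Sum>y\<in>spins C. \<Sum>z\<in>spins ?R. h (\<lambda>k. if k \<in> C then y k else z k))" for h :: "_ \<Rightarrow> real"
    using sum_spins_Un[OF S'(2), of h] S'(1) by simp
  have 1: "(\<Sum>w\<in>spins S. f w * g w) = (\<Sum>y\<in>spins C. f y) * (\<Sum>z\<in>spins ?R. g z)"
    unfolding sum F G by (rule sum_product[symmetric])
  have 2: "(\<Sum>w\<in>spins S. f w) = (\<Sum>y\<in>spins C. f y) * 2 ^ card ?R"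
    unfolding sum F using fin by (simp add: card_spins sum_distrib_right mult.commute)
  have 3: "(\<Sum>w\<in>spins S. g w) = 2 ^ card C * (\<Sum>z\<in>spins ?R. g z)"
    unfolding sum G using fin by (simp add: card_spins)
  show ?thesis unfolding mean_def 1 2 3 card by (simp add: power_add)
qed

lemma mean_mono: "(\<And>w. w \<in> spins S \<Longrightarrow> f w \<le> g w) \<Longrightarrow> mean S f \<le> mean S g"
  unfolding mean_def by (intro divide_right_mono sum_mono) auto

lemma mean_cong: "(\<And>w. w \<in> spins S \<Longrightarrow> f w = g w) \<Longrightarrow> mean S f = mean S g"
  unfolding mean_def by (intro arg_cong2[of _ _ _ _ "(/)"] sum.cong) auto

lemma mean_add: "mean S (\<lambda>w. f w + g w) = mean S f + mean S g"
  unfolding mean_def by (simp add: sum.distrib add_divide_distrib)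

lemma mean_cmult: "mean S (\<lambda>w. c * f w) = c * mean S f"
  unfolding mean_def by (simp add: sum_distrib_left)

lemma mean_const: "finite S \<Longrightarrow> mean S (\<lambda>w. c) = c"
  unfolding mean_def by (simp add: card_spins)

lemma nrm_nonneg: "0 \<le> nrm S f"
  unfolding nrm_def mean_def by (intro divide_nonneg_nonneg sum_nonneg) auto

lemma nrm_zero [simp]: "nrm S (\<lambda>w. 0) = 0"
  by (simp add: nrm_def mean_def)

lemma nrm_triangle: "nrm S (\<lambda>w. f w + g w) \<le> nrm S f + nrm S g"
  unfolding nrm_def mean_add[symmetric] by (rule mean_mono) (rule abs_triangle_ineq)

lemma nrm_triangle_diff: "nrm S (\<lambda>w. f w - g w) \<le> nrm S f + nrm S g"
  unfolding nrm_def mean_add[symmetric] by (rule mean_mono) (rule abs_triangle_ineq4)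

lemma nrm_cmult: "nrm S (\<lambda>w. c * f w) = \<bar>c\<bar> * nrm S f"
  unfolding nrm_def mean_cmult[symmetric] by (simp add: abs_mult)

lemma nrm_mult:
  assumes "finite S" "dep C f" "C \<subseteq> S" "dep D g" "D \<subseteq> S" "C \<inter> D = {}"
  shows "nrm S (\<lambda>w. f w * g w) = nrm S f * nrm S g"
  unfolding nrm_def abs_mult using mean_mult[OF assms(1) dep_abs[OF assms(2)] assms(3) dep_abs[OF assms(4)] assms(5,6)] by simp

lemma leafprod_empty [simp]: "leafprod {} p q = (\<lambda>x. 1)"
  by (simp add: leafprod_def fun_eq_iff)

lemma dep_leafprod: "X \<subseteq> U \<Longrightarrow> dep U (leafprod X p q)"
  unfolding leafprod_def dep_def by (intro allI impI prod.cong refl) auto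

lemma leafprod_Un: "finite X \<Longrightarrow> finite Y \<Longrightarrow> X \<inter> Y = {} \<Longrightarrow>
    leafprod (X \<union> Y) p q x = leafprod X p q x * leafprod Y p q x"
  by (simp add: leafprod_def prod.union_disjoint)

lemma leafprod_insert: "finite X \<Longrightarrow> l \<notin> X \<Longrightarrow>
    leafprod (insert l X) p q x = (p l + x l * q l) * leafprod X p q x"
  by (simp add: leafprod_def)

lemma leafprod_cong: "(\<And>l. l \<in> X \<Longrightarrow> p l = p' l \<and> q l = q' l) \<Longrightarrow> leafprod X p q = leafprod X p' q'"
  unfolding leafprod_def by (intro ext prod.cong) auto

lemma ex_join_leafprod:
  assumes T: "rtree U EU u" "rtree W EW v" "U \<inter> W = {}" and "dep U f" "dep W h" and X: "X \<subseteq> U \<union> W"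
  shows "ex (U \<union> W) (insert {u, v} (EU \<union> EW)) \<theta> (\<lambda>x. f x * h x * leafprod X p q x)
    = ex U EU \<theta> (\<lambda>x. f x * leafprod (X \<inter> U) p q x) * ex W EW \<theta> (\<lambda>x. h x * leafprod (X \<inter> W) p q x)
     + \<theta> {u, v} * ex U EU \<theta> (\<lambda>x. x u * f x * leafprod (X \<inter> U) p q x)
        * ex W EW \<theta> (\<lambda>x. x v * h x * leafprod (X \<inter> W) p q x)"
proof -
  have X': "X = (X \<inter> U) \<union> (X \<inter> W)" "(X \<inter> U) \<inter> (X \<inter> W) = {}" using assms by auto
  have fin: "finite (X \<inter> U)" "finite (X \<inter> W)" using T rtree_props(1) by auto
  have "leafprod X p q x = leafprod (X \<inter> U) p q x * leafprod (X \<inter> W) p q x" for x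
    using leafprod_Un[OF fin X'(2)] X'(1) by metis
  then have eq: "f x * h x * leafprod X p q x = (f x * leafprod (X \<inter> U) p q x) * (h x * leafprod (X \<inter> W) p q x)" for x
    by (metis mult.assoc mult.left_commute)
  then show ?thesis
    unfolding eq
    using ex_join[OF T, of "\<lambda>x. f x * leafprod (X \<inter> U) p q x" "\<lambda>x. h x * leafprod (X \<inter> W) p q x" \<theta>] assms
    by (simp add: dep_mult dep_leafprod mult.assoc)
qed

lemma ex_square: "u \<in> U \<Longrightarrow> ex U E \<theta> (\<lambda>x. x u * x u * f x) = ex U E \<theta> f"
  by (rule ex_cong) (simp add: spins_square)

lemma ex_square': "u \<in> U \<Longrightarrow> ex U E \<theta> (\<lambda>x. x u * (x a * x u) * f x) = ex U E \<theta> (\<lambda>x. x a * f x)"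
  by (rule ex_cong) (use spins_square in \<open>fastforce simp: algebra_simps\<close>)

text \<open>A leaf \<open>l\<close> stands for a cluster \<open>C l\<close> of original leaves. \<open>P l\<close> is the density of the cluster and \<open>Q l\<close> its odd part with
  respect to the cluster root, divided by the correlation between \<open>l\<close> and that root. Since this quotient may exceed
  \<open>P l\<close> pointwise, only the bound of \<open>Q l\<close> by the cluster size \<open>nn l\<close> in mean is available.\<close>

locale clusters =
  fixes S :: "nat set" and L :: "nat set" and P Q :: "nat \<Rightarrow> (nat \<Rightarrow> real) \<Rightarrow> real"
    and C :: "nat \<Rightarrow> nat set" and nn :: "nat \<Rightarrow> real"
  assumes finite_S: "finite S" and finite_L: "finite L"
    and C_sub: "l \<in> L \<Longrightarrow> C l \<subseteq> S"
    and C_disj: "l \<in> L \<Longrightarrow> m \<in> L \<Longrightarrow> l \<noteq> m \<Longrightarrow> C l \<inter> C m = {}"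
    and dep_P: "l \<in> L \<Longrightarrow> dep (C l) (P l)" and dep_Q: "l \<in> L \<Longrightarrow> dep (C l) (Q l)"
    and nrm_Q: "l \<in> L \<Longrightarrow> nrm S (Q l) \<le> nn l" and nn_ge_1: "l \<in> L \<Longrightarrow> 1 \<le> nn l"
begin

text \<open>For fixed cluster spins \<open>w\<close> this is a function of the tree configuration.
  Its expectation is the density of the clusters at \<open>w\<close>, which may be signed.\<close>

definition block :: "nat set \<Rightarrow> (nat \<Rightarrow> real) \<Rightarrow> (nat \<Rightarrow> real) \<Rightarrow> real" where
  "block X w = leafprod X (\<lambda>l. P l w) (\<lambda>l. Q l w)"

lemma dep_block: 
  assumes "X \<subseteq> L"
  shows "dep (\<Union>(C ` X)) (\<lambda>w. ex V E \<theta> (\<lambda>x. h x * block X w x))"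
  unfolding dep_def
proof (intro allI impI)
  fix w w' :: "nat \<Rightarrow> real" assume a: "\<forall>k\<in>\<Union>(C ` X). w k = w' k"
  have "block X w = block X w'"
    unfolding block_def
  proof (rule leafprod_cong)
    fix l assume l: "l \<in> X"
    then have "P l w = P l w'" using a assms by (intro depD[OF dep_P]) auto
    moreover have "Q l w = Q l w'" using a l assms by (intro depD[OF dep_Q]) auto
    ultimately show "P l w = P l w' \<and> Q l w = Q l w'" by simp
  qed
  then show "ex V E \<theta> (\<lambda>x. h x * block X w x) = ex V E \<theta> (\<lambda>x. h x * block X w' x)" by simp
qed

lemma dep_block1: "X \<subseteq> L \<Longrightarrow> dep (\<Union>(C ` X)) (\<lambda>w. ex V E \<theta> (block X w))"
  using dep_block[of X V E \<theta> "\<lambda>x. 1"] by simp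

lemma UC_sub: "X \<subseteq> L \<Longrightarrow> \<Union>(C ` X) \<subseteq> S"
  using C_sub by blast

lemma UC_disj: "X \<subseteq> L \<Longrightarrow> Y \<subseteq> L \<Longrightarrow> X \<inter> Y = {} \<Longrightarrow> \<Union>(C ` X) \<inter> \<Union>(C ` Y) = {}"
  using C_disj by blast

lemma nrm_block_mult:
  assumes "X \<subseteq> L" "Y \<subseteq> L" "X \<inter> Y = {}"
  shows "nrm S (\<lambda>w. ex V E \<theta> (\<lambda>x. h x * block X w x) * ex V' E' \<theta> (\<lambda>x. k x * block Y w x))
     = nrm S (\<lambda>w. ex V E \<theta> (\<lambda>x. h x * block X w x)) * nrm S (\<lambda>w. ex V' E' \<theta> (\<lambda>x. k x * block Y w x))"
  by (rule nrm_mult[OF finite_S dep_block[OF assms(1)] UC_sub[OF assms(1)] dep_block[OF assms(2)] UC_sub[OF assms(2)] UC_disj[OF assms]])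

lemma nrm_block_mult1:
  assumes "X \<subseteq> L" "Y \<subseteq> L" "X \<inter> Y = {}"
  shows "nrm S (\<lambda>w. ex V E \<theta> (\<lambda>x. h x * block X w x) * ex V' E' \<theta> (block Y w))
     = nrm S (\<lambda>w. ex V E \<theta> (\<lambda>x. h x * block X w x)) * nrm S (\<lambda>w. ex V' E' \<theta> (block Y w))"
  using nrm_block_mult[OF assms, of V E \<theta> h V' E' "\<lambda>x. 1"] by simp

lemma nrm_block_mult2:
  assumes "X \<subseteq> L" "Y \<subseteq> L" "X \<inter> Y = {}"
  shows "nrm S (\<lambda>w. ex V' E' \<theta> (block Y w) * ex V E \<theta> (\<lambda>x. h x * block X w x))
     = nrm S (\<lambda>w. ex V' E' \<theta> (block Y w)) * nrm S (\<lambda>w. ex V E \<theta> (\<lambda>x. h x * block X w x))"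
  using nrm_block_mult1[OF assms] by (simp add: mult.commute)

lemma nn_nonneg: "l \<in> L \<Longrightarrow> 0 \<le> nn l"
  using nn_ge_1 by force

text \<open>Norms multiply across a cut; with a superadditive \<open>g\<close> the product for the
  two sides still lies below \<open>exp (g X)\<close>. All subsets are included because the
  recursion meets the restriction of \<open>X\<close> to every subtree.\<close>

definition bounded :: "nat set \<Rightarrow> nat set set \<Rightarrow> (nat set \<Rightarrow> real) \<Rightarrow> (nat set \<Rightarrow> real) \<Rightarrow> nat set \<Rightarrow> bool" where
  "bounded V E \<theta> g X \<longleftrightarrow> X \<subseteq> V \<and> X \<subseteq> L \<and> (\<forall>e\<in>E. \<bar>\<theta> e\<bar> \<le> 1) \<and> (\<forall>B\<subseteq>X. 0 \<le> g B \<and> nrm S (\<lambda>w. ex V E \<theta> (block B w)) \<le> exp (g B))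
     \<and> (\<forall>A\<subseteq>X. \<forall>B\<subseteq>X. A \<inter> B = {} \<longrightarrow> g A + g B \<le> g (A \<union> B))"

text \<open>A block supported on one side has the same expectation in the component as in the whole
  tree, so the bounds are inherited by both sides.\<close>

lemma bounded_join:
  assumes T: "rtree U EU u" "rtree W EW v" "U \<inter> W = {}"
    and b: "bounded (U \<union> W) (insert {u, v} (EU \<union> EW)) \<theta> g X"
  shows "bounded U EU \<theta> g (X \<inter> U)" "bounded W EW \<theta> g (X \<inter> W)"
    and "nrm S (\<lambda>w. ex U EU \<theta> (block (X \<inter> U) w)) \<le> exp (g (X \<inter> U))"
    and "nrm S (\<lambda>w. ex W EW \<theta> (block (X \<inter> W) w)) \<le> exp (g (X \<inter> W))"
    and "exp (g (X \<inter> U)) * exp (g (X \<inter> W)) \<le> exp (g X)"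
    and "exp (g (X \<inter> W)) * exp (g (X \<inter> U)) \<le> exp (g X)"
proof -
  have 1: "ex U EU \<theta> (block B w) = ex (U \<union> W) (insert {u, v} (EU \<union> EW)) \<theta> (block B w)" if "B \<subseteq> X \<inter> U" for B w
    using ex_join_left[OF T, of "block B w" \<theta>] that by (simp add: block_def dep_leafprod)
  have 2: "ex W EW \<theta> (block B w) = ex (U \<union> W) (insert {u, v} (EU \<union> EW)) \<theta> (block B w)" if "B \<subseteq> X \<inter> W" for B w
    using ex_join_right[OF T, of "block B w" \<theta>] that by (simp add: block_def dep_leafprod)
  have "(X \<inter> U) \<union> (X \<inter> W) = X" "(X \<inter> U) \<inter> (X \<inter> W) = {}" using b T(3) by (auto simp: bounded_def)
  with b show "exp (g (X \<inter> U)) * exp (g (X \<inter> W)) \<le> exp (g X)"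
    unfolding bounded_def exp_add[symmetric] exp_le_cancel_iff by (metis inf_le1)
  then show "exp (g (X \<inter> W)) * exp (g (X \<inter> U)) \<le> exp (g X)" by (simp add: mult.commute)
  show bU: "bounded U EU \<theta> g (X \<inter> U)" using b 1 unfolding bounded_def by (auto; metis le_inf_iff)
  show bW: "bounded W EW \<theta> g (X \<inter> W)" using b 2 unfolding bounded_def by (auto; metis le_inf_iff)
  show "nrm S (\<lambda>w. ex U EU \<theta> (block (X \<inter> U) w)) \<le> exp (g (X \<inter> U))" using bU by (auto simp: bounded_def)
  show "nrm S (\<lambda>w. ex W EW \<theta> (block (X \<inter> W) w)) \<le> exp (g (X \<inter> W))" using bW by (auto simp: bounded_def)
qed

text \<open>Unrolling \<open>q = q_U p_W + t p_U q_W\<close> down to the leaves, a leaf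
  \<open>m\<close> contributes the product of the weights on its path from the root, which is
  \<open>cor V E \<theta> u m\<close>, times the norm of \<open>Q m\<close>. The even factors are
  absorbed by \<open>exp (g X)\<close>.\<close>

lemma rooted_bound:
  assumes "rtree V E u" "bounded V E \<theta> g X"
  shows "nrm S (\<lambda>w. ex V E \<theta> (\<lambda>x. x u * block X w x)) \<le> exp (g X) * (\<Sum>m\<in>X. \<bar>cor V E \<theta> u m\<bar> * nn m)"
  using assms
proof (induction arbitrary: X)
  case (single u)
  note T = rtree.single[of u]
  from single have "X = {} \<or> X = {u}" by (auto simp: bounded_def)
  then show ?case
  proof
    assume "X = {}"
    then show ?thesis using ex_coord[OF T, of u \<theta>] by (simp add: block_def)
  next
    assume X: "X = {u}"
    then have uL: "u \<in> L" and g: "0 \<le> g X" using single by (auto simp: bounded_def)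
    have "ex {u} {} \<theta> (\<lambda>x. x u * block X w x) = ex {u} {} \<theta> (\<lambda>x. P u w * x u + Q u w * 1)" for w
      by (rule ex_cong) (simp add: block_def X leafprod_def algebra_simps spins_square)
    then have "ex {u} {} \<theta> (\<lambda>x. x u * block X w x) = Q u w" for w
      using ex_one[OF T, of \<theta>] ex_coord[OF T, of u \<theta>] ex_cmult[of "{u}" "{}" \<theta> "P u w" "\<lambda>x. x u"]
        ex_cmult[of "{u}" "{}" \<theta> "Q u w" "\<lambda>x. 1"]
      unfolding ex_add by simp
    then have "nrm S (\<lambda>w. ex {u} {} \<theta> (\<lambda>x. x u * block X w x)) \<le> 1 * nn u" using nrm_Q[OF uL] by simp
    also have "\<dots> \<le> exp (g X) * nn u" using g nn_nonneg[OF uL] by (intro mult_right_mono) auto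
    finally show ?thesis using cor_refl[OF T, of u \<theta>] X by simp
  qed
next
  case (join U EU u W EW v)
  note T = join.hyps
  let ?V = "U \<union> W" and ?E = "insert {u, v} (EU \<union> EW)" and ?t = "\<theta> {u, v}"
  let ?XU = "X \<inter> U" and ?XW = "X \<inter> W"
  note bj = bounded_join[OF T join.prems]
  have uU: "u \<in> U" and vW: "v \<in> W" using T rtree_props(3) by auto
  have XL: "?XU \<subseteq> L" "?XW \<subseteq> L" and X: "X \<subseteq> U \<union> W" using join.prems by (auto simp: bounded_def)
  have disj: "?XU \<inter> ?XW = {}" "?XW \<inter> ?XU = {}" using T(3) by auto
  let ?qU = "\<lambda>w. ex U EU \<theta> (\<lambda>x. x u * block ?XU w x)" and ?pU = "\<lambda>w. ex U EU \<theta> (block ?XU w)"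
  let ?qW = "\<lambda>w. ex W EW \<theta> (\<lambda>x. x v * block ?XW w x)" and ?pW = "\<lambda>w. ex W EW \<theta> (block ?XW w)"
  let ?sU = "\<Sum>m\<in>?XU. \<bar>cor U EU \<theta> u m\<bar> * nn m" and ?sW = "\<Sum>m\<in>?XW. \<bar>cor W EW \<theta> v m\<bar> * nn m"
  have eq: "ex ?V ?E \<theta> (\<lambda>x. x u * block X w x) = ?qU w * ?pW w + ?t * (?pU w * ?qW w)" for w
    using ex_join_leafprod[OF T dep_coord[OF uU] dep_const[of _ 1] X, of \<theta> "\<lambda>l. P l w" "\<lambda>l. Q l w"]
    by (simp add: block_def ex_square[OF uU])
  have s0: "0 \<le> ?sU" "0 \<le> ?sW" using XL nn_nonneg by (auto intro!: sum_nonneg mult_nonneg_nonneg)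
  have "nrm S (\<lambda>w. ?qU w * ?pW w) = nrm S ?qU * nrm S ?pW"
    by (rule nrm_block_mult1[OF XL disj(1)])
  also have "\<dots> \<le> (exp (g ?XU) * ?sU) * exp (g ?XW)"
    using join.IH(1)[OF bj(1)] bj(4) nrm_nonneg s0 by (intro mult_mono) auto
  also have "\<dots> = (exp (g ?XU) * exp (g ?XW)) * ?sU" by simp
  also have "\<dots> \<le> exp (g X) * ?sU" using bj(5) s0 by (intro mult_right_mono) auto
  finally have 1: "nrm S (\<lambda>w. ?qU w * ?pW w) \<le> exp (g X) * ?sU" .
  have "nrm S (\<lambda>w. ?pU w * ?qW w) = nrm S ?pU * nrm S ?qW"
    by (rule nrm_block_mult2[OF XL(2,1) disj(2)])
  also have "\<dots> \<le> exp (g ?XU) * (exp (g ?XW) * ?sW)"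
    using join.IH(2)[OF bj(2)] bj(3) nrm_nonneg s0 by (intro mult_mono) auto
  also have "\<dots> = (exp (g ?XU) * exp (g ?XW)) * ?sW" by simp
  also have "\<dots> \<le> exp (g X) * ?sW" using bj(5) s0 by (intro mult_right_mono) auto
  finally have 2: "nrm S (\<lambda>w. ?pU w * ?qW w) \<le> exp (g X) * ?sW" .
  have "nrm S (\<lambda>w. ex ?V ?E \<theta> (\<lambda>x. x u * block X w x)) \<le> nrm S (\<lambda>w. ?qU w * ?pW w) + nrm S (\<lambda>w. ?t * (?pU w * ?qW w))"
    unfolding eq by (rule nrm_triangle)
  also have "\<dots> \<le> exp (g X) * ?sU + \<bar>?t\<bar> * (exp (g X) * ?sW)"
    unfolding nrm_cmult using 1 2 by (intro add_mono mult_left_mono) auto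
  also have "\<dots> = exp (g X) * (?sU + \<bar>?t\<bar> * ?sW)" by (simp add: algebra_simps)
  also have "?sU = (\<Sum>m\<in>?XU. \<bar>cor ?V ?E \<theta> u m\<bar> * nn m)"
    using cor_join(1)[OF T uU] by (intro sum.cong) auto
  also have "\<bar>?t\<bar> * ?sW = (\<Sum>m\<in>?XW. \<bar>cor ?V ?E \<theta> u m\<bar> * nn m)"
    using cor_join(3)[OF T uU] cor_refl[OF T(1) uU] unfolding sum_distrib_left
    by (intro sum.cong) (auto simp: abs_mult)
  also have "(\<Sum>m\<in>?XU. \<bar>cor ?V ?E \<theta> u m\<bar> * nn m) + (\<Sum>m\<in>?XW. \<bar>cor ?V ?E \<theta> u m\<bar> * nn m)
      = (\<Sum>m\<in>X. \<bar>cor ?V ?E \<theta> u m\<bar> * nn m)"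
  proof -
    have "X = ?XU \<union> ?XW" using X by auto
    then show ?thesis using sum.union_disjoint[OF _ _ disj(1), of "\<lambda>m. \<bar>cor ?V ?E \<theta> u m\<bar> * nn m"] T rtree_props(1)
      by auto
  qed
  finally show ?case .
qed

end

section \<open>Sliding a leaf along a path\<close>

text \<open>\<open>k * X\<close> lies between \<open>Y\<close> and \<open>X\<close>: shrinking
  \<open>X\<close> by \<open>k\<close> does not carry it past \<open>Y\<close>.\<close>

lemma scaled_diff_le:
  fixes X Y k :: real
  assumes "\<bar>Y\<bar> \<le> k * \<bar>X\<bar>" "0 \<le> k" "k \<le> 1"
  shows "\<bar>k * X - Y\<bar> \<le> \<bar>X - Y\<bar>" "(1 - k) * \<bar>X\<bar> \<le> \<bar>X - Y\<bar>"
proof -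
  have "k * \<bar>X\<bar> \<le> \<bar>X\<bar>" using assms by (simp add: mult_left_le_one_le)
  show "(1 - k) * \<bar>X\<bar> \<le> \<bar>X - Y\<bar>" using assms by (simp add: algebra_simps)
  show "\<bar>k * X - Y\<bar> \<le> \<bar>X - Y\<bar>"
  proof (cases "0 \<le> X")
    case True
    then have "Y \<le> k * X" "k * X \<le> X" using assms \<open>k * \<bar>X\<bar> \<le> \<bar>X\<bar>\<close> by auto
    then show ?thesis by linarith
  next
    case False
    then have "k * X \<le> Y" "X \<le> k * X" using assms \<open>k * \<bar>X\<bar> \<le> \<bar>X\<bar>\<close> by auto
    then show ?thesis by linarith
  qed
qed

lemma abs_diff_scaled: "0 \<le> k \<Longrightarrow> k \<le> 1 \<Longrightarrow> \<bar>X - k * X\<bar> = (1 - k) * \<bar>X\<bar>" for X k :: real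
proof -
  assume "0 \<le> k" "k \<le> 1"
  then have "\<bar>(1 - k) * X\<bar> = (1 - k) * \<bar>X\<bar>" by (simp add: abs_mult)
  then show ?thesis by (simp add: algebra_simps)
qed

text \<open>A discrete intermediate value principle, used to locate the edge where two sliding
  leaves should meet.\<close>

lemma rtrancl_crossing:
  assumes "(a, b) \<in> R\<^sup>*" "P a" "\<not> P b"
  obtains u v where "(u, v) \<in> R" "P u" "\<not> P v"
  using assms by (induction rule: rtrancl_induct) blast+

lemma split_atD:
  assumes "split_at V E a b u v U EU W EW"
  shows "rtree U EU u" "rtree W EW v" "U \<inter> W = {}" "V = U \<union> W" "E = insert {u, v} (EU \<union> EW)" "a \<in> U" "b \<in> W"
    "u \<in> U" "v \<in> W" "u \<in> V" "v \<in> V" "{u, v} \<in> E" "rtree V E u"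
proof -
  show *: "rtree U EU u" "rtree W EW v" "U \<inter> W = {}" "V = U \<union> W" "E = insert {u, v} (EU \<union> EW)" "a \<in> U" "b \<in> W"
    using assms by (auto simp: split_at_def)
  then show "u \<in> U" "v \<in> W" using rtree_props(3) by auto
  then show "u \<in> V" "v \<in> V" "{u, v} \<in> E" using * by auto
  show "rtree V E u" using rtree.join[OF *(1-3)] * by simp
qed

lemma split_cor:
  assumes s: "split_at V E a b u v U EU W EW"
  shows "i \<in> U \<Longrightarrow> cor V E \<theta> i v = cor V E \<theta> i u * \<theta> {u, v}"
    "j \<in> W \<Longrightarrow> cor V E \<theta> u j = \<theta> {u, v} * cor V E \<theta> v j"
    "i \<in> U \<Longrightarrow> j \<in> W \<Longrightarrow> cor V E \<theta> i j = cor V E \<theta> i u * \<theta> {u, v} * cor V E \<theta> v j"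
proof -
  note d = split_atD[OF s]
  note c = cor_join[OF d(1-3), of _ _ \<theta>, folded d(4,5)]
  show 3: "cor V E \<theta> i j = cor V E \<theta> i u * \<theta> {u, v} * cor V E \<theta> v j" if "i \<in> U" "j \<in> W" for i j
    using c(3)[OF that] c(1)[OF that(1) d(8)] c(2)[OF d(9) that(2)] by simp
  show "i \<in> U \<Longrightarrow> cor V E \<theta> i v = cor V E \<theta> i u * \<theta> {u, v}"
    using 3[OF _ d(9), of i] cor_refl[OF d(13) d(11)] by simp
  show "j \<in> W \<Longrightarrow> cor V E \<theta> u j = \<theta> {u, v} * cor V E \<theta> v j"
    using 3[OF d(8), of j] cor_refl[OF d(13) d(10)] by simp
qed

context clusters
begin

definition spin_ex where "spin_ex V E \<theta> i X = (\<lambda>w. ex V E \<theta> (\<lambda>x. x i * block X w x))"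

text \<open>Cutting the edge leaves products with one factor per side. The third combination is
  chosen so that the terms with \<open>Au\<close> cancel and only a product of two odd parts
  survives.\<close>

lemma split_identities:
  fixes \<theta> :: "nat set \<Rightarrow> real"
  assumes s: "split_at V E a b u v U EU W EW" and X: "X \<subseteq> V"
  defines "t \<equiv> \<theta> {u, v}"
  defines "qU \<equiv> spin_ex U EU \<theta> u (X \<inter> U)" and "pU \<equiv> \<lambda>w. ex U EU \<theta> (block (X \<inter> U) w)"
    and "qW \<equiv> spin_ex W EW \<theta> v (X \<inter> W)" and "pW \<equiv> \<lambda>w. ex W EW \<theta> (block (X \<inter> W) w)"
  shows "spin_ex V E \<theta> u X w = qU w * pW w + t * (pU w * qW w)"
    and "spin_ex V E \<theta> v X w = pU w * qW w + t * (qU w * pW w)"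
    and "ex V E \<theta> (\<lambda>x. x a * x v * block X w x) - t * ex V E \<theta> (\<lambda>x. x a * x u * block X w x)
       = (1 - t * t) * (spin_ex U EU \<theta> a (X \<inter> U) w * qW w)"
proof -
  note d = split_atD[OF s]
  have X: "X \<subseteq> U \<union> W" using X d by simp
  note J = ex_join_leafprod[OF d(1-3) _ _ X, of _ _ \<theta> "\<lambda>l. P l w" "\<lambda>l. Q l w", folded d(4,5), folded block_def t_def]
  note defs = qU_def qW_def pU_def pW_def spin_ex_def
  show "spin_ex V E \<theta> u X w = qU w * pW w + t * (pU w * qW w)"
    using J[OF dep_coord[OF d(8)] dep_const[of _ 1]] ex_square[OF d(8), of EU \<theta> "block (X \<inter> U) w"]
    by (simp add: defs)
  show "spin_ex V E \<theta> v X w = pU w * qW w + t * (qU w * pW w)"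
    using J[OF dep_const[of _ 1] dep_coord[OF d(9)]] ex_square[OF d(9), of EW \<theta> "block (X \<inter> W) w"]
    by (simp add: defs)
  define Aq where "Aq = spin_ex U EU \<theta> a (X \<inter> U) w"
  define Au where "Au = ex U EU \<theta> (\<lambda>x. x u * x a * block (X \<inter> U) w x)"
  have 1: "ex V E \<theta> (\<lambda>x. x a * x v * block X w x) = Aq * qW w + t * Au * pW w"
    using J[OF dep_coord[OF d(6)] dep_coord[OF d(9)]] ex_square[OF d(9), of EW \<theta> "block (X \<inter> W) w"]
    by (simp add: defs Aq_def Au_def)
  have 2: "ex V E \<theta> (\<lambda>x. x a * x u * block X w x) = Au * pW w + t * Aq * qW w"
    using J[OF dep_mult[OF dep_coord[OF d(6)] dep_coord[OF d(8)]] dep_const[of _ 1]]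
      ex_square'[OF d(8), of EU \<theta> a "block (X \<inter> U) w"]
    by (simp add: defs Aq_def Au_def mult.commute[of "_ a" "_ u"])
  show "ex V E \<theta> (\<lambda>x. x a * x v * block X w x) - t * ex V E \<theta> (\<lambda>x. x a * x u * block X w x)
       = (1 - t * t) * (spin_ex U EU \<theta> a (X \<inter> U) w * qW w)"
    unfolding 1 2 Aq_def[symmetric] by (simp add: algebra_simps)
qed

lemma split_bounds:
  fixes \<theta> :: "nat set \<Rightarrow> real"
  assumes s: "split_at V E a b u v U EU W EW" and b: "bounded V E \<theta> g X"
  defines "qU \<equiv> spin_ex U EU \<theta> u (X \<inter> U)" and "pU \<equiv> \<lambda>w. ex U EU \<theta> (block (X \<inter> U) w)"
    and "qW \<equiv> spin_ex W EW \<theta> v (X \<inter> W)" and "pW \<equiv> \<lambda>w. ex W EW \<theta> (block (X \<inter> W) w)"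
  shows "nrm S (\<lambda>w. qU w * pW w) \<le> exp (g X) * (\<Sum>m\<in>X \<inter> U. \<bar>cor V E \<theta> u m\<bar> * nn m)"
    and "nrm S (\<lambda>w. pU w * qW w) \<le> exp (g X) * (\<Sum>m\<in>X \<inter> W. \<bar>cor V E \<theta> v m\<bar> * nn m)"
    and "nrm S (\<lambda>w. spin_ex U EU \<theta> a (X \<inter> U) w * qW w)
      \<le> exp (g X) * ((\<Sum>m\<in>X \<inter> U. \<bar>cor V E \<theta> a m\<bar> * nn m) * (\<Sum>m\<in>X \<inter> W. \<bar>cor V E \<theta> v m\<bar> * nn m))"
proof -
  note d = split_atD[OF s]
  note defs = qU_def qW_def pU_def pW_def spin_ex_def
  note bj = bounded_join[OF d(1-3), folded d(4,5), OF b]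
  note c = cor_join[OF d(1-3), of _ _ \<theta>, folded d(4,5)]
  have XL: "X \<inter> U \<subseteq> L" "X \<inter> W \<subseteq> L" using b by (auto simp: bounded_def)
  have disj: "(X \<inter> U) \<inter> (X \<inter> W) = {}" "(X \<inter> W) \<inter> (X \<inter> U) = {}" using d(3) by auto
  define sU where "sU = (\<lambda>i. \<Sum>m\<in>X \<inter> U. \<bar>cor V E \<theta> i m\<bar> * nn m)"
  define sW where "sW = (\<Sum>m\<in>X \<inter> W. \<bar>cor V E \<theta> v m\<bar> * nn m)"
  have s0: "0 \<le> sU i" "0 \<le> sW" for i
    using XL nn_nonneg by (auto intro!: sum_nonneg mult_nonneg_nonneg simp: sU_def sW_def)
  have U: "nrm S (spin_ex U EU \<theta> i (X \<inter> U)) \<le> exp (g (X \<inter> U)) * sU i" if "i \<in> U" for i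
    using rooted_bound[OF rtree_reroot[OF d(1) that] bj(1)] c(1)[OF that] by (simp add: sU_def spin_ex_def)
  have W: "nrm S qW \<le> exp (g (X \<inter> W)) * sW"
    using rooted_bound[OF d(2) bj(2)] c(2)[OF d(9)] by (simp add: sW_def spin_ex_def qW_def)
  have "nrm S (\<lambda>w. qU w * pW w) = nrm S qU * nrm S pW"
    unfolding defs by (rule nrm_block_mult1[OF XL disj(1)])
  also have "\<dots> \<le> (exp (g (X \<inter> U)) * sU u) * exp (g (X \<inter> W))"
    using U[OF d(8)] bj(4) nrm_nonneg s0 unfolding qU_def pW_def by (intro mult_mono) auto
  also have "\<dots> = (exp (g (X \<inter> U)) * exp (g (X \<inter> W))) * sU u" by simp
  also have "\<dots> \<le> exp (g X) * sU u" using bj(5) s0 by (intro mult_right_mono) auto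
  finally show "nrm S (\<lambda>w. qU w * pW w) \<le> exp (g X) * (\<Sum>m\<in>X \<inter> U. \<bar>cor V E \<theta> u m\<bar> * nn m)"
    by (simp add: sU_def)
  have "nrm S (\<lambda>w. pU w * qW w) = nrm S pU * nrm S qW"
    unfolding defs by (rule nrm_block_mult2[OF XL(2,1) disj(2)])
  also have "\<dots> \<le> exp (g (X \<inter> U)) * (exp (g (X \<inter> W)) * sW)"
    using W bj(3) nrm_nonneg s0 unfolding pU_def by (intro mult_mono) auto
  also have "\<dots> = (exp (g (X \<inter> U)) * exp (g (X \<inter> W))) * sW" by simp
  also have "\<dots> \<le> exp (g X) * sW" using bj(5) s0 by (intro mult_right_mono) auto
  finally show "nrm S (\<lambda>w. pU w * qW w) \<le> exp (g X) * (\<Sum>m\<in>X \<inter> W. \<bar>cor V E \<theta> v m\<bar> * nn m)"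
    by (simp add: sW_def)
  have "nrm S (\<lambda>w. spin_ex U EU \<theta> a (X \<inter> U) w * qW w) = nrm S (spin_ex U EU \<theta> a (X \<inter> U)) * nrm S qW"
    unfolding defs by (rule nrm_block_mult[OF XL disj(1)])
  also have "\<dots> \<le> (exp (g (X \<inter> U)) * sU a) * (exp (g (X \<inter> W)) * sW)"
    using U[OF d(6)] W nrm_nonneg s0 by (intro mult_mono) auto
  also have "\<dots> = (exp (g (X \<inter> U)) * exp (g (X \<inter> W))) * (sU a * sW)" by simp
  also have "\<dots> \<le> exp (g X) * (sU a * sW)" using bj(5) s0 by (intro mult_right_mono) auto
  finally show "nrm S (\<lambda>w. spin_ex U EU \<theta> a (X \<inter> U) w * qW w)
      \<le> exp (g X) * ((\<Sum>m\<in>X \<inter> U. \<bar>cor V E \<theta> a m\<bar> * nn m) * (\<Sum>m\<in>X \<inter> W. \<bar>cor V E \<theta> v m\<bar> * nn m))"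
    by (simp add: sU_def sW_def)
qed

lemma sum_split: "X \<subseteq> U \<union> W \<Longrightarrow> U \<inter> W = {} \<Longrightarrow> X \<subseteq> L \<Longrightarrow>
   (\<Sum>m\<in>X. f m) = (\<Sum>m\<in>X \<inter> U. f m) + (\<Sum>m\<in>X \<inter> W. (f m :: real))"
proof -
  assume a: "X \<subseteq> U \<union> W" "U \<inter> W = {}" "X \<subseteq> L"
  then have "finite X" using finite_L finite_subset by blast
  moreover have "X = (X \<inter> U) \<union> (X \<inter> W)" "(X \<inter> U) \<inter> (X \<inter> W) = {}" using a by auto
  ultimately show ?thesis using sum.union_disjoint[of "X \<inter> U" "X \<inter> W" f] by auto
qed

text \<open>Moving the reference point from \<open>u\<close> to \<open>v\<close> adds
  \<open>cor a u * (1 - t * t)\<close> times the odd part of the near side. On the right, the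
  summands of leaves on the near side grow accordingly, while leaves beyond the edge keep
  theirs.\<close>

lemma slide_bound:
  assumes T: "rtree V E a" and z: "z \<in> V" and b: "bounded V E \<theta> g X"
  shows "nrm S (\<lambda>w. spin_ex V E \<theta> a X w - cor V E \<theta> a z * spin_ex V E \<theta> z X w)
    \<le> exp (g X) * (\<Sum>m\<in>X. \<bar>cor V E \<theta> a m - cor V E \<theta> a z * cor V E \<theta> z m\<bar> * nn m)"
  using path_exists[OF T z]
proof (induction rule: rtrancl_induct)
  case base
  show ?case using cor_refl[OF T, of a \<theta>] rtree_props(3)[OF T] by simp
next
  case (step u v)
  then obtain U EU W EW where s: "split_at V E a z u v U EU W EW" by (auto simp: path_step_def)
  note d = split_atD[OF s]
  have XV: "X \<subseteq> V" "X \<subseteq> L" and th: "\<And>e. e \<in> E \<Longrightarrow> \<bar>\<theta> e\<bar> \<le> 1" using b by (auto simp: bounded_def)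
  define t where "t = \<theta> {u, v}"
  have t: "\<bar>t\<bar> \<le> 1" using th[OF d(12)] by (simp add: t_def)
  then have t2: "t * t \<le> 1" using abs_square_le_1[of t] by (simp add: power2_eq_square)
  let ?c = "cor V E \<theta>"
  have cav: "?c a v = ?c a u * t" using split_cor(1)[OF s d(6)] by (simp add: t_def)
  define G where "G = (\<lambda>w. spin_ex U EU \<theta> u (X \<inter> U) w * ex W EW \<theta> (block (X \<inter> W) w))"
  have eq: "spin_ex V E \<theta> a X w - ?c a v * spin_ex V E \<theta> v X w
      = (spin_ex V E \<theta> a X w - ?c a u * spin_ex V E \<theta> u X w) + (?c a u * (1 - t * t)) * G w" for w
    unfolding cav split_identities(1,2)[OF s XV(1), of \<theta> w, folded t_def] G_def by (simp add: algebra_simps)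
  have "nrm S (\<lambda>w. spin_ex V E \<theta> a X w - ?c a v * spin_ex V E \<theta> v X w)
     \<le> exp (g X) * (\<Sum>m\<in>X. \<bar>?c a m - ?c a u * ?c u m\<bar> * nn m)
       + \<bar>?c a u * (1 - t * t)\<bar> * (exp (g X) * (\<Sum>m\<in>X \<inter> U. \<bar>?c u m\<bar> * nn m))"
    unfolding eq
    by (rule order_trans[OF nrm_triangle add_mono[OF step.IH]])
      (unfold nrm_cmult G_def, intro mult_left_mono split_bounds(1)[OF s b] abs_ge_zero)
  also have "\<dots> = exp (g X) * ((\<Sum>m\<in>X. \<bar>?c a m - ?c a u * ?c u m\<bar> * nn m)
       + (\<Sum>m\<in>X \<inter> U. \<bar>?c a u\<bar> * (1 - t * t) * \<bar>?c u m\<bar> * nn m))"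
  proof -
    have "(\<Sum>m\<in>X \<inter> U. \<bar>?c a u\<bar> * (1 - t * t) * \<bar>?c u m\<bar> * nn m)
      = \<bar>?c a u * (1 - t * t)\<bar> * (\<Sum>m\<in>X \<inter> U. \<bar>?c u m\<bar> * nn m)"
      using t2 by (simp add: sum_distrib_left abs_mult mult.assoc)
    then show ?thesis by (simp only: distrib_left mult.left_commute)
  qed
  also have "\<dots> \<le> exp (g X) * (\<Sum>m\<in>X. \<bar>?c a m - ?c a v * ?c v m\<bar> * nn m)"
  proof (intro mult_left_mono)
    \<comment> \<open>In fact an equality, since
      \<open>(1 - k) + (1 - t * t) * k = 1 - t * t * k\<close>: the cost of a leaf telescopes along
      the path.\<close>
    have 1: "\<bar>?c a m - ?c a u * ?c u m\<bar> + \<bar>?c a u\<bar> * (1 - t * t) * \<bar>?c u m\<bar> \<le> \<bar>?c a m - ?c a v * ?c v m\<bar>" if m: "m \<in> U" for m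
    proof -
      have "a \<in> V" "m \<in> V" using d m by auto
      from cor_mult[where \<theta>=\<theta>, OF T th this(1) d(10) this(2)]
      obtain k where k: "0 \<le> k" "k \<le> 1" "?c a u * ?c u m = k * ?c a m" by blast
      have "?c v m = ?c u m * t" using split_cor(1)[OF s m, of \<theta>] cor_sym[of V E \<theta>] by (simp add: t_def)
      then have e: "?c a v * ?c v m = (t * t * k) * ?c a m" using k(3) cav by (simp add: algebra_simps)
      have tk: "0 \<le> t * t * k" "t * t * k \<le> 1" using mult_le_one[of "t * t" k] t2 k by auto
      then have "\<bar>?c a m - ?c a v * ?c v m\<bar> = (1 - t * t * k) * \<bar>?c a m\<bar>"
        unfolding e by (rule abs_diff_scaled)
      moreover have "\<bar>?c a m - ?c a u * ?c u m\<bar> = (1 - k) * \<bar>?c a m\<bar>"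
        unfolding k(3) by (rule abs_diff_scaled[OF k(1,2)])
      moreover have "\<bar>?c a u\<bar> * (1 - t * t) * \<bar>?c u m\<bar> = (1 - t * t) * (k * \<bar>?c a m\<bar>)"
      proof -
        have "\<bar>?c a u\<bar> * \<bar>?c u m\<bar> = k * \<bar>?c a m\<bar>" using arg_cong[OF k(3), of abs] k(1) by (simp add: abs_mult)
        then show ?thesis by (simp add: algebra_simps)
      qed
      ultimately show ?thesis by (simp add: algebra_simps)
    qed
    have 2: "\<bar>?c a m - ?c a u * ?c u m\<bar> = \<bar>?c a m - ?c a v * ?c v m\<bar>" if m: "m \<in> W" for m
      using split_cor(2)[OF s m, of \<theta>] cav by (simp add: t_def)
    have XUW: "X \<subseteq> U \<union> W" using XV d by simp
    note ss = sum_split[OF XUW d(3) XV(2)]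
    have "(\<Sum>m\<in>X \<inter> U. \<bar>?c a m - ?c a u * ?c u m\<bar> * nn m) + (\<Sum>m\<in>X \<inter> U. \<bar>?c a u\<bar> * (1 - t * t) * \<bar>?c u m\<bar> * nn m)
       \<le> (\<Sum>m\<in>X \<inter> U. \<bar>?c a m - ?c a v * ?c v m\<bar> * nn m)"
      unfolding sum.distrib[symmetric] distrib_right[symmetric] using 1 nn_nonneg XV
      by (intro sum_mono mult_right_mono) auto
    moreover have "(\<Sum>m\<in>X \<inter> W. \<bar>?c a m - ?c a u * ?c u m\<bar> * nn m) = (\<Sum>m\<in>X \<inter> W. \<bar>?c a m - ?c a v * ?c v m\<bar> * nn m)"
      using 2 by (intro sum.cong) auto
    ultimately show "(\<Sum>m\<in>X. \<bar>?c a m - ?c a u * ?c u m\<bar> * nn m) + (\<Sum>m\<in>X \<inter> U. \<bar>?c a u\<bar> * (1 - t * t) * \<bar>?c u m\<bar> * nn m)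
      \<le> (\<Sum>m\<in>X. \<bar>?c a m - ?c a v * ?c v m\<bar> * nn m)"
      unfolding ss[of "\<lambda>m. \<bar>?c a m - ?c a u * ?c u m\<bar> * nn m"] ss[of "\<lambda>m. \<bar>?c a m - ?c a v * ?c v m\<bar> * nn m"] by linarith
  qed simp
  finally show ?case .
qed

text \<open>Slide \<open>a\<close> and \<open>b\<close> towards each other along their path up to the edge where \<open>\<bar>r * cor a w\<bar>\<close> drops below \<open>\<bar>cor b w\<bar>\<close>;
  then no term of the error overshoots \<open>\<bar>cor b m - r * cor a m\<bar>\<close>.\<close>

lemma transfer_bound:
  assumes T: "rtree V E a" and z: "b \<in> V" and bd: "bounded V E \<theta> g X" and r: "\<bar>r\<bar> \<le> 1"
  shows "nrm S (\<lambda>w. spin_ex V E \<theta> b X w - r * spin_ex V E \<theta> a X w)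
    \<le> exp (g X) * (\<Sum>m\<in>X. 2 * \<bar>cor V E \<theta> b m - r * cor V E \<theta> a m\<bar> * nn m)"
proof -
  let ?c = "cor V E \<theta>"
  have aV: "a \<in> V" using T rtree_props(3) by auto
  have Tb: "rtree V E b" by (rule rtree_reroot[OF T z])
  have XV: "X \<subseteq> V" "X \<subseteq> L" and th: "\<And>e. e \<in> E \<Longrightarrow> \<bar>\<theta> e\<bar> \<le> 1" using bd by (auto simp: bounded_def)
  show ?thesis
  proof (cases "\<bar>r\<bar> \<le> \<bar>?c a b\<bar>")
    \<comment> \<open>Here \<open>b\<close> can be slid all the way to \<open>a\<close>, after which
      the coefficient \<open>?c b a\<close> is corrected to \<open>r\<close>. The case condition
      gives \<open>scaled_diff_le\<close> its hypothesis, with the factor \<open>k\<close> of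
      \<open>cor_mult\<close>.\<close>
    case True
    have eq: "spin_ex V E \<theta> b X w - r * spin_ex V E \<theta> a X w = (spin_ex V E \<theta> b X w - ?c b a * spin_ex V E \<theta> a X w) + (?c b a - r) * spin_ex V E \<theta> a X w" for w
      by (simp add: algebra_simps)
    have "nrm S (\<lambda>w. spin_ex V E \<theta> b X w - r * spin_ex V E \<theta> a X w)
     \<le> exp (g X) * (\<Sum>m\<in>X. \<bar>?c b m - ?c b a * ?c a m\<bar> * nn m) + \<bar>?c b a - r\<bar> * (exp (g X) * (\<Sum>m\<in>X. \<bar>?c a m\<bar> * nn m))"
      unfolding eq
      by (rule order_trans[OF nrm_triangle add_mono[OF slide_bound[OF Tb aV bd]]])
        (unfold nrm_cmult spin_ex_def, intro mult_left_mono rooted_bound[OF T bd] abs_ge_zero)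
    also have "\<dots> = exp (g X) * (\<Sum>m\<in>X. (\<bar>?c b m - ?c b a * ?c a m\<bar> + \<bar>(?c b a - r) * ?c a m\<bar>) * nn m)"
    proof -
      have "(\<Sum>m\<in>X. (\<bar>?c b m - ?c b a * ?c a m\<bar> + \<bar>(?c b a - r) * ?c a m\<bar>) * nn m)
        = (\<Sum>m\<in>X. \<bar>?c b m - ?c b a * ?c a m\<bar> * nn m) + \<bar>?c b a - r\<bar> * (\<Sum>m\<in>X. \<bar>?c a m\<bar> * nn m)"
        unfolding distrib_right sum.distrib abs_mult sum_distrib_left by (simp only: mult.assoc)
      then show ?thesis by (simp only: distrib_left mult.left_commute)
    qed
    also have "\<dots> \<le> exp (g X) * (\<Sum>m\<in>X. 2 * \<bar>?c b m - r * ?c a m\<bar> * nn m)"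
    proof (intro mult_left_mono sum_mono mult_right_mono)
      fix m assume m: "m \<in> X"
      then have "m \<in> V" using XV by auto
      from cor_mult[where \<theta>=\<theta>, OF T th z aV this] obtain k where k: "0 \<le> k" "k \<le> 1" "?c b a * ?c a m = k * ?c b m" by blast
      have "\<bar>r * ?c a m\<bar> \<le> \<bar>?c b a * ?c a m\<bar>" using True cor_sym[of V E \<theta> a b]
        unfolding abs_mult by (intro mult_right_mono) auto
      then have le: "\<bar>r * ?c a m\<bar> \<le> k * \<bar>?c b m\<bar>" unfolding k(3) using k(1) by (simp add: abs_mult)
      have "\<bar>?c b m - ?c b a * ?c a m\<bar> = (1 - k) * \<bar>?c b m\<bar>"
        unfolding k(3) by (rule abs_diff_scaled[OF k(1,2)])
      moreover have "(?c b a - r) * ?c a m = k * ?c b m - r * ?c a m" using k(3) by (simp add: algebra_simps)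
      ultimately show "\<bar>?c b m - ?c b a * ?c a m\<bar> + \<bar>(?c b a - r) * ?c a m\<bar> \<le> 2 * \<bar>?c b m - r * ?c a m\<bar>"
        using scaled_diff_le[OF le k(1,2)] by simp
    next
      fix m assume "m \<in> X" then show "0 \<le> nn m" using XV nn_nonneg by auto
    qed auto
    finally show ?thesis .
  next
    case False
    let ?Pr = "\<lambda>z. \<bar>?c b z\<bar> < \<bar>r * ?c a z\<bar>"
    have "?Pr a" using False cor_refl[OF T aV, of \<theta>] cor_sym[of V E \<theta> a b] by simp
    moreover have "\<not> ?Pr b"
    proof -
      have "\<bar>r * ?c a b\<bar> \<le> \<bar>r\<bar> * 1" using False r unfolding abs_mult by (intro mult_left_mono) auto
      then show ?thesis using cor_refl[OF T z, of \<theta>] r by simp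
    qed
    ultimately obtain u v where uv: "(u, v) \<in> path_step V E a b" "?Pr u" "\<not> ?Pr v"
      using rtrancl_crossing[OF path_exists[OF T z], of ?Pr] by blast
    then obtain U EU W EW where s: "split_at V E a b u v U EU W EW" by (auto simp: path_step_def)
    note d = split_atD[OF s]
    define t where "t = \<theta> {u, v}"
    have cav: "?c a v = ?c a u * t" using split_cor(1)[OF s d(6)] by (simp add: t_def)
    have cbu: "?c b u = ?c b v * t" using split_cor(2)[OF s d(7)] by (simp add: t_def cor_sym[of V E \<theta> b])
    define G where "G = (\<lambda>w. spin_ex U EU \<theta> u (X \<inter> U) w * ex W EW \<theta> (block (X \<inter> W) w))"
    define H where "H = (\<lambda>w. ex U EU \<theta> (block (X \<inter> U) w) * spin_ex W EW \<theta> v (X \<inter> W) w)"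
    \<comment> \<open>Now \<open>b\<close> is slid only to \<open>v\<close> and \<open>a\<close>
      only to \<open>u\<close>. The remainder involves the odd parts at the two ends of one edge;
      its coefficients at \<open>G\<close> and \<open>H\<close> are the differences of the
      correlations with \<open>b\<close> and \<open>r\<close> times those with \<open>a\<close>,
      taken at \<open>u\<close> and at \<open>v\<close>.\<close>
    have eq: "spin_ex V E \<theta> b X w - r * spin_ex V E \<theta> a X w
       = ((spin_ex V E \<theta> b X w - ?c b v * spin_ex V E \<theta> v X w) - r * (spin_ex V E \<theta> a X w - ?c a u * spin_ex V E \<theta> u X w))
       + ((?c b u - r * ?c a u) * G w + (?c b v - r * ?c a v) * H w)" for w
      unfolding cav cbu split_identities(1,2)[OF s XV(1), of \<theta> w, folded t_def] G_def H_def by (simp add: algebra_simps)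
    have "nrm S (\<lambda>w. spin_ex V E \<theta> b X w - r * spin_ex V E \<theta> a X w) \<le>
       (exp (g X) * (\<Sum>m\<in>X. \<bar>?c b m - ?c b v * ?c v m\<bar> * nn m) + \<bar>r\<bar> * (exp (g X) * (\<Sum>m\<in>X. \<bar>?c a m - ?c a u * ?c u m\<bar> * nn m)))
       + (\<bar>?c b u - r * ?c a u\<bar> * (exp (g X) * (\<Sum>m\<in>X \<inter> U. \<bar>?c u m\<bar> * nn m))
        + \<bar>?c b v - r * ?c a v\<bar> * (exp (g X) * (\<Sum>m\<in>X \<inter> W. \<bar>?c v m\<bar> * nn m)))"
      unfolding eq
      apply (rule order_trans[OF nrm_triangle], rule add_mono)
       apply (rule order_trans[OF nrm_triangle_diff], rule add_mono[OF slide_bound[OF Tb d(11) bd]])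
       apply (unfold nrm_cmult)[1]
       apply (rule mult_left_mono[OF slide_bound[OF T d(10) bd] abs_ge_zero])
      apply (rule order_trans[OF nrm_triangle], rule add_mono; unfold nrm_cmult G_def H_def)
       apply (intro mult_left_mono split_bounds(1)[OF s bd] abs_ge_zero)
      apply (intro mult_left_mono split_bounds(2)[OF s bd] abs_ge_zero)
      done
    also have "\<dots> = exp (g X) * ((\<Sum>m\<in>X. \<bar>?c b m - ?c b v * ?c v m\<bar> * nn m) + (\<Sum>m\<in>X. \<bar>r\<bar> * \<bar>?c a m - ?c a u * ?c u m\<bar> * nn m)
       + (\<Sum>m\<in>X \<inter> U. \<bar>?c b u - r * ?c a u\<bar> * \<bar>?c u m\<bar> * nn m)
        + (\<Sum>m\<in>X \<inter> W. \<bar>?c b v - r * ?c a v\<bar> * \<bar>?c v m\<bar> * nn m))"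
      by (simp add: algebra_simps sum_distrib_left)
    also have "\<dots> \<le> exp (g X) * (\<Sum>m\<in>X. 2 * \<bar>?c b m - r * ?c a m\<bar> * nn m)"
    proof (intro mult_left_mono)
      have XUW: "X \<subseteq> U \<union> W" using XV d by simp
      note ss = sum_split[OF XUW d(3) XV(2)]
      have 1: "\<bar>?c b m - ?c b v * ?c v m\<bar> + \<bar>r\<bar> * \<bar>?c a m - ?c a u * ?c u m\<bar> + \<bar>?c b u - r * ?c a u\<bar> * \<bar>?c u m\<bar>
          \<le> 2 * \<bar>?c b m - r * ?c a m\<bar>" if m: "m \<in> U" for m
      proof -
        have mV: "m \<in> V" using d m by auto
        from cor_mult[where \<theta>=\<theta>, OF T th aV d(10) mV] obtain k where k: "0 \<le> k" "k \<le> 1" "?c a u * ?c u m = k * ?c a m" by blast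
        have cvm: "?c v m = ?c u m * t" using split_cor(1)[OF s m, of \<theta>] cor_sym[of V E \<theta> _ m] by (simp add: t_def)
        have cbm: "?c b m = ?c b u * ?c u m"
          using split_cor(3)[OF s m d(7), of \<theta>] cbu cor_sym[of V E \<theta> _ m] cor_sym[of V E \<theta> b] by (simp add: t_def)
        have z1: "?c b m - ?c b v * ?c v m = 0" using cbm cvm cbu by simp
        have "\<bar>?c b m\<bar> \<le> \<bar>r * ?c a u\<bar> * \<bar>?c u m\<bar>" unfolding cbm abs_mult[of "?c b u"]
          using uv(2) by (intro mult_right_mono) auto
        also have "\<dots> = k * \<bar>r * ?c a m\<bar>" using arg_cong[OF k(3), of "\<lambda>y. \<bar>r * y\<bar>"] k(1) by (simp add: abs_mult)
        finally have le: "\<bar>?c b m\<bar> \<le> k * \<bar>r * ?c a m\<bar>" .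
        have e2: "\<bar>r\<bar> * \<bar>?c a m - ?c a u * ?c u m\<bar> = (1 - k) * \<bar>r * ?c a m\<bar>"
        proof -
          have "r * (?c a m - ?c a u * ?c u m) = (1 - k) * (r * ?c a m)" unfolding k(3) by (simp add: algebra_simps)
          from arg_cong[OF this, of abs] k show ?thesis by (simp add: abs_mult)
        qed
        have e3: "\<bar>?c b u - r * ?c a u\<bar> * \<bar>?c u m\<bar> = \<bar>k * (r * ?c a m) - ?c b m\<bar>"
        proof -
          have "(?c b u - r * ?c a u) * ?c u m = - (k * (r * ?c a m) - ?c b m)" using k(3) cbm by (simp add: algebra_simps)
          from arg_cong[OF this, of abs] show ?thesis by (simp only: abs_mult abs_minus_cancel)
        qed
        show ?thesis unfolding z1 e2 e3
          using scaled_diff_le[OF le k(1,2)] abs_minus_commute[of "r * ?c a m" "?c b m"] by simp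
      qed
      have 2: "\<bar>?c b m - ?c b v * ?c v m\<bar> + \<bar>r\<bar> * \<bar>?c a m - ?c a u * ?c u m\<bar> + \<bar>?c b v - r * ?c a v\<bar> * \<bar>?c v m\<bar>
          \<le> 2 * \<bar>?c b m - r * ?c a m\<bar>" if m: "m \<in> W" for m
      proof -
        have mV: "m \<in> V" using d m by auto
        from cor_mult[where \<theta>=\<theta>, OF T th z d(11) mV] obtain k where k: "0 \<le> k" "k \<le> 1" "?c b v * ?c v m = k * ?c b m" by blast
        have cum: "?c u m = t * ?c v m" using split_cor(2)[OF s m, of \<theta>] by (simp add: t_def)
        have cam: "?c a m = ?c a v * ?c v m"
          using split_cor(3)[OF s d(6) m, of \<theta>] cav by (simp add: t_def)
        have z1: "?c a m - ?c a u * ?c u m = 0" using cam cum cav by simp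
        have "\<bar>r * ?c a m\<bar> \<le> \<bar>?c b v\<bar> * \<bar>?c v m\<bar>" unfolding cam mult.assoc[symmetric] abs_mult[of _ "?c v m"]
          using uv(3) by (intro mult_right_mono) auto
        also have "\<dots> = k * \<bar>?c b m\<bar>" using arg_cong[OF k(3), of abs] k(1) by (simp add: abs_mult)
        finally have le: "\<bar>r * ?c a m\<bar> \<le> k * \<bar>?c b m\<bar>" .
        have e2: "\<bar>?c b m - ?c b v * ?c v m\<bar> = (1 - k) * \<bar>?c b m\<bar>"
        proof -
          have "(?c b m - ?c b v * ?c v m) = (1 - k) * (?c b m)" unfolding k(3) by (simp add: algebra_simps)
          from arg_cong[OF this, of abs] k show ?thesis by (simp add: abs_mult)
        qed
        have e3: "\<bar>?c b v - r * ?c a v\<bar> * \<bar>?c v m\<bar> = \<bar>k * ?c b m - r * ?c a m\<bar>"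
        proof -
          have "(?c b v - r * ?c a v) * ?c v m = k * ?c b m - r * ?c a m" using k(3) cam by (simp add: algebra_simps)
          from arg_cong[OF this, of abs] show ?thesis by (simp only: abs_mult)
        qed
        show ?thesis unfolding z1 e2 e3 using scaled_diff_le[OF le k(1,2)] by simp
      qed
      have sU: "(\<Sum>m\<in>X \<inter> U. \<bar>?c b m - ?c b v * ?c v m\<bar> * nn m) + (\<Sum>m\<in>X \<inter> U. \<bar>r\<bar> * \<bar>?c a m - ?c a u * ?c u m\<bar> * nn m)
        + (\<Sum>m\<in>X \<inter> U. \<bar>?c b u - r * ?c a u\<bar> * \<bar>?c u m\<bar> * nn m) \<le> (\<Sum>m\<in>X \<inter> U. 2 * \<bar>?c b m - r * ?c a m\<bar> * nn m)"
        unfolding sum.distrib[symmetric] distrib_right[symmetric] using 1 nn_nonneg XV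
        by (intro sum_mono mult_right_mono) auto
      have sW: "(\<Sum>m\<in>X \<inter> W. \<bar>?c b m - ?c b v * ?c v m\<bar> * nn m) + (\<Sum>m\<in>X \<inter> W. \<bar>r\<bar> * \<bar>?c a m - ?c a u * ?c u m\<bar> * nn m)
        + (\<Sum>m\<in>X \<inter> W. \<bar>?c b v - r * ?c a v\<bar> * \<bar>?c v m\<bar> * nn m) \<le> (\<Sum>m\<in>X \<inter> W. 2 * \<bar>?c b m - r * ?c a m\<bar> * nn m)"
        unfolding sum.distrib[symmetric] distrib_right[symmetric] using 2 nn_nonneg XV
        by (intro sum_mono mult_right_mono) auto
      show "(\<Sum>m\<in>X. \<bar>?c b m - ?c b v * ?c v m\<bar> * nn m) + (\<Sum>m\<in>X. \<bar>r\<bar> * \<bar>?c a m - ?c a u * ?c u m\<bar> * nn m)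
       + (\<Sum>m\<in>X \<inter> U. \<bar>?c b u - r * ?c a u\<bar> * \<bar>?c u m\<bar> * nn m)
        + (\<Sum>m\<in>X \<inter> W. \<bar>?c b v - r * ?c a v\<bar> * \<bar>?c v m\<bar> * nn m)
        \<le> (\<Sum>m\<in>X. 2 * \<bar>?c b m - r * ?c a m\<bar> * nn m)"
        unfolding ss[of "\<lambda>m. \<bar>?c b m - ?c b v * ?c v m\<bar> * nn m"] ss[of "\<lambda>m. \<bar>r\<bar> * \<bar>?c a m - ?c a u * ?c u m\<bar> * nn m"]
          ss[of "\<lambda>m. 2 * \<bar>?c b m - r * ?c a m\<bar> * nn m"]
        using sU sW by linarith
    qed simp
    finally show ?thesis .
  qed
qed

text \<open>Each step of the path contributes one summand, and for fixed \<open>m, m'\<close> the contributions telescope to a minor.\<close>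

lemma pair_bound:
  assumes T: "rtree V E a" and z: "b \<in> V" and bd: "bounded V E \<theta> g X"
  shows "nrm S (\<lambda>w. ex V E \<theta> (\<lambda>x. x a * x b * block X w x) - cor V E \<theta> a b * ex V E \<theta> (block X w))
    \<le> exp (g X) * (\<Sum>m\<in>X. \<Sum>m'\<in>X. \<bar>cor V E \<theta> a m * cor V E \<theta> b m' - cor V E \<theta> a m' * cor V E \<theta> b m\<bar> * (nn m * nn m'))"
  using path_exists[OF T z]
proof (induction rule: rtrancl_induct)
  case base
  have aV: "a \<in> V" using rtree_props(3)[OF T] .
  show ?case using cor_refl[OF T aV, of \<theta>] ex_square[OF aV, of E \<theta> "block X _"] by simp
next
  case (step u v)
  then obtain U EU W EW where s: "split_at V E a b u v U EU W EW" by (auto simp: path_step_def)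
  note d = split_atD[OF s]
  let ?c = "cor V E \<theta>"
  have aV: "a \<in> V" using rtree_props(3)[OF T] .
  have XV: "X \<subseteq> V" "X \<subseteq> L" and th: "\<And>e. e \<in> E \<Longrightarrow> \<bar>\<theta> e\<bar> \<le> 1" using bd by (auto simp: bounded_def)
  define t where "t = \<theta> {u, v}"
  have t: "\<bar>t\<bar> \<le> 1" using th[OF d(12)] by (simp add: t_def)
  then have t2: "t * t \<le> 1" using abs_square_le_1[of t] by (simp add: power2_eq_square)
  have cav: "?c a v = ?c a u * t" using split_cor(1)[OF s d(6)] by (simp add: t_def)
  define G where "G = (\<lambda>w. spin_ex U EU \<theta> a (X \<inter> U) w * spin_ex W EW \<theta> v (X \<inter> W) w)"
  \<comment> \<open>Recursion in the endpoint: the old error is damped by \<open>t\<close>, and the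
    edge adds a product of the odd parts at \<open>a\<close> and \<open>v\<close> from its two
    sides.\<close>
  have eq: "ex V E \<theta> (\<lambda>x. x a * x v * block X w x) - ?c a v * ex V E \<theta> (block X w)
     = t * (ex V E \<theta> (\<lambda>x. x a * x u * block X w x) - ?c a u * ex V E \<theta> (block X w)) + (1 - t * t) * G w" for w
    using split_identities(3)[OF s XV(1), of \<theta> w, folded t_def] cav unfolding G_def by (simp add: algebra_simps)
  let ?D = "\<lambda>z m m'. \<bar>?c a m * ?c z m' - ?c a m' * ?c z m\<bar>"
  let ?g = "\<lambda>m m'. if m \<in> U \<and> m' \<in> W then \<bar>?c a m\<bar> * \<bar>?c v m'\<bar> else 0"
  have fin: "finite X" using XV finite_L finite_subset by blast
  have "nrm S (\<lambda>w. ex V E \<theta> (\<lambda>x. x a * x v * block X w x) - ?c a v * ex V E \<theta> (block X w))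
     \<le> \<bar>t\<bar> * (exp (g X) * (\<Sum>m\<in>X. \<Sum>m'\<in>X. ?D u m m' * (nn m * nn m')))
       + \<bar>1 - t * t\<bar> * (exp (g X) * ((\<Sum>m\<in>X \<inter> U. \<bar>?c a m\<bar> * nn m) * (\<Sum>m\<in>X \<inter> W. \<bar>?c v m\<bar> * nn m)))"
    unfolding eq
    by (rule order_trans[OF nrm_triangle add_mono]; unfold nrm_cmult G_def;
        intro mult_left_mono step.IH split_bounds(3)[OF s bd] abs_ge_zero)
  also have "(\<Sum>m\<in>X \<inter> U. \<bar>?c a m\<bar> * nn m) * (\<Sum>m\<in>X \<inter> W. \<bar>?c v m\<bar> * nn m)
     = (\<Sum>m\<in>X. \<Sum>m'\<in>X. ?g m m' * (nn m * nn m'))"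
  proof -
    have "(\<Sum>m\<in>X. \<Sum>m'\<in>X. ?g m m' * (nn m * nn m'))
      = (\<Sum>m\<in>X. \<Sum>m'\<in>X. (if m \<in> U then \<bar>?c a m\<bar> * nn m else 0) * (if m' \<in> W then \<bar>?c v m'\<bar> * nn m' else 0))"
      by (intro sum.cong) auto
    also have "\<dots> = (\<Sum>m\<in>X. if m \<in> U then \<bar>?c a m\<bar> * nn m else 0) * (\<Sum>m\<in>X. if m \<in> W then \<bar>?c v m\<bar> * nn m else 0)"
      by (rule sum_product[symmetric])
    finally show ?thesis using fin by (simp add: sum.inter_restrict)
  qed
  also have "\<bar>t\<bar> * (exp (g X) * (\<Sum>m\<in>X. \<Sum>m'\<in>X. ?D u m m' * (nn m * nn m')))
       + \<bar>1 - t * t\<bar> * (exp (g X) * (\<Sum>m\<in>X. \<Sum>m'\<in>X. ?g m m' * (nn m * nn m')))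
     = exp (g X) * (\<Sum>m\<in>X. \<Sum>m'\<in>X. (\<bar>t\<bar> * ?D u m m' + (1 - t * t) * ?g m m') * (nn m * nn m'))"
  proof -
    have "(\<Sum>m\<in>X. \<Sum>m'\<in>X. (\<bar>t\<bar> * ?D u m m' + (1 - t * t) * ?g m m') * (nn m * nn m'))
      = \<bar>t\<bar> * (\<Sum>m\<in>X. \<Sum>m'\<in>X. ?D u m m' * (nn m * nn m')) + (1 - t * t) * (\<Sum>m\<in>X. \<Sum>m'\<in>X. ?g m m' * (nn m * nn m'))"
      unfolding distrib_right sum.distrib sum_distrib_left by (simp only: mult.assoc)
    moreover have "\<bar>1 - t * t\<bar> = 1 - t * t" using t2 by simp
    ultimately show ?thesis by (simp only: distrib_left mult.left_commute)
  qed
  also have "\<dots> \<le> exp (g X) * (\<Sum>m\<in>X. \<Sum>m'\<in>X. ?D v m m' * (nn m * nn m'))"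
  proof (intro mult_left_mono sum_mono mult_right_mono)
    fix m m' assume m: "m \<in> X" "m' \<in> X"
    then show "0 \<le> nn m * nn m'" using XV nn_nonneg by (intro mult_nonneg_nonneg) auto
    have mV: "m \<in> V" "m' \<in> V" using m XV by auto
    have cU: "?c v m = t * ?c u m" if "m \<in> U" for m
      using split_cor(1)[OF s that, of \<theta>] cor_sym[of V E \<theta> _ m] by (simp add: t_def)
    have cW: "?c u m = t * ?c v m" if "m \<in> W" for m
      using split_cor(2)[OF s that, of \<theta>] by (simp add: t_def)
    have caW: "?c a m = ?c a u * t * ?c v m" if "m \<in> W" for m
      using split_cor(3)[OF s d(6) that, of \<theta>] by (simp add: t_def)
    \<comment> \<open>\<open>1 - t * t * k = t * t * (1 - k) + (1 - t * t)\<close>: for leaves on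
      opposite sides the new minor is exactly the damped old one plus the contribution of the
      edge.\<close>
    have cross: "\<bar>t\<bar> * ?D u m m' + (1 - t * t) * (\<bar>?c a m\<bar> * \<bar>?c v m'\<bar>) = ?D v m m'" if mm: "m \<in> U" "m' \<in> W" "m \<in> V" for m m'
    proof -
      from cor_mult[where \<theta>=\<theta>, OF T th aV d(10) mm(3)] obtain k where k: "0 \<le> k" "k \<le> 1" "?c a u * ?c u m = k * ?c a m" by blast
      have tk: "t * t * k \<le> 1" using mult_le_one[of "t * t" k] t2 k by auto
      have "?c a m * ?c v m' - ?c a m' * ?c v m = ?c a m * ?c v m' - t * t * (?c a u * ?c u m) * ?c v m'"
        using caW[OF mm(2)] cU[OF mm(1)] by simp
      also have "\<dots> = (1 - t * t * k) * (?c a m * ?c v m')" unfolding k(3) by (simp add: algebra_simps)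
      finally have 1: "?D v m m' = (1 - t * t * k) * (\<bar>?c a m\<bar> * \<bar>?c v m'\<bar>)" using tk by (simp add: abs_mult)
      have "?c a m * ?c u m' - ?c a m' * ?c u m = t * (?c a m * ?c v m' - (?c a u * ?c u m) * ?c v m')"
        using caW[OF mm(2)] cW[OF mm(2)] by (simp add: algebra_simps)
      also have "\<dots> = t * ((1 - k) * (?c a m * ?c v m'))" unfolding k(3) by (simp add: algebra_simps)
      finally have "\<bar>t\<bar> * ?D u m m' = \<bar>t\<bar> * \<bar>t\<bar> * ((1 - k) * (\<bar>?c a m\<bar> * \<bar>?c v m'\<bar>))" using k by (simp add: abs_mult)
      then have 2: "\<bar>t\<bar> * ?D u m m' = t * t * ((1 - k) * (\<bar>?c a m\<bar> * \<bar>?c v m'\<bar>))" by simp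
      show ?thesis unfolding 1 2 by (simp add: algebra_simps)
    qed
    have nonneg: "0 \<le> (1 - t * t) * (\<bar>?c a m\<bar> * \<bar>?c v m'\<bar>)" for m m' using t2 by simp
    consider "m \<in> U" "m' \<in> U" | "m \<in> U" "m' \<in> W" | "m \<in> W" "m' \<in> U" | "m \<in> W" "m' \<in> W" using mV d(4) by auto
    then show "\<bar>t\<bar> * ?D u m m' + (1 - t * t) * ?g m m' \<le> ?D v m m'"
    proof cases
      case 1
      then have "m' \<notin> W" using d(3) by auto
      have "?c a m * ?c v m' - ?c a m' * ?c v m = t * (?c a m * ?c u m' - ?c a m' * ?c u m)"
        using cU[OF 1(1)] cU[OF 1(2)] by (simp add: algebra_simps)
      then show ?thesis using \<open>m' \<notin> W\<close> by (simp add: abs_mult)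
    next
      case 2
      then show ?thesis using cross[OF 2 mV(1)] by simp
    next
      case 3
      then have "m \<notin> U" using d(3) by auto
      have "?D u m m' = ?D u m' m" "?D v m m' = ?D v m' m" by (auto simp: abs_minus_commute mult.commute)
      then show ?thesis using \<open>m \<notin> U\<close> cross[OF 3(2,1) mV(2)] nonneg[of m' m] by simp
    next
      case 4
      then have "m \<notin> U" using d(3) by auto
      have "?c a m * ?c u m' - ?c a m' * ?c u m = 0"
        using caW[OF 4(1)] caW[OF 4(2)] cW[OF 4(1)] cW[OF 4(2)] by simp
      then show ?thesis using \<open>m \<notin> U\<close> by simp
    qed
  qed simp_all
  finally show ?case .
qed

end

section \<open>Cherries\<close>

text \<open>Not a configuration in the graph but what a cherry means for the leaf law: to the other
  leaves, \<open>b\<close> looks like a rescaled copy of \<open>a\<close>, and the product of the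
  two spins like a constant. The identities with \<open>x u\<close> serve the recursion, since a
  further join brings in the root spin.\<close>

definition cherry :: "nat set \<Rightarrow> nat set set \<Rightarrow> (nat set \<Rightarrow> real) \<Rightarrow> nat \<Rightarrow> nat set \<Rightarrow> nat \<Rightarrow> nat \<Rightarrow> real \<Rightarrow> bool" where
  "cherry V E \<theta> u L a b r \<longleftrightarrow> a \<in> L \<and> b \<in> L \<and> a \<noteq> b \<and> \<bar>r\<bar> \<le> 1 \<and> (\<forall>p q X. X \<subseteq> L - {a, b} \<longrightarrow>
     ex V E \<theta> (\<lambda>x. x b * leafprod X p q x) = r * ex V E \<theta> (\<lambda>x. x a * leafprod X p q x) \<and>
     ex V E \<theta> (\<lambda>x. x u * x b * leafprod X p q x) = r * ex V E \<theta> (\<lambda>x. x u * x a * leafprod X p q x) \<and>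
     ex V E \<theta> (\<lambda>x. x a * x b * leafprod X p q x) = cor V E \<theta> a b * ex V E \<theta> (leafprod X p q) \<and>
     ex V E \<theta> (\<lambda>x. x u * (x a * x b) * leafprod X p q x) = cor V E \<theta> a b * ex V E \<theta> (\<lambda>x. x u * leafprod X p q x))"

lemma ex_square_left: "u \<in> U \<Longrightarrow> ex U E \<theta> (\<lambda>x. x u * (x u * f x) * g x) = ex U E \<theta> (\<lambda>x. f x * g x)"
  by (rule ex_cong) (metis spins_square mult.assoc mult_1)

text \<open>Descend into a side holding two leaves of \<open>L\<close>; the identities survive each
  join because the other side enters only as a factor. If each side holds one leaf, no further
  leaves exist and \<open>X\<close> is empty.\<close>

lemma cherry_exists:
  assumes "rtree V E u" "L \<subseteq> V" "2 \<le> card L"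
  shows "\<exists>a b r. cherry V E \<theta> u L a b r"
  using assms
proof (induction arbitrary: L)
  case (single u)
  then have "card L \<le> card {u}" by (intro card_mono) auto
  then show ?case using single by simp
next
  case (join U EU u W EW v)
  note T = join.hyps
  let ?V = "U \<union> W" and ?E = "insert {u, v} (EU \<union> EW)"
  have uU: "u \<in> U" and vW: "v \<in> W" using T rtree_props(3) by auto
  have fin: "finite L" using join.prems T rtree_props(1) by (meson finite_Un finite_subset)
  have cardL: "card L = card (L \<inter> U) + card (L \<inter> W)"
    using card_Un_disjoint[of "L \<inter> U" "L \<inter> W"] fin join.prems T by (auto simp: Int_Un_distrib[symmetric] Int_absorb2)
  consider (U) "2 \<le> card (L \<inter> U)" | (W) "2 \<le> card (L \<inter> W)" | (one) "card (L \<inter> U) = 1" "card (L \<inter> W) = 1"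
    using cardL join.prems by linarith
  then show ?case
  proof cases
    case U
    obtain a b r where ch: "cherry U EU \<theta> u (L \<inter> U) a b r" using join.IH(1)[OF _ U] by auto
    then have c: "a \<in> L" "b \<in> L" "a \<in> U" "b \<in> U" "a \<noteq> b" "\<bar>r\<bar> \<le> 1"
      by (auto simp: cherry_def)
    have "cherry ?V ?E \<theta> u L a b r"
      unfolding cherry_def
    proof (intro conjI allI impI c(1,2,5,6))
      fix p q X assume X: "X \<subseteq> L - {a, b}"
      then have XV: "X \<subseteq> U \<union> W" using join.prems by auto
      note J = ex_join_leafprod[OF T _ _ XV, of _ _ \<theta> p q]
      from X have "X \<inter> U \<subseteq> L \<inter> U - {a, b}" by auto
      note h = ch[unfolded cherry_def, THEN conjunct2, THEN conjunct2, THEN conjunct2, THEN conjunct2, rule_format, OF this, of p q]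
      note h = h[THEN conjunct1] h[THEN conjunct2, THEN conjunct1]
        h[THEN conjunct2, THEN conjunct2, THEN conjunct1] h[THEN conjunct2, THEN conjunct2, THEN conjunct2]
      have cab: "cor ?V ?E \<theta> a b = cor U EU \<theta> a b" using cor_join(1)[OF T c(3,4)] .
      note dc = dep_coord[OF uU] dep_coord[OF c(3)] dep_coord[OF c(4)]
      note sq = ex_square_left[OF uU, of EU \<theta>] ex_square[OF uU, of EU \<theta>]
      show "ex ?V ?E \<theta> (\<lambda>x. x b * leafprod X p q x) = r * ex ?V ?E \<theta> (\<lambda>x. x a * leafprod X p q x)"
        unfolding J[OF dc(3) dep_const[of _ 1], unfolded mult_1_right mult_1_left] J[OF dc(2) dep_const[of _ 1], unfolded mult_1_right mult_1_left] sq h cab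
        by (simp add: algebra_simps)
      show "ex ?V ?E \<theta> (\<lambda>x. x u * x b * leafprod X p q x) = r * ex ?V ?E \<theta> (\<lambda>x. x u * x a * leafprod X p q x)"
        unfolding J[OF dep_mult[OF dc(1,3)] dep_const[of _ 1], unfolded mult_1_right mult_1_left] J[OF dep_mult[OF dc(1,2)] dep_const[of _ 1], unfolded mult_1_right mult_1_left] sq h cab
        by (simp add: algebra_simps)
      show "ex ?V ?E \<theta> (\<lambda>x. x a * x b * leafprod X p q x) = cor ?V ?E \<theta> a b * ex ?V ?E \<theta> (leafprod X p q)"
        unfolding J[OF dep_mult[OF dc(2,3)] dep_const[of _ 1], unfolded mult_1_right mult_1_left] J[OF dep_const[of _ 1] dep_const[of _ 1], unfolded mult_1_right mult_1_left] sq h cab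
        by (simp add: algebra_simps)
      show "ex ?V ?E \<theta> (\<lambda>x. x u * (x a * x b) * leafprod X p q x) = cor ?V ?E \<theta> a b * ex ?V ?E \<theta> (\<lambda>x. x u * leafprod X p q x)"
        unfolding J[OF dep_mult[OF dc(1) dep_mult[OF dc(2,3)]] dep_const[of _ 1], unfolded mult_1_right mult_1_left] J[OF dc(1) dep_const[of _ 1], unfolded mult_1_right mult_1_left] sq h cab
        by (simp add: algebra_simps)
    qed
    then show ?thesis by blast
  next
    case W
    obtain a b r where ch: "cherry W EW \<theta> v (L \<inter> W) a b r" using join.IH(2)[OF _ W] by auto
    then have c: "a \<in> L" "b \<in> L" "a \<in> W" "b \<in> W" "a \<noteq> b" "\<bar>r\<bar> \<le> 1"
      by (auto simp: cherry_def)
    have "cherry ?V ?E \<theta> u L a b r"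
      unfolding cherry_def
    proof (intro conjI allI impI c(1,2,5,6))
      fix p q X assume X: "X \<subseteq> L - {a, b}"
      then have XV: "X \<subseteq> U \<union> W" using join.prems by auto
      note J = ex_join_leafprod[OF T _ _ XV, of _ _ \<theta> p q]
      from X have "X \<inter> W \<subseteq> L \<inter> W - {a, b}" by auto
      note h = ch[unfolded cherry_def, THEN conjunct2, THEN conjunct2, THEN conjunct2, THEN conjunct2, rule_format, OF this, of p q]
      note h = h[THEN conjunct1] h[THEN conjunct2, THEN conjunct1]
        h[THEN conjunct2, THEN conjunct2, THEN conjunct1] h[THEN conjunct2, THEN conjunct2, THEN conjunct2]
      have cab: "cor ?V ?E \<theta> a b = cor W EW \<theta> a b" using cor_join(2)[OF T c(3,4)] .
      note dc = dep_coord[OF c(3)] dep_coord[OF c(4)]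
      note d1 = dep_const[of U 1] and du = dep_coord[OF uU]
      note sq = ex_square[OF uU, of EU \<theta>]
      show "ex ?V ?E \<theta> (\<lambda>x. x b * leafprod X p q x) = r * ex ?V ?E \<theta> (\<lambda>x. x a * leafprod X p q x)"
        unfolding J[OF d1 dc(2), unfolded mult_1_right mult_1_left] J[OF d1 dc(1), unfolded mult_1_right mult_1_left] sq h cab
        by (simp add: algebra_simps)
      show "ex ?V ?E \<theta> (\<lambda>x. x u * x b * leafprod X p q x) = r * ex ?V ?E \<theta> (\<lambda>x. x u * x a * leafprod X p q x)"
        unfolding J[OF du dc(2), unfolded mult_1_right mult_1_left] J[OF du dc(1), unfolded mult_1_right mult_1_left] sq h cab
        by (simp add: algebra_simps)
      show "ex ?V ?E \<theta> (\<lambda>x. x a * x b * leafprod X p q x) = cor ?V ?E \<theta> a b * ex ?V ?E \<theta> (leafprod X p q)"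
        unfolding J[OF d1 dep_mult[OF dc], unfolded mult_1_right mult_1_left] J[OF d1 dep_const[of _ 1], unfolded mult_1_right mult_1_left] sq h cab
        by (simp add: algebra_simps)
      show "ex ?V ?E \<theta> (\<lambda>x. x u * (x a * x b) * leafprod X p q x) = cor ?V ?E \<theta> a b * ex ?V ?E \<theta> (\<lambda>x. x u * leafprod X p q x)"
        unfolding J[OF du dep_mult[OF dc], unfolded mult_1_right mult_1_left] J[OF du dep_const[of _ 1], unfolded mult_1_right mult_1_left] sq h cab
        by (simp add: algebra_simps)
    qed
    then show ?thesis by blast
  next
    case one
    let ?c = "cor ?V ?E \<theta>"
    have T': "rtree ?V ?E u" using rtree.join[OF T] .
    obtain a0 where a0: "L \<inter> U = {a0}" using one(1) by (auto simp: card_1_singleton_iff)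
    obtain b0 where b0: "L \<inter> W = {b0}" using one(2) by (auto simp: card_1_singleton_iff)
    have L0: "L = {a0, b0}" "a0 \<noteq> b0" using a0 b0 join.prems T(3) by blast+
    \<comment> \<open>The leaf more strongly correlated with the root is taken as \<open>a\<close>;
      this makes the ratio \<open>r\<close> at most 1 in modulus.\<close>
    obtain a b where ab: "L = {a, b}" "a \<noteq> b" "\<bar>?c u b\<bar> \<le> \<bar>?c u a\<bar>"
    proof (cases "\<bar>?c u b0\<bar> \<le> \<bar>?c u a0\<bar>")
      case True then show ?thesis using that[of a0 b0] L0 by auto
    next
      case False then show ?thesis using that[of b0 a0] L0 by auto
    qed
    \<comment> \<open>If \<open>?c u a = 0\<close>, then \<open>?c u b = 0\<close> as well, and
      division by zero giving 0 keeps \<open>?c u b = r * ?c u a\<close> true.\<close>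
    define r where "r = ?c u b / ?c u a"
    have r: "\<bar>r\<bar> \<le> 1" using ab(3) by (auto simp: r_def abs_divide divide_le_eq)
    have rc: "?c u b = r * ?c u a" using ab(3) by (auto simp: r_def)
    have aV: "a \<in> ?V" "b \<in> ?V" "u \<in> ?V" using ab join.prems uU by auto
    have o3: "ex ?V ?E \<theta> (\<lambda>x. x u * (x a * x b)) = 0"
      by (rule ex_odd[OF T']) (use aV in \<open>auto intro!: dep_mult dep_coord\<close>)
    have "cherry ?V ?E \<theta> u L a b r"
      unfolding cherry_def
    proof (intro conjI allI impI r)
      fix p q X assume "X \<subseteq> L - {a, b}"
      then have X: "X = {}" using ab by auto
      show "ex ?V ?E \<theta> (\<lambda>x. x b * leafprod X p q x) = r * ex ?V ?E \<theta> (\<lambda>x. x a * leafprod X p q x)"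
        using ex_coord[OF T'] aV by (simp add: X)
      show "ex ?V ?E \<theta> (\<lambda>x. x u * x b * leafprod X p q x) = r * ex ?V ?E \<theta> (\<lambda>x. x u * x a * leafprod X p q x)"
        using rc by (simp add: X cor_def)
      show "ex ?V ?E \<theta> (\<lambda>x. x a * x b * leafprod X p q x) = ?c a b * ex ?V ?E \<theta> (leafprod X p q)"
        using ex_one[OF T', of \<theta>] by (simp add: X cor_def)
      show "ex ?V ?E \<theta> (\<lambda>x. x u * (x a * x b) * leafprod X p q x) = ?c a b * ex ?V ?E \<theta> (\<lambda>x. x u * leafprod X p q x)"
        using o3 ex_coord[OF T' aV(3), of \<theta>] by (simp add: X)
    qed (use ab in auto)
    then show ?thesis by blast
  qed
qed

section \<open>Leaf expansions and the form of the error bound\<close>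

lemma cor_abs_le_1:
  assumes T: "rtree V E u" and th: "\<And>e. e \<in> E \<Longrightarrow> \<bar>\<theta> e\<bar> \<le> 1" and ij: "i \<in> V" "j \<in> V"
  shows "\<bar>cor V E \<theta> i j\<bar> \<le> 1"
proof -
  \<comment> \<open>The walk from \<open>i\<close> to \<open>j\<close> and back bounds the square of
    the correlation.\<close>
  from cor_mult[where \<theta> = \<theta>, OF T th ij(1) ij(2) ij(1)]
  obtain k where "k \<le> 1" "cor V E \<theta> i j * cor V E \<theta> j i = k * cor V E \<theta> i i" by blast
  then have "cor V E \<theta> i j * cor V E \<theta> i j \<le> 1"
    using cor_refl[OF T ij(1), of \<theta>] cor_sym[of V E \<theta> j i] by simp
  then show ?thesis using abs_square_le_1[of "cor V E \<theta> i j"] by (simp add: power2_eq_square)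
qed

lemma ex_leafprod_single:
  assumes "rtree V E u" "l \<in> V"
  shows "ex V E \<theta> (leafprod {l} p q) = p l"
proof -
  have "leafprod {l} p q = (\<lambda>x. p l * 1 + q l * x l)" by (simp add: leafprod_def fun_eq_iff)
  then show ?thesis
    by (simp only: ex_add ex_cmult ex_one[OF assms(1)] ex_coord[OF assms])
qed

lemma clusters_subset: "clusters S L P Q C nn \<Longrightarrow> B \<subseteq> L \<Longrightarrow> clusters S B P Q C nn"
proof -
  assume c: "clusters S L P Q C nn" and sub: "B \<subseteq> L"
  interpret c: clusters S L P Q C nn by (rule c)
  show ?thesis
  proof
    show "finite S" "finite B" using c.finite_S c.finite_L sub finite_subset by auto
    fix l assume "l \<in> B"
    then have l: "l \<in> L" using sub by auto
    from c.C_sub[OF l] c.dep_P[OF l] c.dep_Q[OF l] c.nrm_Q[OF l] c.nn_ge_1[OF l]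
    show "C l \<subseteq> S" "dep (C l) (P l)" "dep (C l) (Q l)" "nrm S (Q l) \<le> nn l" "1 \<le> nn l" .
    show "C l \<inter> C m = {}" if "m \<in> B" "l \<noteq> m" for m using c.C_disj[OF l] that sub by auto
  qed
qed

lemma ex_two_leaves:
  assumes "finite X" "a \<notin> X" "b \<notin> X" "a \<noteq> b"
  shows "ex V E \<theta> (leafprod (insert a (insert b X)) p q)
     = p a * p b * ex V E \<theta> (leafprod X p q) + q a * p b * ex V E \<theta> (\<lambda>x. x a * leafprod X p q x)
      + p a * q b * ex V E \<theta> (\<lambda>x. x b * leafprod X p q x) + q a * q b * ex V E \<theta> (\<lambda>x. x a * x b * leafprod X p q x)"
proof -
  have "leafprod (insert a (insert b X)) p q = (\<lambda>x. p a * p b * leafprod X p q x + q a * p b * (x a * leafprod X p q x)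
     + p a * q b * (x b * leafprod X p q x) + q a * q b * (x a * x b * leafprod X p q x))"
    using assms by (simp add: leafprod_insert fun_eq_iff algebra_simps)
  then show ?thesis by (simp only: ex_add ex_cmult)
qed

lemma ex_one_leaf:
  assumes "finite X" "a \<notin> X"
  shows "ex V E \<theta> (leafprod (insert a X) p q)
     = p a * ex V E \<theta> (leafprod X p q) + q a * ex V E \<theta> (\<lambda>x. x a * leafprod X p q x)"
proof -
  have "leafprod (insert a X) p q = (\<lambda>x. p a * leafprod X p q x + q a * (x a * leafprod X p q x))"
    using assms by (simp add: leafprod_insert fun_eq_iff algebra_simps)
  then show ?thesis by (simp only: ex_add ex_cmult)
qed

text \<open>The cardinality factor is already additive; the fourth power only has to be
  monotone.\<close>

lemma superadditive_bound:
  fixes nn :: "nat \<Rightarrow> real"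
  assumes "finite A" "finite B" "A \<inter> B = {}" "\<And>l. l \<in> A \<union> B \<Longrightarrow> 0 \<le> nn l" "0 \<le> c"
  shows "c * real (card A) * (sum nn A) ^ 4 + c * real (card B) * (sum nn B) ^ 4
     \<le> c * real (card (A \<union> B)) * (sum nn (A \<union> B)) ^ 4"
proof -
  have s: "sum nn (A \<union> B) = sum nn A + sum nn B" using assms by (simp add: sum.union_disjoint)
  have n: "0 \<le> sum nn A" "0 \<le> sum nn B" using assms by (auto intro: sum_nonneg)
  have "c * real (card A) * (sum nn A) ^ 4 \<le> c * real (card A) * (sum nn (A \<union> B)) ^ 4"
    using n assms(5) unfolding s by (intro mult_left_mono power_mono) auto
  moreover have "c * real (card B) * (sum nn B) ^ 4 \<le> c * real (card B) * (sum nn (A \<union> B)) ^ 4"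
    using n assms(5) unfolding s by (intro mult_left_mono power_mono) auto
  ultimately show ?thesis using assms by (simp add: card_Un_disjoint algebra_simps)
qed

section \<open>Different topologies\<close>

text \<open>Expand \<open>(P a + x a * Q a) * (P b + x b * Q b)\<close> and put
  \<open>r * x a\<close> for \<open>x b\<close> and \<open>\<beta>\<close> for
  \<open>x a * x b\<close>: the new \<open>P\<close> and \<open>Q\<close> are the even and the odd
  coefficient. Because \<open>\<bar>r\<bar> \<le> 1\<close>, the bounds for the odd parts just add
  up.\<close>

lemma merge_clusters:
  assumes c: "clusters S L P Q C nn" and ab: "a \<in> L" "b \<in> L" "a \<noteq> b" and r: "\<bar>r\<bar> \<le> 1"
    and Pa: "nrm S (P a) \<le> 1" "nrm S (P b) \<le> 1"
  shows "clusters S (L - {b}) (P(a := \<lambda>w. P a w * P b w + \<beta> * (Q a w * Q b w)))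
     (Q(a := \<lambda>w. Q a w * P b w + r * (P a w * Q b w))) (C(a := C a \<union> C b)) (nn(a := nn a + nn b))"
proof -
  interpret c: clusters S L P Q C nn by (rule c)
  have da: "dep (C a \<union> C b) (P a)" "dep (C a \<union> C b) (Q a)" "dep (C a \<union> C b) (P b)" "dep (C a \<union> C b) (Q b)"
    using c.dep_P c.dep_Q ab by (blast intro: dep_mono)+
  have nQ: "nrm S (\<lambda>w. Q a w * P b w + r * (P a w * Q b w)) \<le> nn a + nn b"
  proof -
    have "nrm S (\<lambda>w. Q a w * P b w) = nrm S (Q a) * nrm S (P b)"
      by (rule nrm_mult[OF c.finite_S c.dep_Q[OF ab(1)] c.C_sub[OF ab(1)] c.dep_P[OF ab(2)] c.C_sub[OF ab(2)] c.C_disj[OF ab(1-3)]])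
    also have "\<dots> \<le> nn a * 1" using c.nrm_Q Pa ab nrm_nonneg c.nn_nonneg by (intro mult_mono) auto
    finally have 1: "nrm S (\<lambda>w. Q a w * P b w) \<le> nn a" by simp
    have "nrm S (\<lambda>w. P a w * Q b w) = nrm S (P a) * nrm S (Q b)"
      by (rule nrm_mult[OF c.finite_S c.dep_P[OF ab(1)] c.C_sub[OF ab(1)] c.dep_Q[OF ab(2)] c.C_sub[OF ab(2)] c.C_disj[OF ab(1-3)]])
    also have "\<dots> \<le> 1 * nn b" using c.nrm_Q Pa ab nrm_nonneg c.nn_nonneg by (intro mult_mono) auto
    finally have "\<bar>r\<bar> * nrm S (\<lambda>w. P a w * Q b w) \<le> 1 * nn b" using r nrm_nonneg by (intro mult_mono) auto
    with 1 show ?thesis using nrm_triangle[of S "\<lambda>w. Q a w * P b w" "\<lambda>w. r * (P a w * Q b w)"]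
      unfolding nrm_cmult by linarith
  qed
  show ?thesis
  proof
    show "finite S" "finite (L - {b})" using c.finite_S c.finite_L by auto
    fix l assume l: "l \<in> L - {b}"
    show "(C(a := C a \<union> C b)) l \<subseteq> S" using c.C_sub l ab by auto
    show "dep ((C(a := C a \<union> C b)) l) ((P(a := \<lambda>w. P a w * P b w + \<beta> * (Q a w * Q b w))) l)"
      using c.dep_P l da by (auto intro!: dep_add dep_mult)
    show "dep ((C(a := C a \<union> C b)) l) ((Q(a := \<lambda>w. Q a w * P b w + r * (P a w * Q b w))) l)"
      using c.dep_Q l da by (auto intro!: dep_add dep_mult)
    show "nrm S ((Q(a := \<lambda>w. Q a w * P b w + r * (P a w * Q b w))) l) \<le> (nn(a := nn a + nn b)) l"
      using nQ c.nrm_Q l by auto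
    show "1 \<le> (nn(a := nn a + nn b)) l" using c.nn_ge_1[of l] c.nn_ge_1[of a] c.nn_nonneg[of b] l ab by auto
    show "(C(a := C a \<union> C b)) l \<inter> (C(a := C a \<union> C b)) m = {}" if "m \<in> L - {b}" "l \<noteq> m" for m
      using c.C_disj that l ab by (auto; blast)
  qed
qed

abbreviation ev :: "nat set \<Rightarrow> nat set set \<Rightarrow> (nat set \<Rightarrow> real) \<Rightarrow> (nat \<Rightarrow> (nat \<Rightarrow> real) \<Rightarrow> real) \<Rightarrow> (nat \<Rightarrow> (nat \<Rightarrow> real) \<Rightarrow> real) \<Rightarrow> nat set \<Rightarrow> (nat \<Rightarrow> real) \<Rightarrow> real" where
  "ev V E \<theta> P Q X w \<equiv> ex V E \<theta> (leafprod X (\<lambda>l. P l w) (\<lambda>l. Q l w))"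

text \<open>In the tree that owns the cherry the substitution behind the merge is exact, so all
  merging error arises in the other tree.\<close>

lemma ev_merge:
  assumes ch: "cherry V E \<theta> u L a b r" and fin: "finite L" and B: "B \<subseteq> L - {b}" "a \<in> B"
  shows "ev V E \<theta> (P(a := \<lambda>w. P a w * P b w + cor V E \<theta> a b * (Q a w * Q b w)))
     (Q(a := \<lambda>w. Q a w * P b w + r * (P a w * Q b w))) B w = ev V E \<theta> P Q (insert b B) w"
proof -
  define X where "X = B - {a}"
  have X: "finite X" "a \<notin> X" "b \<notin> X" "a \<noteq> b" "X \<subseteq> L - {a, b}"
    using B fin finite_subset ch by (auto simp: X_def cherry_def)
  have BX: "B = insert a X" using B by (auto simp: X_def)
  have c: "leafprod X (\<lambda>l. (P(a := f)) l w) (\<lambda>l. (Q(a := g)) l w) = leafprod X (\<lambda>l. P l w) (\<lambda>l. Q l w)" for f g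
    using X by (intro leafprod_cong) auto
  note h = ch[unfolded cherry_def, THEN conjunct2, THEN conjunct2, THEN conjunct2, THEN conjunct2, rule_format, OF X(5), of "\<lambda>l. P l w" "\<lambda>l. Q l w"]
  show ?thesis
    unfolding BX insert_commute[of b a] ex_two_leaves[OF X(1-4)] ex_one_leaf[OF X(1,2)] c
    using h by (simp add: algebra_simps)
qed

text \<open>A merge along a cherry of the second tree keeps the densities there and
  \<open>sum nn L\<close>, and moves the density of the first tree by at most
  \<open>27 * \<epsilon> * sum nn L ^ 4\<close> in norm. After \<open>card L - 1\<close> merges one
  leaf is left, whose density is \<open>P\<close> in both trees.\<close>

lemma tree_comparison:
  assumes T1: "rtree V1 E1 r1" and th1: "\<And>e. e \<in> E1 \<Longrightarrow> \<bar>\<theta>1 e\<bar> \<le> 1"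
    and T2: "rtree V2 E2 r2" and th2: "\<And>e. e \<in> E2 \<Longrightarrow> \<bar>\<theta>2 e\<bar> \<le> 1"
    and \<epsilon>: "0 \<le> \<epsilon>"
    and "clusters S L P Q C nn" "L \<subseteq> V1" "L \<subseteq> V2"
    and "\<And>i j. i \<in> L \<Longrightarrow> j \<in> L \<Longrightarrow> \<bar>cor V1 E1 \<theta>1 i j - cor V2 E2 \<theta>2 i j\<bar> \<le> \<epsilon>"
    and "\<And>B. B \<subseteq> L \<Longrightarrow> nrm S (ev V2 E2 \<theta>2 P Q B) \<le> 1"
    and "27 * \<epsilon> * real (card L) * (sum nn L) ^ 4 \<le> 1"
  shows "nrm S (\<lambda>w. ev V1 E1 \<theta>1 P Q L w - ev V2 E2 \<theta>2 P Q L w) \<le> 27 * \<epsilon> * real (card L - 1) * (sum nn L) ^ 4"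
  using assms(6-)
proof (induction "card L" arbitrary: L P Q C nn rule: less_induct)
  case less
  note cl = less.prems(1) and LV = less.prems(2,3) and close = less.prems(4) and n2 = less.prems(5) and small = less.prems(6)
  interpret c: clusters S L P Q C nn by (rule cl)
  have finL: "finite L" by (rule c.finite_L)
  let ?N = "sum nn L"
  have N0: "0 \<le> ?N" using c.nn_nonneg by (auto intro: sum_nonneg)
  show ?case
  proof (cases "card L \<le> 1")
    case True
    then consider "L = {}" | l where "L = {l}" using finL by (metis One_nat_def card_1_singletonE card_0_eq le_SucE le_zero_eq)
    then have "ev V1 E1 \<theta>1 P Q L w = ev V2 E2 \<theta>2 P Q L w" for w
    proof cases
      case 1 then show ?thesis using ex_one[OF T1] ex_one[OF T2] by simp
    next
      case 2 then show ?thesis using ex_leafprod_single[OF T1, of l] ex_leafprod_single[OF T2, of l] LV by simp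
    qed
    then show ?thesis using \<epsilon> N0 by simp
  next
    case False
    then obtain a b r where ch: "cherry V2 E2 \<theta>2 r2 L a b r" using cherry_exists[OF T2 LV(2)] by force
    then have ab: "a \<in> L" "b \<in> L" "a \<noteq> b" "\<bar>r\<bar> \<le> 1" by (auto simp: cherry_def)
    let ?c1 = "cor V1 E1 \<theta>1" and ?c2 = "cor V2 E2 \<theta>2"
    define X where "X = L - {a, b}"
    have X: "finite X" "a \<notin> X" "b \<notin> X" "X \<subseteq> L" "insert a (insert b X) = L" "insert a X = L - {b}"
      using ab finL by (auto simp: X_def)
    have cardL: "card L = card X + 2" unfolding X(5)[symmetric] using X(1-3) ab(3) by simp
    have N1: "1 \<le> ?N" "nn b \<le> ?N" "nn a \<le> ?N" "sum nn X \<le> ?N"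
    proof -
      have "?N = nn a + nn b + sum nn X" unfolding X(5)[symmetric] using X(1-3) ab(3) by simp
      moreover have "0 \<le> sum nn X" using c.nn_nonneg X by (auto intro!: sum_nonneg)
      ultimately show "1 \<le> ?N" "nn b \<le> ?N" "nn a \<le> ?N" "sum nn X \<le> ?N"
        using c.nn_ge_1[OF ab(1)] c.nn_ge_1[OF ab(2)] by linarith+
    qed
    define g where "g = (\<lambda>B. 27 * \<epsilon> * real (card B) * (sum nn B) ^ 4)"
    have nnB: "0 \<le> sum nn B" if "B \<subseteq> L" for B using c.nn_nonneg that by (auto intro!: sum_nonneg)
    have g0: "0 \<le> g B" if "B \<subseteq> L" for B unfolding g_def using \<epsilon> nnB[OF that] by simp
    have gmono: "g B \<le> 1" if "B \<subseteq> L" for B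
    proof -
      have "card B \<le> card L" "sum nn B \<le> ?N" using that finL c.nn_nonneg by (auto intro!: card_mono sum_mono2)
      then have "g B \<le> 27 * \<epsilon> * real (card L) * ?N ^ 4"
        unfolding g_def using \<epsilon> nnB[OF that] by (intro mult_mono power_mono) auto
      then show ?thesis using small by simp
    qed
    \<comment> \<open>Every subset of \<open>X\<close> is smaller than \<open>L\<close>, so the
      induction hypothesis bounds its norm in the first tree by \<open>1 + g B\<close>, which is at
      most \<open>exp (g B)\<close>.\<close>
    have bd: "c.bounded V1 E1 \<theta>1 g X"
      unfolding c.bounded_def c.block_def
    proof (intro conjI allI impI ballI)
      show "X \<subseteq> V1" "X \<subseteq> L" using X LV by auto
      show "\<bar>\<theta>1 e\<bar> \<le> 1" if "e \<in> E1" for e by (rule th1[OF that])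
      fix B assume B: "B \<subseteq> X"
      then have BL: "B \<subseteq> L" using X by auto
      show "0 \<le> g B" by (rule g0[OF BL])
      have "card B < card L" using B X cardL card_mono[OF X(1) B] by linarith
      then have "nrm S (\<lambda>w. ev V1 E1 \<theta>1 P Q B w - ev V2 E2 \<theta>2 P Q B w) \<le> 27 * \<epsilon> * real (card B - 1) * (sum nn B) ^ 4"
      proof (rule less.hyps[OF _ clusters_subset[OF cl BL]])
        show "B \<subseteq> V1" "B \<subseteq> V2" using BL LV by auto
        show "\<bar>?c1 i j - ?c2 i j\<bar> \<le> \<epsilon>" if "i \<in> B" "j \<in> B" for i j
          using close[of i j] that BL by blast
        show "nrm S (ev V2 E2 \<theta>2 P Q A) \<le> 1" if "A \<subseteq> B" for A using n2[of A] that BL by blast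
        show "27 * \<epsilon> * real (card B) * sum nn B ^ 4 \<le> 1" using gmono[OF BL] by (simp add: g_def)
      qed
      also have "\<dots> \<le> g B" unfolding g_def using \<epsilon> nnB[OF BL] by (intro mult_right_mono mult_left_mono) auto
      finally have "nrm S (\<lambda>w. ev V1 E1 \<theta>1 P Q B w) \<le> 1 + g B"
        using nrm_triangle[of S "\<lambda>w. ev V1 E1 \<theta>1 P Q B w - ev V2 E2 \<theta>2 P Q B w" "ev V2 E2 \<theta>2 P Q B"] n2[OF BL]
        by simp
      then show "nrm S (\<lambda>w. ev V1 E1 \<theta>1 P Q B w) \<le> exp (g B)" using exp_ge_add_one_self[of "g B"] by linarith
      fix B' assume B': "B' \<subseteq> X" "B \<inter> B' = {}"
      show "g B + g B' \<le> g (B \<union> B')"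
        unfolding g_def using B B' X finite_subset c.nn_nonneg \<epsilon> by (intro superadditive_bound) auto
    qed
    have K: "exp (g X) \<le> 3" using gmono[OF X(4)] exp_le exp_le_cancel_iff[of "g X" 1] by linarith
    have aV: "a \<in> V1" "b \<in> V1" "a \<in> V2" "b \<in> V2" and XV: "X \<subseteq> V1" "X \<subseteq> V2" using ab LV X by auto
    have Ta: "rtree V1 E1 a" by (rule rtree_reroot[OF T1 aV(1)])
    have prp: "?c2 b m = r * ?c2 a m" if "m \<in> X" for m
    proof -
      \<comment> \<open>With coefficients 0 and 1 a leaf contributes its bare spin, so the cherry
        identity specialises to correlations.\<close>
      have l: "leafprod {m} (\<lambda>_. 0) (\<lambda>_. 1) = (\<lambda>x. x m)" by (simp add: leafprod_def fun_eq_iff)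
      have "{m} \<subseteq> L - {a, b}" using that by (auto simp: X_def)
      with ch have "ex V2 E2 \<theta>2 (\<lambda>x. x b * leafprod {m} (\<lambda>_. 0) (\<lambda>_. 1) x) = r * ex V2 E2 \<theta>2 (\<lambda>x. x a * leafprod {m} (\<lambda>_. 0) (\<lambda>_. 1) x)"
        unfolding cherry_def by blast
      then show ?thesis unfolding l cor_def .
    qed
    have le1: "\<bar>?c1 i j\<bar> \<le> 1" if "i \<in> V1" "j \<in> V1" for i j by (rule cor_abs_le_1[OF T1 th1 that])
    have le2: "\<bar>?c2 i j\<bar> \<le> 1" if "i \<in> V2" "j \<in> V2" for i j by (rule cor_abs_le_1[OF T2 th2 that])
    define p where "p = (\<lambda>w. ev V1 E1 \<theta>1 P Q X w)"
    define q where "q = c.spin_ex V1 E1 \<theta>1 a X"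
    define e where "e = c.spin_ex V1 E1 \<theta>1 b X"
    define oo where "oo = (\<lambda>w. ex V1 E1 \<theta>1 (\<lambda>x. x a * x b * c.block X w x))"
    have sumnn: "sum nn X ^ 2 \<le> ?N ^ 2" using N1 nnB[OF X(4)] by (intro power_mono)
    \<comment> \<open>in the second tree \<open>b\<close> is a rescaled copy of \<open>a\<close> as seen from \<open>X\<close>; both estimates transport this to the first tree\<close>
    have est1: "nrm S (\<lambda>w. e w - r * q w) \<le> 12 * \<epsilon> * ?N"
    proof -
      have "nrm S (\<lambda>w. e w - r * q w) \<le> exp (g X) * (\<Sum>m\<in>X. 2 * \<bar>?c1 b m - r * ?c1 a m\<bar> * nn m)"
        unfolding e_def q_def by (rule c.transfer_bound[OF Ta aV(2) bd ab(4)])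
      also have "\<dots> \<le> 3 * (\<Sum>m\<in>X. 4 * \<epsilon> * nn m)"
      proof (rule mult_mono[OF K sum_mono[OF mult_right_mono] _ sum_nonneg[OF mult_nonneg_nonneg]])
        fix m assume m: "m \<in> X"
        then show "0 \<le> nn m" "0 \<le> nn m" using X c.nn_nonneg by auto
        have "?c1 b m - r * ?c1 a m = (?c1 b m - ?c2 b m) - r * (?c1 a m - ?c2 a m)" using prp[OF m] by (simp add: algebra_simps)
        also have "\<bar>\<dots>\<bar> \<le> \<bar>?c1 b m - ?c2 b m\<bar> + \<bar>r\<bar> * \<bar>?c1 a m - ?c2 a m\<bar>"
          unfolding abs_mult[symmetric] by (rule abs_triangle_ineq4)
        also have "\<dots> \<le> \<epsilon> + 1 * \<epsilon>" using close ab m X by (intro add_mono mult_mono) auto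
        finally show "2 * \<bar>?c1 b m - r * ?c1 a m\<bar> \<le> 4 * \<epsilon>" by simp
      qed auto
      also have "\<dots> = 12 * \<epsilon> * sum nn X" by (simp add: sum_distrib_left mult.assoc)
      also have "\<dots> \<le> 12 * \<epsilon> * ?N" using N1 \<epsilon> by (intro mult_left_mono) auto
      finally show ?thesis .
    qed
    have est2: "nrm S (\<lambda>w. oo w - ?c2 a b * p w) \<le> 15 * \<epsilon> * ?N ^ 2"
    proof -
      have "nrm S (\<lambda>w. oo w - ?c1 a b * p w) \<le> exp (g X) * (\<Sum>m\<in>X. \<Sum>m'\<in>X. \<bar>?c1 a m * ?c1 b m' - ?c1 a m' * ?c1 b m\<bar> * (nn m * nn m'))"
        using c.pair_bound[OF Ta aV(2) bd] unfolding oo_def p_def c.block_def .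
      also have "\<dots> \<le> 3 * (\<Sum>m\<in>X. \<Sum>m'\<in>X. 4 * \<epsilon> * (nn m * nn m'))"
      proof -
        let ?D = "\<lambda>m m'. \<bar>?c1 a m * ?c1 b m' - ?c1 a m' * ?c1 b m\<bar>"
        have nnX: "0 \<le> nn m * nn m'" if "m \<in> X" "m' \<in> X" for m m'
          using that X c.nn_nonneg by (auto intro!: mult_nonneg_nonneg)
        have d: "\<bar>?c1 a i * ?c1 b j - ?c2 a i * ?c2 b j\<bar> \<le> 2 * \<epsilon>" if "i \<in> X" "j \<in> X" for i j
        proof -
          have ij: "i \<in> L" "j \<in> L" "i \<in> V1" "j \<in> V2" using that X XV by auto
          have "?c1 a i * ?c1 b j - ?c2 a i * ?c2 b j = ?c1 a i * (?c1 b j - ?c2 b j) + (?c1 a i - ?c2 a i) * ?c2 b j"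
            by (simp add: algebra_simps)
          also have "\<bar>\<dots>\<bar> \<le> \<bar>?c1 a i\<bar> * \<bar>?c1 b j - ?c2 b j\<bar> + \<bar>?c1 a i - ?c2 a i\<bar> * \<bar>?c2 b j\<bar>"
            unfolding abs_mult[symmetric] by (rule abs_triangle_ineq)
          also have "\<dots> \<le> 1 * \<epsilon> + \<epsilon> * 1"
            by (intro add_mono mult_mono close le1 le2 ab ij aV \<epsilon> abs_ge_zero) simp_all
          finally show ?thesis by simp
        qed
        have t: "?D m m' * (nn m * nn m') \<le> 4 * \<epsilon> * (nn m * nn m')" if m: "m \<in> X" "m' \<in> X" for m m'
        proof (rule mult_right_mono[OF _ nnX[OF m]])
          \<comment> \<open>By \<open>prp\<close> the minors of the second tree vanish, so a minor
            of the first is a difference of two products that are each off by at most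
            \<open>2 * \<epsilon>\<close>.\<close>
          have "?c2 a m * ?c2 b m' = ?c2 a m' * ?c2 b m" using prp m by simp
          with d[OF m(1) m(2)] d[OF m(2) m(1)] show "?D m m' \<le> 4 * \<epsilon>" by linarith
        qed
        have "(\<Sum>m\<in>X. \<Sum>m'\<in>X. ?D m m' * (nn m * nn m')) \<le> (\<Sum>m\<in>X. \<Sum>m'\<in>X. 4 * \<epsilon> * (nn m * nn m'))"
          by (intro sum_mono t)
        moreover have "0 \<le> (\<Sum>m\<in>X. \<Sum>m'\<in>X. ?D m m' * (nn m * nn m'))"
          by (intro sum_nonneg mult_nonneg_nonneg[OF abs_ge_zero nnX])
        ultimately show ?thesis using K by (intro mult_mono) auto
      qed
      also have "\<dots> = 12 * \<epsilon> * (sum nn X) ^ 2" unfolding power2_eq_square sum_product by (simp add: sum_distrib_left mult.assoc)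
      also have "\<dots> \<le> 12 * \<epsilon> * ?N ^ 2" using sumnn \<epsilon> by (intro mult_left_mono) auto
      finally have 1: "nrm S (\<lambda>w. oo w - ?c1 a b * p w) \<le> 12 * \<epsilon> * ?N ^ 2" .
      \<comment> \<open>Passing from \<open>?c1 a b\<close> to \<open>?c2 a b\<close> costs
        \<open>\<epsilon>\<close> times the norm of \<open>p\<close>; this raises 12 to 15.\<close>
      have p3: "nrm S p \<le> 3" using bd K unfolding c.bounded_def c.block_def p_def by force
      have "\<bar>?c1 a b - ?c2 a b\<bar> * nrm S p \<le> \<epsilon> * 3" using close[OF ab(1,2)] p3 \<epsilon> nrm_nonneg by (intro mult_mono) auto
      also have "\<dots> \<le> \<epsilon> * (3 * ?N ^ 2)" using N1 \<epsilon> by (intro mult_left_mono) auto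
      finally have 2: "nrm S (\<lambda>w. (?c1 a b - ?c2 a b) * p w) \<le> 3 * \<epsilon> * ?N ^ 2" unfolding nrm_cmult by simp
      have "(\<lambda>w. oo w - ?c2 a b * p w) = (\<lambda>w. (oo w - ?c1 a b * p w) + (?c1 a b - ?c2 a b) * p w)"
        by (simp add: algebra_simps)
      then show ?thesis using nrm_triangle[of S "\<lambda>w. oo w - ?c1 a b * p w" "\<lambda>w. (?c1 a b - ?c2 a b) * p w"] 1 2 by simp
    qed
    define P' where "P' = P(a := \<lambda>w. P a w * P b w + ?c2 a b * (Q a w * Q b w))"
    define Q' where "Q' = Q(a := \<lambda>w. Q a w * P b w + r * (P a w * Q b w))"
    define C' where "C' = C(a := C a \<union> C b)"
    define nn' where "nn' = nn(a := nn a + nn b)"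
    have nP: "nrm S (P l) \<le> 1" if "l \<in> L" for l
      using n2[of "{l}"] ex_leafprod_single[OF T2, of l] that LV by auto
    have cl': "clusters S (L - {b}) P' Q' C' nn'"
      unfolding P'_def Q'_def C'_def nn'_def by (rule merge_clusters[OF cl ab nP[OF ab(1)] nP[OF ab(2)]])
    have sum': "sum nn' (L - {b}) = ?N"
    proof -
      have "sum nn' X = sum nn X" unfolding nn'_def using X by (intro sum.cong) auto
      then have "sum nn' (L - {b}) = nn a + nn b + sum nn X" unfolding X(6)[symmetric] using X(1-3) by (simp add: nn'_def)
      also have "\<dots> = ?N" unfolding X(5)[symmetric] using X(1-3) ab(3) by simp
      finally show ?thesis .
    qed
    have n2': "nrm S (ev V2 E2 \<theta>2 P' Q' B) \<le> 1" if B: "B \<subseteq> L - {b}" for B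
    proof (cases "a \<in> B")
      case True
      have "ev V2 E2 \<theta>2 P' Q' B = ev V2 E2 \<theta>2 P Q (insert b B)"
        unfolding P'_def Q'_def by (rule ext) (rule ev_merge[OF ch finL B True])
      then show ?thesis using n2[of "insert b B"] B ab by auto
    next
      case False
      have "leafprod B (\<lambda>l. P' l w) (\<lambda>l. Q' l w) = leafprod B (\<lambda>l. P l w) (\<lambda>l. Q l w)" for w
        using False by (intro leafprod_cong) (auto simp: P'_def Q'_def)
      then show ?thesis using n2[of B] B by auto
    qed
    have card': "card (L - {b}) = card X + 1" unfolding X(6)[symmetric] using X(1-3) by simp
    have IH: "nrm S (\<lambda>w. ev V1 E1 \<theta>1 P' Q' (L - {b}) w - ev V2 E2 \<theta>2 P' Q' (L - {b}) w) \<le> 27 * \<epsilon> * real (card X) * ?N ^ 4"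
    proof -
      have "27 * \<epsilon> * real (card (L - {b})) * (sum nn' (L - {b})) ^ 4 \<le> 27 * \<epsilon> * real (card L) * ?N ^ 4"
        unfolding sum' card' cardL using \<epsilon> by (intro mult_right_mono mult_left_mono) auto
      also note small
      finally have sm: "27 * \<epsilon> * real (card (L - {b})) * (sum nn' (L - {b})) ^ 4 \<le> 1" .
      have "nrm S (\<lambda>w. ev V1 E1 \<theta>1 P' Q' (L - {b}) w - ev V2 E2 \<theta>2 P' Q' (L - {b}) w)
         \<le> 27 * \<epsilon> * real (card (L - {b}) - 1) * (sum nn' (L - {b})) ^ 4"
        by (rule less.hyps[OF _ cl' _ _ _ _ sm]) (use card' cardL LV close n2' in auto)
      then show ?thesis unfolding sum' card' by simp
    qed
    have ev2: "ev V2 E2 \<theta>2 P' Q' (L - {b}) w = ev V2 E2 \<theta>2 P Q L w" for w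
    proof -
      have "insert b (L - {b}) = L" using ab by auto
      then show ?thesis unfolding P'_def Q'_def using ev_merge[OF ch finL, of "L - {b}" P Q w] ab by auto
    qed
    define D1 where "D1 = (\<lambda>w. (e w - r * q w) * (P a w * Q b w))"
    define D2 where "D2 = (\<lambda>w. (oo w - ?c2 a b * p w) * (Q a w * Q b w))"
    have ev1: "ev V1 E1 \<theta>1 P Q L w - ev V1 E1 \<theta>1 P' Q' (L - {b}) w = D1 w + D2 w" for w
    proof -
      have c: "leafprod X (\<lambda>l. P' l w) (\<lambda>l. Q' l w) = leafprod X (\<lambda>l. P l w) (\<lambda>l. Q l w)"
        using X by (intro leafprod_cong) (auto simp: P'_def Q'_def)
      have "ev V1 E1 \<theta>1 P Q L w = P a w * P b w * p w + Q a w * P b w * q w + P a w * Q b w * e w + Q a w * Q b w * oo w"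
        using ex_two_leaves[OF X(1-3) ab(3), of V1 E1 \<theta>1 "\<lambda>l. P l w" "\<lambda>l. Q l w"]
        unfolding X(5) p_def q_def e_def oo_def c.spin_ex_def c.block_def .
      moreover have "ev V1 E1 \<theta>1 P' Q' (L - {b}) w = P' a w * p w + Q' a w * q w"
        using ex_one_leaf[OF X(1,2), of V1 E1 \<theta>1 "\<lambda>l. P' l w" "\<lambda>l. Q' l w"]
        unfolding X(6) p_def q_def c.spin_ex_def c.block_def c .
      ultimately show ?thesis unfolding D1_def D2_def P'_def Q'_def by (simp add: algebra_simps)
    qed
    have Cab: "C a \<union> C b \<subseteq> S" "\<Union>(C ` X) \<inter> (C a \<union> C b) = {}"
      using c.C_sub ab c.C_disj X by (auto; blast)+
    have dq: "dep (\<Union>(C ` X)) q" "dep (\<Union>(C ` X)) e" "dep (\<Union>(C ` X)) p" "dep (\<Union>(C ` X)) oo"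
      unfolding q_def e_def oo_def p_def c.spin_ex_def
      using c.dep_block[OF X(4)] c.dep_block1[OF X(4)] unfolding c.block_def by auto
    have dP: "dep (C a \<union> C b) (P a)" "dep (C a \<union> C b) (Q a)" "dep (C a \<union> C b) (Q b)"
      using c.dep_P c.dep_Q ab by (blast intro: dep_mono)+
    have nD1: "nrm S D1 \<le> 12 * \<epsilon> * ?N ^ 4"
    proof -
      have "nrm S D1 = nrm S (\<lambda>w. e w - r * q w) * nrm S (\<lambda>w. P a w * Q b w)"
        unfolding D1_def using Cab c.UC_sub[OF X(4)] dq dP
        by (intro nrm_mult[OF c.finite_S, of "\<Union>(C ` X)" _ "C a \<union> C b"] dep_diff dep_mult dep_const) auto
      also have "nrm S (\<lambda>w. P a w * Q b w) = nrm S (P a) * nrm S (Q b)"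
        by (rule nrm_mult[OF c.finite_S c.dep_P[OF ab(1)] c.C_sub[OF ab(1)] c.dep_Q[OF ab(2)] c.C_sub[OF ab(2)] c.C_disj[OF ab(1-3)]])
      also have "nrm S (\<lambda>w. e w - r * q w) * (nrm S (P a) * nrm S (Q b)) \<le> (12 * \<epsilon> * ?N) * (1 * ?N)"
        using est1 nP[OF ab(1)] c.nrm_Q[OF ab(2)] N1 N0 nrm_nonneg \<epsilon> by (intro mult_mono mult_nonneg_nonneg) auto
      also have "\<dots> = 12 * \<epsilon> * ?N ^ 2" by (simp add: power2_eq_square)
      also have "\<dots> \<le> 12 * \<epsilon> * ?N ^ 4" using N1 \<epsilon> by (intro mult_left_mono power_increasing) auto
      finally show ?thesis .
    qed
    have nD2: "nrm S D2 \<le> 15 * \<epsilon> * ?N ^ 4"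
    proof -
      have "nrm S D2 = nrm S (\<lambda>w. oo w - ?c2 a b * p w) * nrm S (\<lambda>w. Q a w * Q b w)"
        unfolding D2_def using Cab c.UC_sub[OF X(4)] dq dP
        by (intro nrm_mult[OF c.finite_S, of "\<Union>(C ` X)" _ "C a \<union> C b"] dep_diff dep_mult dep_const) auto
      also have "nrm S (\<lambda>w. Q a w * Q b w) = nrm S (Q a) * nrm S (Q b)"
        by (rule nrm_mult[OF c.finite_S c.dep_Q[OF ab(1)] c.C_sub[OF ab(1)] c.dep_Q[OF ab(2)] c.C_sub[OF ab(2)] c.C_disj[OF ab(1-3)]])
      also have "nrm S (\<lambda>w. oo w - ?c2 a b * p w) * (nrm S (Q a) * nrm S (Q b)) \<le> (15 * \<epsilon> * ?N ^ 2) * (?N * ?N)"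
        using est2 c.nrm_Q[OF ab(1)] c.nrm_Q[OF ab(2)] N1 N0 nrm_nonneg \<epsilon> by (intro mult_mono mult_nonneg_nonneg) auto
      also have "\<dots> = 15 * \<epsilon> * ?N ^ 4" by (simp add: power2_eq_square power4_eq_xxxx)
      finally show ?thesis .
    qed
    have "(\<lambda>w. ev V1 E1 \<theta>1 P Q L w - ev V2 E2 \<theta>2 P Q L w)
       = (\<lambda>w. (D1 w + D2 w) + (ev V1 E1 \<theta>1 P' Q' (L - {b}) w - ev V2 E2 \<theta>2 P' Q' (L - {b}) w))"
      unfolding ev2 ev1[symmetric] by simp
    then have "nrm S (\<lambda>w. ev V1 E1 \<theta>1 P Q L w - ev V2 E2 \<theta>2 P Q L w)
       \<le> nrm S D1 + nrm S D2 + 27 * \<epsilon> * real (card X) * ?N ^ 4"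
      using nrm_triangle[of S "\<lambda>w. D1 w + D2 w" "\<lambda>w. ev V1 E1 \<theta>1 P' Q' (L - {b}) w - ev V2 E2 \<theta>2 P' Q' (L - {b}) w"]
        nrm_triangle[of S D1 D2] IH by simp
    also have "\<dots> \<le> 12 * \<epsilon> * ?N ^ 4 + 15 * \<epsilon> * ?N ^ 4 + 27 * \<epsilon> * real (card X) * ?N ^ 4"
      using nD1 nD2 by simp
    also have "\<dots> = 27 * \<epsilon> * real (card L - 1) * ?N ^ 4" unfolding cardL by (simp add: algebra_simps)
    finally show ?thesis .
  qed
qed

section \<open>Derivative of the leaf density\<close>

lemma mean_coord:
  assumes "finite S" "l \<in> S"
  shows "mean S (\<lambda>w. w l) = 0"
proof -
  \<comment> \<open>The uniform law is the Ising law of the graph without edges, which makes the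
    sign change of \<open>ex_gauge\<close> available.\<close>
  have m: "mean S f = ex S {} (\<lambda>_. 0) f" for f by (simp add: mean_def ex_def)
  have "ex S {} (\<lambda>_. 0) (\<lambda>w. - 1 * w l) = ex S {} (\<lambda>e. 0 * (\<Prod>k\<in>e. - 1)) (\<lambda>w. w l)"
    using ex_gauge[of "{}" S "\<lambda>w. w l" "\<lambda>_. -1" "\<lambda>_. 0"] dep_coord[OF assms(2)] by auto
  then have "- ex S {} (\<lambda>_. 0) (\<lambda>w. w l) = ex S {} (\<lambda>_. 0) (\<lambda>w. w l)"
    unfolding ex_cmult by simp
  then show ?thesis unfolding m by simp
qed

abbreviation ones :: "nat \<Rightarrow> real" where "ones \<equiv> \<lambda>_. 1"

text \<open>As functions of \<open>w\<close> the factors are independent under the uniform law and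
  have mean 1. Averaging over \<open>w\<close> therefore removes \<open>leafprod\<close> from an
  expectation.\<close>

lemma mean_leafprod:
  assumes "finite S" "X \<subseteq> S"
  shows "mean S (\<lambda>w. leafprod X ones w x) = 1"
proof -
  have "finite X" using assms finite_subset by blast
  then show ?thesis using assms(2)
  proof (induction X rule: finite_induct)
    case empty
    then show ?case using mean_const[OF assms(1), of 1] by simp
  next
    case (insert l X)
    have "mean S (\<lambda>w. leafprod (insert l X) ones w x) = mean S (\<lambda>w. (1 + x l * w l) * leafprod X ones w x)"
      using insert by (simp add: leafprod_insert)
    also have "\<dots> = mean S (\<lambda>w. 1 + x l * w l) * mean S (\<lambda>w. leafprod X ones w x)"
    proof (rule mean_mult[OF assms(1), of "{l}" _ X])
      show "dep {l} (\<lambda>w. 1 + x l * w l)" by (intro dep_add dep_mult dep_const dep_coord) simp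
      show "dep X (\<lambda>w. leafprod X ones w x)"
        unfolding leafprod_def by (intro dep_prod dep_add dep_mult dep_const dep_coord)
    qed (use insert in auto)
    also have "mean S (\<lambda>w. 1 + x l * w l) = 1"
      using insert.prems mean_coord[OF assms(1), of l] mean_const[OF assms(1), of 1] by (simp add: mean_add mean_cmult)
    finally show ?case using insert by simp
  qed
qed

lemma mean_ex_leafprod:
  assumes "finite S" "X \<subseteq> S"
  shows "mean S (\<lambda>w. ex V E \<theta> (\<lambda>x. f x * leafprod X ones w x)) = ex V E \<theta> f"
proof -
  define A where "A = (\<lambda>x. (\<Prod>e\<in>E. 1 + \<theta> e * (\<Prod>k\<in>e. x k)) * f x / 2 ^ card V)"
  have sw: "mean S (\<lambda>w. \<Sum>x\<in>I. h x w) = (\<Sum>x\<in>I. mean S (h x))" for I :: "(nat \<Rightarrow> real) set" and h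
    unfolding mean_def sum_divide_distrib[symmetric] by (rule arg_cong2[OF sum.swap refl])
  have "ex V E \<theta> (\<lambda>x. f x * leafprod X ones w x) = (\<Sum>x\<in>spins V. A x * leafprod X ones w x)" for w
    unfolding ex_def A_def sum_divide_distrib by (intro sum.cong) auto
  then have "mean S (\<lambda>w. ex V E \<theta> (\<lambda>x. f x * leafprod X ones w x)) = (\<Sum>x\<in>spins V. A x)"
    by (simp add: sw mean_cmult mean_leafprod[OF assms])
  also have "\<dots> = ex V E \<theta> f" unfolding ex_def A_def sum_divide_distrib ..
  finally show ?thesis .
qed

lemma leafprod_nonneg:
  assumes "x \<in> spins V" "w \<in> spins S" "X \<subseteq> V" "X \<subseteq> S"
  shows "0 \<le> leafprod X ones w x"
  unfolding leafprod_def
proof (rule prod_nonneg)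
  fix l assume "l \<in> X"
  then have "\<bar>x l\<bar> = 1" "\<bar>w l\<bar> = 1" using spins_abs assms by blast+
  then have "\<bar>x l * w l\<bar> \<le> 1" by (simp add: abs_mult)
  then show "0 \<le> 1 + x l * w l" by linarith
qed

text \<open>The sum and the difference of the two expectations integrate \<open>1 + x u\<close> and
  \<open>1 - x u\<close> against a nonnegative function.\<close>

lemma density_bounds:
  assumes T: "rtree V E u" and th: "\<And>e. e \<in> E \<Longrightarrow> \<bar>\<theta> e\<bar> \<le> 1" and w: "w \<in> spins S" and X: "X \<subseteq> V" "X \<subseteq> S"
  shows "0 \<le> ex V E \<theta> (leafprod X ones w)"
    "\<bar>ex V E \<theta> (\<lambda>x. x u * leafprod X ones w x)\<bar> \<le> ex V E \<theta> (leafprod X ones w)"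
proof -
  have lp: "0 \<le> leafprod X ones w x" if "x \<in> spins V" for x by (rule leafprod_nonneg[OF that w X])
  show "0 \<le> ex V E \<theta> (leafprod X ones w)" by (rule ex_nonneg[OF T th lp])
  have xu: "\<bar>x u\<bar> = 1" if "x \<in> spins V" for x using spins_abs[OF that rtree_props(3)[OF T]] .
  have "0 \<le> ex V E \<theta> (\<lambda>x. leafprod X ones w x + x u * leafprod X ones w x)"
  proof (rule ex_nonneg[OF T th])
    fix x assume x: "x \<in> spins V"
    have "\<bar>x u * leafprod X ones w x\<bar> = leafprod X ones w x" using xu[OF x] lp[OF x] by (simp add: abs_mult)
    then show "0 \<le> leafprod X ones w x + x u * leafprod X ones w x" by linarith
  qed
  moreover have "0 \<le> ex V E \<theta> (\<lambda>x. leafprod X ones w x - x u * leafprod X ones w x)"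
  proof (rule ex_nonneg[OF T th])
    fix x assume x: "x \<in> spins V"
    have "\<bar>x u * leafprod X ones w x\<bar> = leafprod X ones w x" using xu[OF x] lp[OF x] by (simp add: abs_mult)
    then show "0 \<le> leafprod X ones w x - x u * leafprod X ones w x" by linarith
  qed
  ultimately show "\<bar>ex V E \<theta> (\<lambda>x. x u * leafprod X ones w x)\<bar> \<le> ex V E \<theta> (leafprod X ones w)"
    unfolding ex_add ex_diff by linarith
qed

section \<open>Smooth families of edge weights\<close>

lemma differentiable_prod:
  fixes f :: "'a \<Rightarrow> real \<Rightarrow> real"
  assumes "\<And>e. e \<in> E \<Longrightarrow> f e differentiable (at t)"
  shows "(\<lambda>s. \<Prod>e\<in>E. f e s) differentiable (at t)"
  using assms by (induction E rule: infinite_finite_induct) (auto intro: differentiable_mult)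

lemma ex_differentiable:
  assumes "\<And>e. e \<in> E \<Longrightarrow> (\<lambda>s. \<theta> s e) differentiable (at (t::real))"
  shows "\<exists>d. ((\<lambda>s. ex V E (\<theta> s) f) has_real_derivative d) (at t)"
proof -
  have "(\<lambda>s. ex V E (\<theta> s) f) differentiable (at t)"
    unfolding ex_def
  proof (cases "finite (spins V)")
    case True
    then show "(\<lambda>s. (\<Sum>x\<in>spins V. (\<Prod>e\<in>E. 1 + \<theta> s e * (\<Prod>k\<in>e. x k)) * f x) / 2 ^ card V) differentiable (at t)"
    proof (intro differentiable_divide differentiable_sum differentiable_mult[OF _ differentiable_const] ballI)
      fix x
      show "(\<lambda>s. \<Prod>e\<in>E. 1 + \<theta> s e * (\<Prod>k\<in>e. x k)) differentiable (at t)"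
        using assms by (intro differentiable_prod differentiable_add differentiable_mult differentiable_const) auto
    qed auto
  qed auto
  then show ?thesis by (simp add: real_differentiable_def)
qed

text \<open>The choice operator makes this depend on the correlation function alone, so a
  correlation shared by a tree and a subtree has the same derivative by rewriting.\<close>

definition dcor :: "nat set \<Rightarrow> nat set set \<Rightarrow> (real \<Rightarrow> nat set \<Rightarrow> real) \<Rightarrow> real \<Rightarrow> nat \<Rightarrow> nat \<Rightarrow> real" where
  "dcor V E \<theta> t i j = (SOME d. ((\<lambda>s. cor V E (\<theta> s) i j) has_real_derivative d) (at t))"

lemma dcor_eqI: "((\<lambda>s. cor V E (\<theta> s) i j) has_real_derivative d) (at t) \<Longrightarrow> dcor V E \<theta> t i j = d"
  unfolding dcor_def by (rule some_equality) (auto intro: DERIV_unique)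

lemma has_dcor:
  assumes "\<And>e. e \<in> E \<Longrightarrow> (\<lambda>s. \<theta> s e) differentiable (at t)"
  shows "((\<lambda>s. cor V E (\<theta> s) i j) has_real_derivative dcor V E \<theta> t i j) (at t)"
proof -
  obtain d where d: "((\<lambda>s. cor V E (\<theta> s) i j) has_real_derivative d) (at t)"
    using ex_differentiable[of E \<theta> t V "\<lambda>x. x i * x j"] assms unfolding cor_def by auto
  then show ?thesis using dcor_eqI by simp
qed

lemma dcor_join:
  assumes T: "rtree U EU u" "rtree W EW v" "U \<inter> W = {}"
    and d: "\<forall>e\<in>insert {u, v} (EU \<union> EW). (\<lambda>s. \<theta> s e) differentiable (at t)"
    and d': "((\<lambda>s. \<theta> s {u, v}) has_real_derivative \<theta>') (at t)"
  defines "V \<equiv> U \<union> W" and "E \<equiv> insert {u, v} (EU \<union> EW)"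
  shows "i \<in> U \<Longrightarrow> j \<in> U \<Longrightarrow> dcor V E \<theta> t i j = dcor U EU \<theta> t i j"
    and "i \<in> W \<Longrightarrow> j \<in> W \<Longrightarrow> dcor V E \<theta> t i j = dcor W EW \<theta> t i j"
    and "i \<in> U \<Longrightarrow> j \<in> W \<Longrightarrow> dcor V E \<theta> t i j = 
      dcor U EU \<theta> t u i * \<theta> t {u, v} * cor W EW (\<theta> t) v j + cor U EU (\<theta> t) u i * \<theta>' * cor W EW (\<theta> t) v j
      + cor U EU (\<theta> t) u i * \<theta> t {u, v} * dcor W EW \<theta> t v j"
proof -
  note c = cor_join[OF T, folded V_def E_def]
  show "i \<in> U \<Longrightarrow> j \<in> U \<Longrightarrow> dcor V E \<theta> t i j = dcor U EU \<theta> t i j" by (simp add: dcor_def c)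
  show "i \<in> W \<Longrightarrow> j \<in> W \<Longrightarrow> dcor V E \<theta> t i j = dcor W EW \<theta> t i j" by (simp add: dcor_def c)
  assume ij: "i \<in> U" "j \<in> W"
  have dU: "((\<lambda>s. cor U EU (\<theta> s) u i) has_real_derivative dcor U EU \<theta> t u i) (at t)" by (rule has_dcor) (use d in auto)
  have dW: "((\<lambda>s. cor W EW (\<theta> s) v j) has_real_derivative dcor W EW \<theta> t v j) (at t)" by (rule has_dcor) (use d in auto)
  have "((\<lambda>s. cor U EU (\<theta> s) u i * \<theta> s {u, v} * cor W EW (\<theta> s) v j) has_real_derivative 
     (dcor U EU \<theta> t u i * \<theta> t {u, v} + \<theta>' * cor U EU (\<theta> t) u i) * cor W EW (\<theta> t) v j
      + dcor W EW \<theta> t v j * (cor U EU (\<theta> t) u i * \<theta> t {u, v})) (at t)"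
    by (intro DERIV_mult dU dW d')
  moreover have "(\<lambda>s. cor V E (\<theta> s) i j) = (\<lambda>s. cor U EU (\<theta> s) u i * \<theta> s {u, v} * cor W EW (\<theta> s) v j)"
    using c(3)[OF ij] cor_sym[of U EU _ i u] by simp
  ultimately have "dcor V E \<theta> t i j = (dcor U EU \<theta> t u i * \<theta> t {u, v} + \<theta>' * cor U EU (\<theta> t) u i) * cor W EW (\<theta> t) v j
      + dcor W EW \<theta> t v j * (cor U EU (\<theta> t) u i * \<theta> t {u, v})"
    by (intro dcor_eqI) simp
  then show "dcor V E \<theta> t i j = 
      dcor U EU \<theta> t u i * \<theta> t {u, v} * cor W EW (\<theta> t) v j + cor U EU (\<theta> t) u i * \<theta>' * cor W EW (\<theta> t) v j
      + cor U EU (\<theta> t) u i * \<theta> t {u, v} * dcor W EW \<theta> t v j"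
    by (simp add: algebra_simps)
qed

definition dens :: "nat set \<Rightarrow> nat set set \<Rightarrow> (nat set \<Rightarrow> real) \<Rightarrow> nat set \<Rightarrow> (nat \<Rightarrow> real) \<Rightarrow> real" where
  "dens V E \<theta> X w = ex V E \<theta> (leafprod X ones w)"

definition rdens :: "nat set \<Rightarrow> nat set set \<Rightarrow> (nat set \<Rightarrow> real) \<Rightarrow> nat \<Rightarrow> nat set \<Rightarrow> (nat \<Rightarrow> real) \<Rightarrow> real" where
  "rdens V E \<theta> u X w = ex V E \<theta> (\<lambda>x. x u * leafprod X ones w x)"

lemma dep_dens: "dep X (dens V E \<theta> X)" and dep_rdens: "dep X (rdens V E \<theta> u X)"
proof -
  have "leafprod X ones w = leafprod X ones w'" if "\<forall>k\<in>X. w k = w' k" for w w'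
    using that by (intro leafprod_cong) auto
  then show "dep X (dens V E \<theta> X)" "dep X (rdens V E \<theta> u X)"
    unfolding dep_def dens_def rdens_def by metis+
qed

lemma dens_join:
  assumes T: "rtree U EU u" "rtree W EW v" "U \<inter> W = {}" and X: "X \<subseteq> U \<union> W"
  defines "V \<equiv> U \<union> W" and "E \<equiv> insert {u, v} (EU \<union> EW)"
  shows "dens V E \<theta> X w = dens U EU \<theta> (X \<inter> U) w * dens W EW \<theta> (X \<inter> W) w
      + \<theta> {u, v} * rdens U EU \<theta> u (X \<inter> U) w * rdens W EW \<theta> v (X \<inter> W) w"
    and "rdens V E \<theta> u X w = rdens U EU \<theta> u (X \<inter> U) w * dens W EW \<theta> (X \<inter> W) w
      + \<theta> {u, v} * dens U EU \<theta> (X \<inter> U) w * rdens W EW \<theta> v (X \<inter> W) w"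
proof -
  have uU: "u \<in> U" using T rtree_props(3) by auto
  note J = ex_join_leafprod[OF T _ _ X, of _ _ \<theta> ones w, folded V_def E_def]
  show "dens V E \<theta> X w = dens U EU \<theta> (X \<inter> U) w * dens W EW \<theta> (X \<inter> W) w
      + \<theta> {u, v} * rdens U EU \<theta> u (X \<inter> U) w * rdens W EW \<theta> v (X \<inter> W) w"
    using J[OF dep_const[of _ 1] dep_const[of _ 1]] by (simp add: dens_def rdens_def)
  show "rdens V E \<theta> u X w = rdens U EU \<theta> u (X \<inter> U) w * dens W EW \<theta> (X \<inter> W) w
      + \<theta> {u, v} * dens U EU \<theta> (X \<inter> U) w * rdens W EW \<theta> v (X \<inter> W) w"
    using J[OF dep_coord[OF uU] dep_const[of _ 1]] ex_square[OF uU] by (simp add: dens_def rdens_def)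
qed

lemma mean_dens:
  assumes "rtree V E u" "finite S" "X \<subseteq> S"
  shows "mean S (dens V E \<theta> X) = 1" "mean S (rdens V E \<theta> u X) = 0"
proof -
  show "mean S (dens V E \<theta> X) = 1"
    using mean_ex_leafprod[OF assms(2,3), of V E \<theta> "\<lambda>x. 1"] ex_one[OF assms(1)] by (simp add: dens_def[abs_def])
  show "mean S (rdens V E \<theta> u X) = 0"
    using mean_ex_leafprod[OF assms(2,3), of V E \<theta> "\<lambda>x. x u"] ex_coord[OF assms(1) rtree_props(3)[OF assms(1)]]
    by (simp add: rdens_def[abs_def])
qed

lemma sum_Un_pairs:
  fixes f :: "nat \<Rightarrow> nat \<Rightarrow> real"
  assumes "finite A" "finite B" "A \<inter> B = {}"
  shows "(\<Sum>i\<in>A \<union> B. \<Sum>j\<in>A \<union> B. f i j) = (\<Sum>i\<in>A. \<Sum>j\<in>A. f i j) + (\<Sum>i\<in>A. \<Sum>j\<in>B. f i j)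
     + (\<Sum>i\<in>B. \<Sum>j\<in>A. f i j) + (\<Sum>i\<in>B. \<Sum>j\<in>B. f i j)"
  using assms by (simp add: sum.union_disjoint sum.distrib)

text \<open>An even combination dominates its odd companions because sum and difference factor, for
  instance into \<open>(a + t * b) * (c + d)\<close> and
  \<open>(a - t * b) * (c - d)\<close>.\<close>

lemma abs_combination_le:
  fixes a b c d t :: real
  assumes "\<bar>b\<bar> \<le> a" "\<bar>d\<bar> \<le> c" "\<bar>t\<bar> \<le> 1"
  shows "\<bar>a * d + t * b * c\<bar> \<le> a * c + t * b * d" "\<bar>b * c + t * a * d\<bar> \<le> a * c + t * b * d"
proof -
  have tb: "\<bar>t * b\<bar> \<le> a" using assms mult_mono[of "\<bar>t\<bar>" 1 "\<bar>b\<bar>" a] by (simp add: abs_mult)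
  have td: "\<bar>t * d\<bar> \<le> c" using assms mult_mono[of "\<bar>t\<bar>" 1 "\<bar>d\<bar>" c] by (simp add: abs_mult)
  have "0 \<le> (a + t * b) * (c + d)" "0 \<le> (a - t * b) * (c - d)"
    using tb assms by (auto intro!: mult_nonneg_nonneg)
  then show "\<bar>a * d + t * b * c\<bar> \<le> a * c + t * b * d" by (simp add: abs_le_iff algebra_simps)
  have "0 \<le> (a + b) * (c + t * d)" "0 \<le> (a - b) * (c - t * d)"
    using td assms by (auto intro!: mult_nonneg_nonneg)
  then show "\<bar>b * c + t * a * d\<bar> \<le> a * c + t * b * d" by (simp add: abs_le_iff algebra_simps)
qed


text \<open>The invariant of the recursion. \<open>\<sigma>\<close> expands the odd part into leaf
  spins with coefficients \<open>cor u m\<close>; its derivative then has a part from these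
  coefficients and a part from inner pairs, weighted by \<open>\<rho>'\<close>. The domination of
  \<open>\<rho>'\<close> by \<open>\<rho>\<close> mirrors that of odd parts by even parts and keeps
  the weights nonnegative at the next join.\<close>

definition density_derivative ::
  "nat set \<Rightarrow> nat set \<Rightarrow> nat set set \<Rightarrow> (real \<Rightarrow> nat set \<Rightarrow> real) \<Rightarrow> real \<Rightarrow> nat \<Rightarrow> nat set \<Rightarrow>
   (nat \<Rightarrow> nat \<Rightarrow> (nat \<Rightarrow> real) \<Rightarrow> real) \<Rightarrow> (nat \<Rightarrow> nat \<Rightarrow> (nat \<Rightarrow> real) \<Rightarrow> real) \<Rightarrow> (nat \<Rightarrow> (nat \<Rightarrow> real) \<Rightarrow> real) \<Rightarrow> bool" where
  "density_derivative S V E \<theta> t u X \<rho> \<rho>' \<sigma> \<longleftrightarrow>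
    (\<forall>w\<in>spins S.
      ((\<lambda>s. dens V E (\<theta> s) X w) has_real_derivative
        (\<Sum>i\<in>X. \<Sum>j\<in>X. dcor V E \<theta> t i j * (w i * w j * \<rho> i j w))) (at t) \<and>
      ((\<lambda>s. rdens V E (\<theta> s) u X w) has_real_derivative
        (\<Sum>m\<in>X. dcor V E \<theta> t u m * (w m * \<sigma> m w)) + (\<Sum>i\<in>X. \<Sum>j\<in>X. dcor V E \<theta> t i j * (w i * w j * \<rho>' i j w))) (at t) \<and>
      rdens V E (\<theta> t) u X w = (\<Sum>m\<in>X. cor V E (\<theta> t) u m * (w m * \<sigma> m w)) \<and>
      (\<forall>i\<in>X. \<forall>j\<in>X. \<bar>\<rho>' i j w\<bar> \<le> \<rho> i j w) \<and> (\<forall>m\<in>X. 0 \<le> \<sigma> m w)) \<and>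
    (\<forall>i\<in>X. \<forall>j\<in>X. dep X (\<rho> i j) \<and> dep X (\<rho>' i j) \<and> mean S (\<rho> i j) \<le> 1) \<and>
    (\<forall>m\<in>X. dep X (\<sigma> m) \<and> mean S (\<sigma> m) \<le> 1)"

text \<open>For leaves on opposite sides the product rule for \<open>cor i u * h * cor v j\<close>
  matches the derivative of \<open>h * qU * qW\<close>, except for the contributions of inner pairs,
  which enter the weights of pairs on one side. Means stay at most 1 because \<open>pU\<close>,
  \<open>pW\<close> have mean 1 and \<open>qU\<close>, \<open>qW\<close> mean 0.\<close>

lemma density_derivative_join:
  assumes T: "rtree U EU u" "rtree W EW v" "U \<inter> W = {}"
    and XV: "X \<subseteq> U \<union> W" "X \<subseteq> S" and S: "finite S"
    and d: "\<And>e. e \<in> insert {u, v} (EU \<union> EW) \<Longrightarrow> (\<lambda>s. \<theta> s e) differentiable (at t)"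
    and th: "\<And>e. e \<in> insert {u, v} (EU \<union> EW) \<Longrightarrow> \<bar>\<theta> t e\<bar> \<le> 1"
    and hU: "density_derivative S U EU \<theta> t u (X \<inter> U) \<rho>U \<rho>U' \<sigma>U"
    and hW: "density_derivative S W EW \<theta> t v (X \<inter> W) \<rho>W \<rho>W' \<sigma>W"
  defines "V \<equiv> U \<union> W" and "E \<equiv> insert {u, v} (EU \<union> EW)"
    and "A \<equiv> X \<inter> U" and "B \<equiv> X \<inter> W" and "h \<equiv> \<theta> t {u, v}"
  defines "pU \<equiv> dens U EU (\<theta> t) A" and "pW \<equiv> dens W EW (\<theta> t) B"
    and "qU \<equiv> rdens U EU (\<theta> t) u A" and "qW \<equiv> rdens W EW (\<theta> t) v B"
  shows "density_derivative S V E \<theta> t u X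
     (\<lambda>i j w. if i \<in> U then if j \<in> U then \<rho>U i j w * pW w + h * \<rho>U' i j w * qW w else \<sigma>U i w * \<sigma>W j w
        else if j \<in> U then 0 else pU w * \<rho>W i j w + h * qU w * \<rho>W' i j w)
     (\<lambda>i j w. if i \<in> U then if j \<in> U then \<rho>U' i j w * pW w + h * \<rho>U i j w * qW w else 0
        else if j \<in> U then 0 else qU w * \<rho>W i j w + h * pU w * \<rho>W' i j w)
     (\<lambda>m w. if m \<in> U then \<sigma>U m w * pW w else pU w * \<sigma>W m w)"
    (is "density_derivative S V E \<theta> t u X ?\<rho> ?\<rho>' ?\<sigma>")
proof -
  let ?d = "dcor V E \<theta> t" and ?dU = "dcor U EU \<theta> t" and ?dW = "dcor W EW \<theta> t"
  let ?cU = "cor U EU (\<theta> t)" and ?cW = "cor W EW (\<theta> t)"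
  have uU: "u \<in> U" and vW: "v \<in> W" using T rtree_props(3) by auto
  have AB: "X = A \<union> B" "A \<inter> B = {}" "A \<subseteq> U" "B \<subseteq> W" "A \<subseteq> S" "B \<subseteq> S" "finite A" "finite B"
    using XV T S finite_subset[of X S] by (auto simp: A_def B_def)
  have BU: "m \<notin> U" if "m \<in> B" for m using that AB(4) T(3) by auto
  have AU: "m \<in> U" if "m \<in> A" for m using that AB(3) by auto
  obtain h' where h': "((\<lambda>s. \<theta> s {u, v}) has_real_derivative h') (at t)"
    using d[of "{u, v}"] by (auto simp: real_differentiable_def)
  have thU: "\<bar>\<theta> t e\<bar> \<le> 1" if "e \<in> EU" for e using th that by auto
  have thW: "\<bar>\<theta> t e\<bar> \<le> 1" if "e \<in> EW" for e using th that by auto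
  have h1: "\<bar>h\<bar> \<le> 1" using th[of "{u, v}"] by (simp add: h_def)
  have dB: "\<forall>e\<in>insert {u, v} (EU \<union> EW). (\<lambda>s. \<theta> s e) differentiable (at t)" using d by blast
  note dc = dcor_join[where \<theta> = \<theta> and t = t, OF T dB h', folded V_def E_def h_def]
  note c = cor_join[OF T, folded V_def E_def]
  have dc3: "?d i j = ?dU u i * h * ?cW v j + ?cU u i * h' * ?cW v j
      + ?cU u i * h * ?dW v j" if "i \<in> A" "j \<in> B" for i j
    by (rule dc(3)[OF subsetD[OF AB(3) that(1)] subsetD[OF AB(4) that(2)]])
  have c0: "cor U EU \<theta>' u u = 1" "cor W EW \<theta>' v v = 1" for \<theta>' using cor_refl[OF T(1) uU] cor_refl[OF T(2) vW] by auto
  have dc0: "?dU u u = 0" by (rule dcor_eqI) (simp add: c0)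
  have dcu: "?d u m = h' * ?cW v m + h * ?dW v m" if "m \<in> B" for m
    using dc(3)[OF uU subsetD[OF AB(4) that]] by (simp add: c0 dc0)
  have cu: "cor V E (\<theta> t) u m = h * ?cW v m" if "m \<in> B" for m
    using c(3)[OF uU subsetD[OF AB(4) that], of "\<theta> t"] by (simp add: c0 h_def)
  have J: "dens V E (\<theta> s) X w = dens U EU (\<theta> s) A w * dens W EW (\<theta> s) B w + \<theta> s {u, v} * rdens U EU (\<theta> s) u A w * rdens W EW (\<theta> s) v B w"
      "rdens V E (\<theta> s) u X w = rdens U EU (\<theta> s) u A w * dens W EW (\<theta> s) B w + \<theta> s {u, v} * dens U EU (\<theta> s) A w * rdens W EW (\<theta> s) v B w" for s w
    using dens_join[OF T XV(1), of "\<theta> s" w] unfolding V_def E_def A_def B_def by auto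
  have mU: "mean S pU = 1" "mean S qU = 0" using mean_dens[OF T(1) S AB(5)] by (auto simp: pU_def qU_def)
  have mW: "mean S pW = 1" "mean S qW = 0" using mean_dens[OF T(2) S AB(6)] by (auto simp: pW_def qW_def)
  have dp: "dep A pU" "dep A qU" "dep B pW" "dep B qW"
    by (auto simp: pU_def qU_def pW_def qW_def dep_dens dep_rdens)
  note hU = hU[folded A_def, unfolded density_derivative_def] and hW = hW[folded B_def, unfolded density_derivative_def]
  have mm: "mean S (\<lambda>w. f w * g w) = mean S f * mean S g" if "dep A f" "dep B g" for f g
    by (rule mean_mult[OF S that(1) AB(5) that(2) AB(6) AB(2)])
  have nonneg_mean: "0 \<le> mean S f" if "\<And>w. w \<in> spins S \<Longrightarrow> 0 \<le> f w" for f
    unfolding mean_def using that by (intro divide_nonneg_nonneg sum_nonneg) auto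
  show ?thesis
    unfolding density_derivative_def
  proof (intro conjI ballI)
    fix w assume w: "w \<in> spins S"
    define a where "a = (\<lambda>i. w i * \<sigma>U i w)"
    define b where "b = (\<lambda>i. w i * \<sigma>W i w)"
    define dpU where "dpU = (\<Sum>i\<in>A. \<Sum>j\<in>A. ?dU i j * (w i * w j * \<rho>U i j w))"
    define dqU1 where "dqU1 = (\<Sum>m\<in>A. ?dU u m * a m)"
    define dqU2 where "dqU2 = (\<Sum>i\<in>A. \<Sum>j\<in>A. ?dU i j * (w i * w j * \<rho>U' i j w))"
    define dpW where "dpW = (\<Sum>i\<in>B. \<Sum>j\<in>B. ?dW i j * (w i * w j * \<rho>W i j w))"
    define dqW1 where "dqW1 = (\<Sum>m\<in>B. ?dW v m * b m)"
    define dqW2 where "dqW2 = (\<Sum>i\<in>B. \<Sum>j\<in>B. ?dW i j * (w i * w j * \<rho>W' i j w))"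
    have DU: "((\<lambda>s. dens U EU (\<theta> s) A w) has_real_derivative dpU) (at t)"
      "((\<lambda>s. rdens U EU (\<theta> s) u A w) has_real_derivative dqU1 + dqU2) (at t)"
      and qU: "qU w = (\<Sum>m\<in>A. ?cU u m * a m)"
      using hU w by (auto simp: dpU_def dqU1_def dqU2_def a_def qU_def)
    have DW: "((\<lambda>s. dens W EW (\<theta> s) B w) has_real_derivative dpW) (at t)"
      "((\<lambda>s. rdens W EW (\<theta> s) v B w) has_real_derivative dqW1 + dqW2) (at t)"
      and qW: "qW w = (\<Sum>m\<in>B. ?cW v m * b m)"
      using hW w by (auto simp: dpW_def dqW1_def dqW2_def b_def qW_def)
    have D1: "((\<lambda>s. dens V E (\<theta> s) X w) has_real_derivative
        dpU * pW w + dpW * pU w + ((h' * qU w + (dqU1 + dqU2) * h) * qW w + (dqW1 + dqW2) * (h * qU w))) (at t)"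
      unfolding J pU_def pW_def qU_def qW_def h_def
      by (intro DERIV_add DERIV_mult DU DW h')
    have D2: "((\<lambda>s. rdens V E (\<theta> s) u X w) has_real_derivative
        (dqU1 + dqU2) * pW w + dpW * qU w + ((h' * pU w + dpU * h) * qW w + (dqW1 + dqW2) * (h * pU w))) (at t)"
      unfolding J pU_def pW_def qU_def qW_def h_def
      by (intro DERIV_add DERIV_mult DU DW h')
    have s1: "(\<Sum>i\<in>A. \<Sum>j\<in>A. ?d i j * (w i * w j * ?\<rho> i j w)) = dpU * pW w + h * dqU2 * qW w"
    proof -
      have "(\<Sum>i\<in>A. \<Sum>j\<in>A. ?d i j * (w i * w j * ?\<rho> i j w))
        = (\<Sum>i\<in>A. \<Sum>j\<in>A. ?dU i j * (w i * w j * \<rho>U i j w) * pW w + ?dU i j * (w i * w j * \<rho>U' i j w) * (h * qW w))"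
        by (intro sum.cong refl) (simp add: AU dc(1) algebra_simps)
      then show ?thesis by (simp add: dpU_def dqU2_def sum.distrib sum_distrib_right[symmetric])
    qed
    have s2: "(\<Sum>i\<in>B. \<Sum>j\<in>B. ?d i j * (w i * w j * ?\<rho> i j w)) = dpW * pU w + h * dqW2 * qU w"
    proof -
      have "(\<Sum>i\<in>B. \<Sum>j\<in>B. ?d i j * (w i * w j * ?\<rho> i j w))
        = (\<Sum>i\<in>B. \<Sum>j\<in>B. ?dW i j * (w i * w j * \<rho>W i j w) * pU w + ?dW i j * (w i * w j * \<rho>W' i j w) * (h * qU w))"
        using AB(4) by (intro sum.cong refl) (simp add: BU dc(2) subset_iff algebra_simps)
      then show ?thesis by (simp add: dpW_def dqW2_def sum.distrib sum_distrib_right[symmetric])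
    qed
    have s3: "(\<Sum>i\<in>A. \<Sum>j\<in>B. ?d i j * (w i * w j * ?\<rho> i j w)) = h * dqU1 * qW w + h' * qU w * qW w + h * qU w * dqW1"
    proof -
      have "(\<Sum>i\<in>A. \<Sum>j\<in>B. ?d i j * (w i * w j * ?\<rho> i j w))
        = (\<Sum>i\<in>A. \<Sum>j\<in>B. h * ((?dU u i * a i) * (?cW v j * b j))
          + h' * ((?cU u i * a i) * (?cW v j * b j))
          + h * ((?cU u i * a i) * (?dW v j * b j)))"
        by (intro sum.cong refl) (simp add: AU BU dc3 a_def b_def algebra_simps)
      also have "\<dots> = h * (dqU1 * qW w) + h' * (qU w * qW w) + h * (qU w * dqW1)"
        unfolding dqU1_def dqW1_def qU qW sum_product sum.distrib sum_distrib_left[symmetric] ..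
      finally show ?thesis by (simp add: mult.assoc)
    qed
    \<comment> \<open>The sums run over ordered pairs; a pair separated by the cut is charged only
      with its end in \<open>U\<close> first, so it is not counted twice.\<close>
    have s4: "(\<Sum>i\<in>B. \<Sum>j\<in>A. ?d i j * (w i * w j * ?\<rho> i j w)) = 0"
      by (intro sum.neutral ballI) (simp add: AU BU)
    have tot: "(\<Sum>i\<in>X. \<Sum>j\<in>X. ?d i j * (w i * w j * ?\<rho> i j w))
       = dpU * pW w + dpW * pU w + ((h' * qU w + (dqU1 + dqU2) * h) * qW w + (dqW1 + dqW2) * (h * qU w))"
      unfolding AB(1) sum_Un_pairs[OF AB(7,8,2)] s1 s2 s3 s4 by (simp add: algebra_simps)
    show "((\<lambda>s. dens V E (\<theta> s) X w) has_real_derivative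
        (\<Sum>i\<in>X. \<Sum>j\<in>X. ?d i j * (w i * w j * ?\<rho> i j w))) (at t)"
      unfolding tot by (rule D1)
    have r1: "(\<Sum>i\<in>A. \<Sum>j\<in>A. ?d i j * (w i * w j * ?\<rho>' i j w)) = dqU2 * pW w + h * dpU * qW w"
    proof -
      have "(\<Sum>i\<in>A. \<Sum>j\<in>A. ?d i j * (w i * w j * ?\<rho>' i j w))
        = (\<Sum>i\<in>A. \<Sum>j\<in>A. ?dU i j * (w i * w j * \<rho>U' i j w) * pW w + ?dU i j * (w i * w j * \<rho>U i j w) * (h * qW w))"
        by (intro sum.cong refl) (simp add: AU dc(1) algebra_simps)
      then show ?thesis by (simp add: dpU_def dqU2_def sum.distrib sum_distrib_right[symmetric])
    qed
    have r2: "(\<Sum>i\<in>B. \<Sum>j\<in>B. ?d i j * (w i * w j * ?\<rho>' i j w)) = dpW * qU w + h * dqW2 * pU w"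
    proof -
      have "(\<Sum>i\<in>B. \<Sum>j\<in>B. ?d i j * (w i * w j * ?\<rho>' i j w))
        = (\<Sum>i\<in>B. \<Sum>j\<in>B. ?dW i j * (w i * w j * \<rho>W i j w) * qU w + ?dW i j * (w i * w j * \<rho>W' i j w) * (h * pU w))"
        using AB(4) by (intro sum.cong refl) (simp add: BU dc(2) subset_iff algebra_simps)
      then show ?thesis by (simp add: dpW_def dqW2_def sum.distrib sum_distrib_right[symmetric])
    qed
    have r34: "(\<Sum>i\<in>A. \<Sum>j\<in>B. ?d i j * (w i * w j * ?\<rho>' i j w)) = 0"
      "(\<Sum>i\<in>B. \<Sum>j\<in>A. ?d i j * (w i * w j * ?\<rho>' i j w)) = 0"
      by (intro sum.neutral ballI; simp add: AU BU)+
    have x1: "(\<Sum>m\<in>A. ?d u m * (w m * ?\<sigma> m w)) = dqU1 * pW w"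
      unfolding dqU1_def sum_distrib_right using uU by (intro sum.cong refl) (simp add: AU dc(1) a_def)
    have x2: "(\<Sum>m\<in>B. ?d u m * (w m * ?\<sigma> m w)) = pU w * (h' * qW w + h * dqW1)"
      unfolding dqW1_def qW sum_distrib_left sum.distrib[symmetric]
      by (intro sum.cong refl) (simp add: BU dcu b_def algebra_simps)
    have x: "(\<Sum>m\<in>X. ?d u m * (w m * ?\<sigma> m w)) = dqU1 * pW w + pU w * (h' * qW w + h * dqW1)"
      unfolding AB(1) sum.union_disjoint[OF AB(7,8,2)] x1 x2 ..
    have tot': "(\<Sum>m\<in>X. ?d u m * (w m * ?\<sigma> m w)) + (\<Sum>i\<in>X. \<Sum>j\<in>X. ?d i j * (w i * w j * ?\<rho>' i j w))
       = (dqU1 + dqU2) * pW w + dpW * qU w + ((h' * pU w + dpU * h) * qW w + (dqW1 + dqW2) * (h * pU w))"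
      unfolding x unfolding AB(1) sum_Un_pairs[OF AB(7,8,2)] r1 r2 r34 by (simp add: algebra_simps)
    show "((\<lambda>s. rdens V E (\<theta> s) u X w) has_real_derivative
        (\<Sum>m\<in>X. ?d u m * (w m * ?\<sigma> m w)) + (\<Sum>i\<in>X. \<Sum>j\<in>X. ?d i j * (w i * w j * ?\<rho>' i j w))) (at t)"
      unfolding tot' by (rule D2)
    have y1: "(\<Sum>m\<in>A. cor V E (\<theta> t) u m * (w m * ?\<sigma> m w)) = qU w * pW w"
      unfolding qU sum_distrib_right using uU by (intro sum.cong refl) (simp add: AU c(1) a_def)
    have y2: "(\<Sum>m\<in>B. cor V E (\<theta> t) u m * (w m * ?\<sigma> m w)) = h * pU w * qW w"
      unfolding qW sum_distrib_left by (intro sum.cong refl) (simp add: BU cu b_def algebra_simps)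
    show "rdens V E (\<theta> t) u X w = (\<Sum>m\<in>X. cor V E (\<theta> t) u m * (w m * ?\<sigma> m w))"
      unfolding AB(1) sum.union_disjoint[OF AB(7,8,2)] y1 y2 unfolding AB(1)[symmetric] J(2) pU_def qU_def pW_def qW_def h_def ..
    have bU: "0 \<le> pU w" "\<bar>qU w\<bar> \<le> pU w"
      using density_bounds[OF T(1) thU w AB(3,5)] by (auto simp: pU_def qU_def dens_def rdens_def)
    have bW: "0 \<le> pW w" "\<bar>qW w\<bar> \<le> pW w"
      using density_bounds[OF T(2) thW w AB(4,6)] by (auto simp: pW_def qW_def dens_def rdens_def)
    fix i assume i: "i \<in> X"
    show "0 \<le> ?\<sigma> i w" using hU hW w bU bW i BU unfolding AB(1) by (auto simp: AU)
    fix j assume j: "j \<in> X"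
    consider "i \<in> A" "j \<in> A" | "i \<in> A" "j \<in> B" | "i \<in> B" "j \<in> A" | "i \<in> B" "j \<in> B" using i j AB by auto
    then show "\<bar>?\<rho>' i j w\<bar> \<le> ?\<rho> i j w"
    proof cases
      case 1
      then have "\<bar>\<rho>U' i j w\<bar> \<le> \<rho>U i j w" using hU w by auto
      from abs_combination_le(2)[OF this bW(2) h1] show ?thesis using 1 by (simp add: AU)
    next
      case 2
      then have "0 \<le> \<sigma>U i w" "0 \<le> \<sigma>W j w" using hU hW w by auto
      then show ?thesis using 2 by (simp add: AU BU)
    next
      case 3 then show ?thesis by (simp add: AU BU)
    next
      case 4
      then have "\<bar>\<rho>W' i j w\<bar> \<le> \<rho>W i j w" using hW w by auto
      from abs_combination_le(2)[OF bU(2) this h1] show ?thesis using 4 by (simp add: BU)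
    qed
  next
    fix i assume i: "i \<in> X"
    have dX: "dep X f" if "dep A f \<or> dep B f" for f using that AB(1) dep_mono by blast
    have dA: "dep X pU" "dep X qU" "dep X pW" "dep X qW" using dp dX by auto
    show "dep X (\<lambda>w. ?\<sigma> i w)"
      using hU hW i dA dX unfolding AB(1) by (auto simp: AU BU intro!: dep_mult)
    show "mean S (\<lambda>w. ?\<sigma> i w) \<le> 1"
      using hU hW i dp mm mU mW unfolding AB(1) by (auto simp: AU BU)
    fix j assume j: "j \<in> X"
    consider "i \<in> A" "j \<in> A" | "i \<in> A" "j \<in> B" | "i \<in> B" "j \<in> A" | "i \<in> B" "j \<in> B" using i j AB by auto
    then have "dep X (\<lambda>w. ?\<rho> i j w) \<and> dep X (\<lambda>w. ?\<rho>' i j w) \<and> mean S (\<lambda>w. ?\<rho> i j w) \<le> 1"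
    proof cases
      case 1
      then have h: "dep A (\<rho>U i j)" "dep A (\<rho>U' i j)" "mean S (\<rho>U i j) \<le> 1" using hU by auto
      have "mean S (\<lambda>w. \<rho>U i j w * pW w + h * (\<rho>U' i j w * qW w)) \<le> 1"
        unfolding mean_add mean_cmult mm[OF h(1) dp(3)] mm[OF h(2) dp(4)] mW using h(3) by simp
      moreover have "dep X (\<lambda>w. \<rho>U i j w * pW w + h * (\<rho>U' i j w * qW w))"
          "dep X (\<lambda>w. \<rho>U' i j w * pW w + h * (\<rho>U i j w * qW w))"
        by (intro dep_add dep_mult dep_const dA dX disjI1 h)+
      ultimately show ?thesis using 1 by (simp add: AU mult.assoc)
    next
      case 2
      then have h: "dep A (\<sigma>U i)" "dep B (\<sigma>W j)" "mean S (\<sigma>U i) \<le> 1" "mean S (\<sigma>W j) \<le> 1"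
        "0 \<le> mean S (\<sigma>U i)" "0 \<le> mean S (\<sigma>W j)" using hU hW by (auto intro!: nonneg_mean)
      have "mean S (\<lambda>w. \<sigma>U i w * \<sigma>W j w) \<le> 1" unfolding mm[OF h(1,2)] using h by (intro mult_le_one) auto
      moreover have "dep X (\<lambda>w. \<sigma>U i w * \<sigma>W j w)"
        by (rule dep_mult[OF dX[OF disjI1[OF h(1)]] dX[OF disjI2[OF h(2)]]])
      ultimately show ?thesis using 2 by (simp add: AU BU)
    next
      case 3 then show ?thesis by (simp add: AU BU mean_const[OF S])
    next
      case 4
      then have h: "dep B (\<rho>W i j)" "dep B (\<rho>W' i j)" "mean S (\<rho>W i j) \<le> 1" using hW by auto
      have "mean S (\<lambda>w. pU w * \<rho>W i j w + h * (qU w * \<rho>W' i j w)) \<le> 1"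
        unfolding mean_add mean_cmult mm[OF dp(1) h(1)] mm[OF dp(2) h(2)] mU using h(3) by simp
      moreover have "dep X (\<lambda>w. pU w * \<rho>W i j w + h * (qU w * \<rho>W' i j w))"
          "dep X (\<lambda>w. qU w * \<rho>W i j w + h * (pU w * \<rho>W' i j w))"
        by (intro dep_add dep_mult dep_const dA dX disjI2 h)+
      ultimately show ?thesis using 4 by (simp add: BU mult.assoc)
    qed
    then show "dep X (\<lambda>w. ?\<rho> i j w)" "dep X (\<lambda>w. ?\<rho>' i j w)" "mean S (\<lambda>w. ?\<rho> i j w) \<le> 1" by auto
  qed
qed

lemma density_derivative_exists:
  assumes "rtree V E u" "X \<subseteq> V" "X \<subseteq> S" and S: "finite S"
    and "\<And>e. e \<in> E \<Longrightarrow> (\<lambda>s. \<theta> s e) differentiable (at t)"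
    and "\<And>e. e \<in> E \<Longrightarrow> \<bar>\<theta> t e\<bar> \<le> 1"
  shows "\<exists>\<rho> \<rho>' \<sigma>. density_derivative S V E \<theta> t u X \<rho> \<rho>' \<sigma>"
  using assms(1-3,5,6)
proof (induction arbitrary: X)
  case (single u)
  note T = rtree.single[of u]
  have d: "dcor {u} {} \<theta> t u u = 0" by (rule dcor_eqI) (simp add: cor_refl[OF T])
  consider "X = {}" | "X = {u}" using single by auto
  then show ?case
  proof cases
    case 1
    then have "density_derivative S {u} {} \<theta> t u X (\<lambda>_ _ _. 0) (\<lambda>_ _ _. 0) (\<lambda>_ _. 0)"
      using ex_one[OF T] ex_coord[OF T, of u] by (simp add: density_derivative_def dens_def rdens_def)
    then show ?thesis by blast
  next
    case 2
    have p: "dens {u} {} \<theta>' {u} w = 1" for \<theta>' w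
      unfolding dens_def using ex_leafprod_single[OF T, of u \<theta>' ones w] by simp
    have q: "rdens {u} {} \<theta>' u {u} w = w u" for \<theta>' w
    proof -
      have "rdens {u} {} \<theta>' u {u} w = ex {u} {} \<theta>' (\<lambda>x. 1 * x u + w u * 1)"
        unfolding rdens_def by (rule ex_cong) (simp add: leafprod_def algebra_simps spins_square)
      then show ?thesis unfolding ex_add ex_cmult using ex_one[OF T] ex_coord[OF T, of u] by simp
    qed
    have "density_derivative S {u} {} \<theta> t u X (\<lambda>_ _ _. 0) (\<lambda>_ _ _. 0) (\<lambda>_ _. 1)"
      unfolding density_derivative_def 2 p q
      using mean_const[OF S] d cor_refl[OF T, of u] by simp
    then show ?thesis by blast
  qed
next
  case (join U EU u W EW v)
  obtain \<rho>U \<rho>U' \<sigma>U where U: "density_derivative S U EU \<theta> t u (X \<inter> U) \<rho>U \<rho>U' \<sigma>U"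
    using join.IH(1)[of "X \<inter> U"] join.prems by (metis Int_lower1 Int_lower2 UnI1 insertI2 subset_trans)
  obtain \<rho>W \<rho>W' \<sigma>W where W: "density_derivative S W EW \<theta> t v (X \<inter> W) \<rho>W \<rho>W' \<sigma>W"
    using join.IH(2)[of "X \<inter> W"] join.prems by (metis Int_lower1 Int_lower2 UnI2 insertI2 subset_trans)
  show ?case
    by (rule exI, rule exI, rule exI,
        rule density_derivative_join[where \<theta> = \<theta> and t = t, OF join.hyps join.prems(1,2) S join.prems(3,4) U W])
qed

section \<open>Equal topologies\<close>

text \<open>Correlations are squarefree monomials in the edge weights. The edge sets are chosen
  before the weights, so one choice serves a whole interpolation and all sign changes.\<close>

lemma cor_path_product:
  assumes "rtree V E u"
  shows "\<exists>pe. \<forall>i\<in>V. \<forall>j\<in>V. pe i j \<subseteq> E \<and> (\<forall>\<theta>. cor V E \<theta> i j = (\<Prod>e\<in>pe i j. \<theta> e))"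
  using assms
proof induction
  case (single u)
  show ?case using cor_refl[OF rtree.single] by (intro exI[of _ "\<lambda>_ _. {}"]) simp
next
  case (join U EU u W EW v)
  then obtain pU pW where
    pU: "\<And>i j. i \<in> U \<Longrightarrow> j \<in> U \<Longrightarrow> pU i j \<subseteq> EU \<and> (\<forall>\<theta>. cor U EU \<theta> i j = (\<Prod>e\<in>pU i j. \<theta> e))" and
    pW: "\<And>i j. i \<in> W \<Longrightarrow> j \<in> W \<Longrightarrow> pW i j \<subseteq> EW \<and> (\<forall>\<theta>. cor W EW \<theta> i j = (\<Prod>e\<in>pW i j. \<theta> e))"
    by metis
  note T = join.hyps
  have uU: "u \<in> U" and vW: "v \<in> W" using T rtree_props(3) by auto
  define pc where "pc = (\<lambda>i j. insert {u, v} (pU i u \<union> pW v j))"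
  have pc: "pc i j \<subseteq> insert {u, v} (EU \<union> EW) \<and>
     (\<forall>\<theta>. cor (U \<union> W) (insert {u, v} (EU \<union> EW)) \<theta> i j = (\<Prod>e\<in>pc i j. \<theta> e))" if ij: "i \<in> U" "j \<in> W" for i j
  proof -
    have E: "EU \<inter> EW = {}" "{u, v} \<notin> EU" "{u, v} \<notin> EW" "finite EU" "finite EW"
    proof -
      have False if "e \<in> EU" "e \<in> EW" for e
        using rtree_props(4)[OF T(1) that(1)] rtree_props(4)[OF T(2) that(2)] T(3) by (auto simp: card_2_iff)
      then show "EU \<inter> EW = {}" by blast
      show "{u, v} \<notin> EU" "{u, v} \<notin> EW" using rtree_props(4)[OF T(1)] rtree_props(4)[OF T(2)] uU vW T(3) by blast+
      show "finite EU" "finite EW" using T rtree_props(2) by auto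
    qed
    have s: "pU i u \<subseteq> EU" "pW v j \<subseteq> EW" using pU[OF ij(1) uU] pW[OF vW ij(2)] by auto
    then have fin: "finite (pU i u)" "finite (pW v j)" "pU i u \<inter> pW v j = {}" "{u, v} \<notin> pU i u \<union> pW v j"
      using E finite_subset by blast+
    have "cor (U \<union> W) (insert {u, v} (EU \<union> EW)) \<theta> i j = (\<Prod>e\<in>pc i j. \<theta> e)" for \<theta>
      using cor_join(3)[OF T ij, of \<theta>] pU[OF ij(1) uU] pW[OF vW ij(2)] fin
      by (simp add: pc_def prod.union_disjoint)
    then show ?thesis using s by (auto simp: pc_def)
  qed
  define pe where "pe = (\<lambda>i j. if i \<in> U then if j \<in> U then pU i j else pc i j else if j \<in> U then pc j i else pW i j)"
  show ?case
  proof (intro exI[of _ pe] ballI)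
    fix i j assume "i \<in> U \<union> W" "j \<in> U \<union> W"
    then consider "i \<in> U" "j \<in> U" | "i \<in> U" "j \<in> W" "j \<notin> U" | "i \<in> W" "i \<notin> U" "j \<in> U" | "i \<in> W" "j \<in> W" "i \<notin> U" "j \<notin> U" by blast
    then show "pe i j \<subseteq> insert {u, v} (EU \<union> EW) \<and>
      (\<forall>\<theta>. cor (U \<union> W) (insert {u, v} (EU \<union> EW)) \<theta> i j = (\<Prod>e\<in>pe i j. \<theta> e))"
    proof cases
      case 1 then show ?thesis using pU[OF 1] cor_join(1)[OF T 1] by (auto simp: pe_def)
    next
      case 2 then show ?thesis using pc[OF 2(1,2)] by (simp add: pe_def)
    next
      case 3 then show ?thesis using pc[OF 3(3,1)] cor_sym[of "U \<union> W" _ _ i j] by (simp add: pe_def)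
    next
      case 4 then show ?thesis using pW[OF 4(1,2)] cor_join(2)[OF T 4(1,2)] by (auto simp: pe_def)
    qed
  qed
qed

text \<open>Along the geometric interpolation of the edge weights every correlation moves monotonically.\<close>

lemma same_sign_bound:
  assumes T: "rtree V E u" and X: "X \<subseteq> V" "X \<subseteq> S" and S: "finite S"
    and th0: "\<And>e. e \<in> E \<Longrightarrow> \<bar>\<theta>0 e\<bar> \<le> 1" and th1: "\<And>e. e \<in> E \<Longrightarrow> \<bar>\<theta>1 e\<bar> \<le> 1"
    and pos: "\<And>e. e \<in> E \<Longrightarrow> 0 < \<theta>0 e * \<theta>1 e"
  shows "nrm S (\<lambda>w. dens V E \<theta>1 X w - dens V E \<theta>0 X w) \<le> (\<Sum>i\<in>X. \<Sum>j\<in>X. \<bar>cor V E \<theta>1 i j - cor V E \<theta>0 i j\<bar>)"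
proof -
  obtain pe where pe: "\<And>i j. i \<in> V \<Longrightarrow> j \<in> V \<Longrightarrow> pe i j \<subseteq> E \<and> (\<forall>\<theta>. cor V E \<theta> i j = (\<Prod>e\<in>pe i j. \<theta> e))"
    using cor_path_product[OF T] by blast
  have finE: "finite E" and finX: "finite X" using rtree_props(2)[OF T] X S finite_subset by auto
  define a where "a = (\<lambda>e. ln \<bar>\<theta>0 e\<bar>)"
  define b where "b = (\<lambda>e. ln \<bar>\<theta>1 e\<bar>)"
  define \<theta> where "\<theta> = (\<lambda>s e. sgn (\<theta>0 e) * exp ((1 - s) * a e + s * b e))"
  have nz: "\<theta>0 e \<noteq> 0" "\<theta>1 e \<noteq> 0" if "e \<in> E" for e using pos[OF that] by auto
  have end0: "\<theta> 0 e = \<theta>0 e" if "e \<in> E" for e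
    using nz[OF that] by (simp add: \<theta>_def a_def sgn_mult_abs)
  have end1: "\<theta> 1 e = \<theta>1 e" if "e \<in> E" for e
  proof -
    have "sgn (\<theta>0 e) = sgn (\<theta>1 e)" using pos[OF that] by (auto simp: zero_less_mult_iff sgn_if)
    then show ?thesis using nz[OF that] by (simp add: \<theta>_def b_def sgn_mult_abs)
  qed
  have cong: "ex V E \<theta>' f = ex V E \<theta>'' f" if "\<And>e. e \<in> E \<Longrightarrow> \<theta>' e = \<theta>'' e" for \<theta>' \<theta>'' f
    unfolding ex_def using that by (intro arg_cong2[of _ _ _ _ "(/)"] sum.cong arg_cong2[of _ _ _ _ "(*)"] prod.cong) auto
  have d: "(\<lambda>s. \<theta> s e) differentiable (at t)" for e t
  proof -
    have "((\<lambda>s. \<theta> s e) has_real_derivative sgn (\<theta>0 e) * (exp ((1 - t) * a e + t * b e) * (b e - a e))) (at t)"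
      unfolding \<theta>_def by (rule derivative_eq_intros refl | simp add: algebra_simps)+
    then show ?thesis by (auto simp: real_differentiable_def)
  qed
  have bound: "\<bar>\<theta> t e\<bar> \<le> 1" if "e \<in> E" "0 \<le> t" "t \<le> 1" for t e
  proof -
    have "a e \<le> 0" "b e \<le> 0" using nz[OF that(1)] th0[OF that(1)] th1[OF that(1)] by (auto simp: a_def b_def)
    then have "(1 - t) * a e + t * b e \<le> 0" using that by (intro add_nonpos_nonpos mult_nonneg_nonpos) auto
    then show ?thesis using nz(1)[OF that(1)] by (simp add: \<theta>_def abs_mult abs_sgn_eq)
  qed
  define Sg where "Sg = (\<lambda>i j. \<Prod>e\<in>pe i j. sgn (\<theta>0 e))"
  define A where "A = (\<lambda>i j. \<Sum>e\<in>pe i j. a e)"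
  define B where "B = (\<lambda>i j. \<Sum>e\<in>pe i j. b e)"
  have cor: "cor V E (\<theta> s) i j = Sg i j * exp ((1 - s) * A i j + s * B i j)" if "i \<in> V" "j \<in> V" for i j s
  proof -
    have "finite (pe i j)" using pe[OF that] finE finite_subset by blast
    then show ?thesis using pe[OF that]
      by (simp add: \<theta>_def prod.distrib Sg_def A_def B_def exp_sum[symmetric] sum.distrib sum_distrib_left)
  qed
  \<comment> \<open>The exponential of an affine function has a derivative of constant sign, so
    \<open>\<kappa>\<close> does not depend on the time \<open>t\<close>.\<close>
  define \<kappa> where "\<kappa> = (\<lambda>i j. sgn (Sg i j * (B i j - A i j)))"
  have dc: "\<bar>dcor V E \<theta> t i j\<bar> = \<kappa> i j * dcor V E \<theta> t i j" if "i \<in> V" "j \<in> V" for i j t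
  proof -
    have "((\<lambda>s. cor V E (\<theta> s) i j) has_real_derivative Sg i j * (exp ((1 - t) * A i j + t * B i j) * (B i j - A i j))) (at t)"
      unfolding cor[OF that] by (rule derivative_eq_intros refl | simp add: algebra_simps)+
    then have e: "dcor V E \<theta> t i j = (Sg i j * (B i j - A i j)) * exp ((1 - t) * A i j + t * B i j)"
      by (simp add: dcor_eqI)
    have "\<bar>y * exp z\<bar> = sgn y * (y * exp z)" for y z :: real
      by (cases y "0 :: real" rule: linorder_cases) (auto simp: abs_mult)
    then show ?thesis unfolding e \<kappa>_def .
  qed
  have \<kappa>1: "\<bar>\<kappa> i j\<bar> \<le> 1" for i j by (simp add: \<kappa>_def abs_sgn_eq)
  \<comment> \<open>Duality: tested against the sign of the final difference, the densities give a
    quantity that is smooth in time, and its total increment is the L1 distance.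
    \<open>\<Phi>\<close> compares it with the total increment of the correlations.\<close>
  define c where "c = (\<lambda>w. sgn (dens V E \<theta>1 X w - dens V E \<theta>0 X w))"
  have c1: "\<bar>c w\<bar> \<le> 1" for w by (simp add: c_def abs_sgn_eq)
  define \<Phi> where "\<Phi> = (\<lambda>s. mean S (\<lambda>w. c w * dens V E (\<theta> s) X w) - (\<Sum>i\<in>X. \<Sum>j\<in>X. \<kappa> i j * cor V E (\<theta> s) i j))"
  have "\<Phi> 1 \<le> \<Phi> 0"
  proof (rule DERIV_nonpos_imp_nonincreasing[of 0 1 \<Phi>])
    fix t :: real assume t: "0 \<le> t" "t \<le> 1"
    obtain \<rho> \<rho>' \<sigma> where "density_derivative S V E \<theta> t u X \<rho> \<rho>' \<sigma>"
      using density_derivative_exists[where \<theta> = \<theta> and t = t, OF T X S d bound[OF _ t]] by blast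
    then have dd: "\<forall>w\<in>spins S. ((\<lambda>s. dens V E (\<theta> s) X w) has_real_derivative
        (\<Sum>i\<in>X. \<Sum>j\<in>X. dcor V E \<theta> t i j * (w i * w j * \<rho> i j w))) (at t) \<and>
        (\<forall>i\<in>X. \<forall>j\<in>X. \<bar>\<rho>' i j w\<bar> \<le> \<rho> i j w)"
      and \<rho>1: "\<And>i j. i \<in> X \<Longrightarrow> j \<in> X \<Longrightarrow> mean S (\<rho> i j) \<le> 1"
      by (auto simp: density_derivative_def)
    have D: "((\<lambda>s. dens V E (\<theta> s) X w) has_real_derivative
        (\<Sum>i\<in>X. \<Sum>j\<in>X. dcor V E \<theta> t i j * (w i * w j * \<rho> i j w))) (at t)" if "w \<in> spins S" for w
      using dd that by blast
    have \<rho>0: "0 \<le> \<rho> i j w" if "w \<in> spins S" "i \<in> X" "j \<in> X" for w i j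
    proof -
      have "\<bar>\<rho>' i j w\<bar> \<le> \<rho> i j w" using dd that by blast
      then show ?thesis by linarith
    qed
    define m where "m = (\<lambda>i j. mean S (\<lambda>w. c w * (w i * w j * \<rho> i j w)))"
    have "((\<lambda>s. mean S (\<lambda>w. c w * dens V E (\<theta> s) X w)) has_real_derivative
        mean S (\<lambda>w. c w * (\<Sum>i\<in>X. \<Sum>j\<in>X. dcor V E \<theta> t i j * (w i * w j * \<rho> i j w)))) (at t)"
      unfolding mean_def by (intro DERIV_cdivide DERIV_sum DERIV_cmult D)
    moreover have "mean S (\<lambda>w. c w * (\<Sum>i\<in>X. \<Sum>j\<in>X. dcor V E \<theta> t i j * (w i * w j * \<rho> i j w)))
       = (\<Sum>i\<in>X. \<Sum>j\<in>X. dcor V E \<theta> t i j * m i j)"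
    proof -
      have sw: "mean S (\<lambda>w. \<Sum>x\<in>I. h x w) = (\<Sum>x\<in>I. mean S (h x))" for I :: "nat set" and h
        unfolding mean_def sum_divide_distrib[symmetric] by (rule arg_cong2[OF sum.swap refl])
      have "(\<lambda>w. c w * (\<Sum>i\<in>X. \<Sum>j\<in>X. dcor V E \<theta> t i j * (w i * w j * \<rho> i j w)))
        = (\<lambda>w. \<Sum>i\<in>X. \<Sum>j\<in>X. dcor V E \<theta> t i j * (c w * (w i * w j * \<rho> i j w)))"
        by (simp add: sum_distrib_left mult.left_commute)
      then show ?thesis by (simp add: sw mean_cmult m_def)
    qed
    moreover have "((\<lambda>s. \<Sum>i\<in>X. \<Sum>j\<in>X. \<kappa> i j * cor V E (\<theta> s) i j) has_real_derivative
        (\<Sum>i\<in>X. \<Sum>j\<in>X. \<kappa> i j * dcor V E \<theta> t i j)) (at t)"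
      by (intro DERIV_sum DERIV_cmult has_dcor d)
    ultimately have "(\<Phi> has_real_derivative (\<Sum>i\<in>X. \<Sum>j\<in>X. dcor V E \<theta> t i j * m i j)
       - (\<Sum>i\<in>X. \<Sum>j\<in>X. \<kappa> i j * dcor V E \<theta> t i j)) (at t)"
      unfolding \<Phi>_def by (intro DERIV_diff) simp_all
    moreover have "(\<Sum>i\<in>X. \<Sum>j\<in>X. dcor V E \<theta> t i j * m i j) \<le> (\<Sum>i\<in>X. \<Sum>j\<in>X. \<kappa> i j * dcor V E \<theta> t i j)"
    proof (intro sum_mono)
      fix i j assume ij: "i \<in> X" "j \<in> X"
      have "\<bar>m i j\<bar> \<le> mean S (\<rho> i j)"
      proof -
        have le: "\<bar>c w * (w i * w j * \<rho> i j w)\<bar> \<le> \<rho> i j w" if w: "w \<in> spins S" for w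
        proof -
          have "\<bar>w i\<bar> = 1" "\<bar>w j\<bar> = 1" using spins_abs[OF w] ij X by auto
          then have "\<bar>c w * (w i * w j * \<rho> i j w)\<bar> = \<bar>c w\<bar> * \<rho> i j w" using \<rho>0[OF w ij] by (simp add: abs_mult)
          also have "\<dots> \<le> 1 * \<rho> i j w" using c1 \<rho>0[OF w ij] by (intro mult_right_mono) auto
          finally show ?thesis by simp
        qed
        have "\<bar>m i j\<bar> \<le> mean S (\<lambda>w. \<bar>c w * (w i * w j * \<rho> i j w)\<bar>)"
          unfolding m_def mean_def abs_divide by (intro frac_le sum_abs) (auto intro: sum_nonneg)
        also have "\<dots> \<le> mean S (\<rho> i j)" by (rule mean_mono[OF le])
        finally show ?thesis .
      qed
      then have "\<bar>m i j\<bar> \<le> 1" using \<rho>1[OF ij] by linarith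
      then have "dcor V E \<theta> t i j * m i j \<le> \<bar>dcor V E \<theta> t i j\<bar> * 1"
        using abs_le_D1[of "dcor V E \<theta> t i j * m i j"] unfolding abs_mult
        by (metis abs_ge_self abs_ge_zero abs_mult mult_left_mono order_trans)
      then show "dcor V E \<theta> t i j * m i j \<le> \<kappa> i j * dcor V E \<theta> t i j" 
        using dc[OF subsetD[OF X(1) ij(1)] subsetD[OF X(1) ij(2)], of t] by simp
    qed
    ultimately show "\<exists>y. (\<Phi> has_real_derivative y) (at t) \<and> y \<le> 0" by fastforce
  qed simp
  moreover have "dens V E (\<theta> 0) X = dens V E \<theta>0 X" "dens V E (\<theta> 1) X = dens V E \<theta>1 X"
    "cor V E (\<theta> 0) i j = cor V E \<theta>0 i j" "cor V E (\<theta> 1) i j = cor V E \<theta>1 i j" for i j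
    using cong[of "\<theta> 0" \<theta>0, OF end0] cong[of "\<theta> 1" \<theta>1, OF end1] by (auto simp: dens_def cor_def fun_eq_iff)
  ultimately have "mean S (\<lambda>w. c w * dens V E \<theta>1 X w) - mean S (\<lambda>w. c w * dens V E \<theta>0 X w)
     \<le> (\<Sum>i\<in>X. \<Sum>j\<in>X. \<kappa> i j * cor V E \<theta>1 i j) - (\<Sum>i\<in>X. \<Sum>j\<in>X. \<kappa> i j * cor V E \<theta>0 i j)"
    by (simp add: \<Phi>_def)
  also have "\<dots> = (\<Sum>i\<in>X. \<Sum>j\<in>X. \<kappa> i j * (cor V E \<theta>1 i j - cor V E \<theta>0 i j))"
    by (simp add: sum_subtractf right_diff_distrib)
  also have "\<dots> \<le> (\<Sum>i\<in>X. \<Sum>j\<in>X. \<bar>cor V E \<theta>1 i j - cor V E \<theta>0 i j\<bar>)"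
  proof (intro sum_mono)
    fix i j
    have "\<bar>\<kappa> i j * (cor V E \<theta>1 i j - cor V E \<theta>0 i j)\<bar> \<le> 1 * \<bar>cor V E \<theta>1 i j - cor V E \<theta>0 i j\<bar>"
      unfolding abs_mult using \<kappa>1 by (intro mult_right_mono) auto
    then show "\<kappa> i j * (cor V E \<theta>1 i j - cor V E \<theta>0 i j) \<le> \<bar>cor V E \<theta>1 i j - cor V E \<theta>0 i j\<bar>"
      unfolding mult_1 by (rule abs_le_D1)
  qed
  also have "mean S (\<lambda>w. c w * dens V E \<theta>1 X w) - mean S (\<lambda>w. c w * dens V E \<theta>0 X w)
     = nrm S (\<lambda>w. dens V E \<theta>1 X w - dens V E \<theta>0 X w)"
  proof -
    have "nrm S (\<lambda>w. dens V E \<theta>1 X w - dens V E \<theta>0 X w)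
       = mean S (\<lambda>w. c w * dens V E \<theta>1 X w + (-1) * (c w * dens V E \<theta>0 X w))"
      unfolding nrm_def by (rule mean_cong) (simp add: abs_sgn c_def algebra_simps)
    then show ?thesis unfolding mean_add mean_cmult by simp
  qed
  finally show ?thesis .
qed

section \<open>Vanishing weights, and cuts at arbitrary edges\<close>

lemma ex_tendsto:
  assumes "\<And>e. e \<in> E \<Longrightarrow> ((\<lambda>k. \<theta> k e) \<longlongrightarrow> \<theta>' e) F"
  shows "((\<lambda>k. ex V E (\<theta> k) f) \<longlongrightarrow> ex V E \<theta>' f) F"
  unfolding ex_def using assms
  by (intro tendsto_divide tendsto_sum tendsto_mult tendsto_prod tendsto_add tendsto_const) auto

text \<open>Both weights of an edge are pushed slightly towards a common sign
  \<open>\<kappa> e\<close>, which makes their product positive; all quantities are continuous in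
  the weights, so the bound survives the limit.\<close>

lemma weak_sign_bound:
  assumes T: "rtree V E u" and X: "X \<subseteq> V" "X \<subseteq> S" and S: "finite S"
    and th0: "\<And>e. e \<in> E \<Longrightarrow> \<bar>\<theta>0 e\<bar> \<le> 1" and th1: "\<And>e. e \<in> E \<Longrightarrow> \<bar>\<theta>1 e\<bar> \<le> 1"
    and pos: "\<And>e. e \<in> E \<Longrightarrow> 0 \<le> \<theta>0 e * \<theta>1 e"
  shows "nrm S (\<lambda>w. dens V E \<theta>1 X w - dens V E \<theta>0 X w) \<le> (\<Sum>i\<in>X. \<Sum>j\<in>X. \<bar>cor V E \<theta>1 i j - cor V E \<theta>0 i j\<bar>)"
proof -
  define \<kappa> where "\<kappa> = (\<lambda>e. if \<theta>0 e < 0 \<or> \<theta>1 e < 0 then -1 else 1 :: real)"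
  define \<eta> where "\<eta> = (\<lambda>k. inverse (real (Suc k)))"
  define P where "P = (\<lambda>\<theta> k e. (1 - \<eta> k) * \<theta> e + \<eta> k * \<kappa> e)"
  have \<eta>: "0 < \<eta> k" "\<eta> k \<le> 1" for k by (auto simp: \<eta>_def inverse_le_1_iff)
  have \<eta>0: "\<eta> \<longlonglongrightarrow> 0" unfolding \<eta>_def by (rule LIMSEQ_inverse_real_of_nat)
  have \<kappa>: "0 \<le> \<kappa> e * \<theta>0 e" "0 \<le> \<kappa> e * \<theta>1 e" if "e \<in> E" for e
    using pos[OF that] by (auto simp: \<kappa>_def zero_le_mult_iff)
  have lim: "(\<lambda>k. P \<theta> k e) \<longlonglongrightarrow> \<theta> e" for \<theta> e
  proof -
    have "(\<lambda>k. P \<theta> k e) \<longlonglongrightarrow> (1 - 0) * \<theta> e + 0 * \<kappa> e" unfolding P_def by (intro tendsto_intros \<eta>0)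
    then show ?thesis by simp
  qed
  have Pb: "\<bar>P \<theta> k e\<bar> \<le> 1" if "\<bar>\<theta> e\<bar> \<le> 1" for \<theta> k e
  proof -
    have "\<bar>P \<theta> k e\<bar> \<le> \<bar>(1 - \<eta> k) * \<theta> e\<bar> + \<bar>\<eta> k * \<kappa> e\<bar>" unfolding P_def by (rule abs_triangle_ineq)
    also have "\<dots> \<le> (1 - \<eta> k) * 1 + \<eta> k * 1"
      unfolding abs_mult using \<eta>[of k] that by (intro add_mono mult_mono) (auto simp: \<kappa>_def)
    finally show ?thesis by simp
  qed
  have Ppos: "0 < \<kappa> e * P \<theta> k e" if "0 \<le> \<kappa> e * \<theta> e" for \<theta> k e
  proof -
    have "\<kappa> e * P \<theta> k e = (1 - \<eta> k) * (\<kappa> e * \<theta> e) + \<eta> k * (\<kappa> e * \<kappa> e)" by (simp add: P_def algebra_simps)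
    moreover have "\<kappa> e * \<kappa> e = 1" by (simp add: \<kappa>_def)
    moreover have "0 \<le> (1 - \<eta> k) * (\<kappa> e * \<theta> e)" using mult_nonneg_nonneg[of "1 - \<eta> k" "\<kappa> e * \<theta> e"] \<eta>[of k] that by auto
    ultimately show ?thesis using \<eta>(1)[of k] by simp
  qed
  have le: "nrm S (\<lambda>w. dens V E (P \<theta>1 k) X w - dens V E (P \<theta>0 k) X w)
     \<le> (\<Sum>i\<in>X. \<Sum>j\<in>X. \<bar>cor V E (P \<theta>1 k) i j - cor V E (P \<theta>0 k) i j\<bar>)" for k
  proof (rule same_sign_bound[OF T X S])
    fix e assume e: "e \<in> E"
    show "\<bar>P \<theta>0 k e\<bar> \<le> 1" "\<bar>P \<theta>1 k e\<bar> \<le> 1" using Pb th0[OF e] th1[OF e] by auto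
    have "0 < (\<kappa> e * P \<theta>0 k e) * (\<kappa> e * P \<theta>1 k e)" by (rule mult_pos_pos[OF Ppos[where \<theta> = \<theta>0 and e = e, OF \<kappa>(1)[OF e]] Ppos[where \<theta> = \<theta>1 and e = e, OF \<kappa>(2)[OF e]]])
    also have "\<dots> = P \<theta>0 k e * P \<theta>1 k e" by (simp add: \<kappa>_def)
    finally show "0 < P \<theta>0 k e * P \<theta>1 k e" .
  qed
  have l1: "(\<lambda>k. nrm S (\<lambda>w. dens V E (P \<theta>1 k) X w - dens V E (P \<theta>0 k) X w)) \<longlonglongrightarrow> nrm S (\<lambda>w. dens V E \<theta>1 X w - dens V E \<theta>0 X w)"
    unfolding nrm_def mean_def dens_def
    by (intro tendsto_divide tendsto_sum tendsto_rabs tendsto_diff ex_tendsto lim tendsto_const) auto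
  have l2: "(\<lambda>k. \<Sum>i\<in>X. \<Sum>j\<in>X. \<bar>cor V E (P \<theta>1 k) i j - cor V E (P \<theta>0 k) i j\<bar>) \<longlonglongrightarrow> (\<Sum>i\<in>X. \<Sum>j\<in>X. \<bar>cor V E \<theta>1 i j - cor V E \<theta>0 i j\<bar>)"
    unfolding cor_def by (intro tendsto_sum tendsto_rabs tendsto_diff ex_tendsto lim)
  show ?thesis by (rule LIMSEQ_le[OF l1 l2]) (use le in auto)
qed

text \<open>The last application of \<open>join\<close> exposes only one edge as a cut. For an edge
  added earlier, the subtree attached later is carried along with the side that contains the
  attaching node.\<close>

lemma edge_split:
  assumes "rtree V E r" "e \<in> E"
  shows "\<exists>x y U EU W EW. e = {x, y} \<and> split_at V E x y x y U EU W EW"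
  using assms
proof (induction arbitrary: e)
  case (single u)
  then show ?case by simp
next
  case (join U EU u W EW v)
  let ?V = "U \<union> W" and ?E = "insert {u, v} (EU \<union> EW)"
  note T = join.hyps
  have uU: "u \<in> U" and vW: "v \<in> W" using T rtree_props(3) by auto
  consider "e = {u, v}" | "e \<in> EU" | "e \<in> EW" using join.prems by auto
  then show ?case
  proof cases
    case 1
    have "split_at ?V ?E u v u v U EU W EW" using T uU vW by (auto simp: split_at_def)
    with 1 show ?thesis by blast
  next
    case 2
    then obtain x y U1 E1 U2 E2 where e: "e = {x, y}" and s: "split_at U EU x y x y U1 E1 U2 E2" using join.IH(1)[OF 2] by (elim exE conjE)
    note d = split_atD[OF s]
    show ?thesis
    proof (cases "u \<in> U1")
      case True
      have "rtree (U1 \<union> W) (insert {u, v} (E1 \<union> EW)) x" using d T True by (intro rtree_attach) auto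
      then have "split_at ?V ?E x y x y (U1 \<union> W) (insert {u, v} (E1 \<union> EW)) U2 E2"
        using d T unfolding split_at_def by auto
      with e show ?thesis by blast
    next
      case False
      have "rtree (U2 \<union> W) (insert {u, v} (E2 \<union> EW)) y" using d T False uU by (intro rtree_attach) auto
      then have "split_at ?V ?E x y x y U1 E1 (U2 \<union> W) (insert {u, v} (E2 \<union> EW))"
        using d T unfolding split_at_def by auto
      with e show ?thesis by blast
    qed
  next
    case 3
    then obtain x y U1 E1 U2 E2 where e: "e = {x, y}" and s: "split_at W EW x y x y U1 E1 U2 E2" using join.IH(2)[OF 3] by (elim exE conjE)
    note d = split_atD[OF s]
    show ?thesis
    proof (cases "v \<in> U1")
      case True
      have "rtree (U1 \<union> U) (insert {v, u} (E1 \<union> EU)) x" using d T True by (intro rtree_attach) auto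
      then have "split_at ?V ?E x y x y (U1 \<union> U) (insert {v, u} (E1 \<union> EU)) U2 E2"
        using d T unfolding split_at_def by (auto simp: insert_commute)
      with e show ?thesis by blast
    next
      case False
      have "rtree (U2 \<union> U) (insert {v, u} (E2 \<union> EU)) y" using d T False vW by (intro rtree_attach) auto
      then have "split_at ?V ?E x y x y U1 E1 (U2 \<union> U) (insert {v, u} (E2 \<union> EU))"
        using d T unfolding split_at_def by (auto simp: insert_commute)
      with e show ?thesis by blast
    qed
  qed
qed

text \<open>Which alternative holds depends on the side of the edge on which \<open>i\<close> lies;
  the disjunction keeps the statement symmetric and free of cuts.\<close>

lemma edge_cor:
  assumes "rtree V E r" "e \<in> E"
  obtains x y where "e = {x, y}" "x \<noteq> y" "x \<in> V" "y \<in> V"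
    "\<And>\<theta> i. i \<in> V \<Longrightarrow> cor V E \<theta> i y = cor V E \<theta> i x * \<theta> e \<or> cor V E \<theta> i x = cor V E \<theta> i y * \<theta> e"
proof -
  obtain x y U EU W EW where e: "e = {x, y}" and s: "split_at V E x y x y U EU W EW"
    using edge_split[OF assms] by blast
  note d = split_atD[OF s]
  have "x \<noteq> y" using d by auto
  moreover have "cor V E \<theta> i y = cor V E \<theta> i x * \<theta> e \<or> cor V E \<theta> i x = cor V E \<theta> i y * \<theta> e" if "i \<in> V" for \<theta> i
    using split_cor(1,2)[OF s, of i \<theta>] that d(4) e cor_sym[of V E \<theta> i] by (auto simp: mult.commute)
  ultimately show ?thesis using that[of x y] e d(10,11) by blast
qed

section \<open>Flipping leaf spins\<close>

lemma ex_weight_cong: "(\<And>e. e \<in> E \<Longrightarrow> \<theta> e = \<theta>' e) \<Longrightarrow> ex V E \<theta> f = ex V E \<theta>' f"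
  unfolding ex_def by (intro arg_cong2[of _ _ _ _ "(/)"] sum.cong arg_cong2[of _ _ _ _ "(*)"] prod.cong) auto

text \<open>\<open>w\<close> and \<open>x\<close> enter \<open>leafprod\<close> only through
  \<open>x l * w l\<close>, so signs pass from the leaf vector to the configuration and from there
  to the edges.\<close>

lemma dens_gauge:
  assumes T: "rtree V E r" and X: "X \<subseteq> V" and h: "\<And>k. k \<in> V \<Longrightarrow> h k = -1 \<or> h k = 1"
  shows "dens V E \<theta> X (\<lambda>k. h k * w k) = dens V E (\<lambda>e. \<theta> e * (\<Prod>k\<in>e. h k)) X w"
proof -
  have "dens V E \<theta> X (\<lambda>k. h k * w k) = ex V E \<theta> (\<lambda>x. leafprod X ones w (\<lambda>k. h k * x k))"
    unfolding dens_def leafprod_def by (simp add: mult_ac)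
  also have "\<dots> = dens V E (\<lambda>e. \<theta> e * (\<Prod>k\<in>e. h k)) X w"
    unfolding dens_def by (rule ex_gauge[OF _ dep_leafprod[OF X] h]) (use rtree_props(4)[OF T] in auto)
  finally show ?thesis .
qed

lemma gauge_weight_bound:
  assumes T: "rtree V E r" and h: "\<And>k. k \<in> V \<Longrightarrow> h k = -1 \<or> h k = (1::real)" and th: "\<bar>\<theta> e\<bar> \<le> 1" and e: "e \<in> E"
  shows "\<bar>\<theta> e * (\<Prod>k\<in>e. h k)\<bar> \<le> 1"
proof -
  have "\<bar>\<Prod>k\<in>e. h k\<bar> = (\<Prod>k\<in>e. \<bar>h k\<bar>)" by (rule abs_prod)
  also have "\<dots> = 1" using rtree_props(4)[OF T e] h by (intro prod.neutral) force
  finally show ?thesis using th by (simp add: abs_mult)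
qed

lemma nrm_dens:
  assumes T: "rtree V E r" and th: "\<And>e. e \<in> E \<Longrightarrow> \<bar>\<theta> e\<bar> \<le> 1" and X: "X \<subseteq> V" "X \<subseteq> S" and S: "finite S"
  shows "nrm S (dens V E \<theta> X) = 1"
proof -
  have "nrm S (dens V E \<theta> X) = mean S (dens V E \<theta> X)"
    unfolding nrm_def using density_bounds(1)[OF T th _ X] by (intro mean_cong) (simp add: dens_def)
  then show ?thesis using mean_dens(1)[OF T S X(2)] by simp
qed

text \<open>Each edge occurs in one factor of the weight of a configuration, and that factor is
  affine in the edge weight.\<close>

lemma ex_affine:
  assumes "finite E" "e0 \<in> E"
  shows "ex V E (\<theta>(e0 := a * x + (1 - a) * y)) f = a * ex V E (\<theta>(e0 := x)) f + (1 - a) * ex V E (\<theta>(e0 := y)) f"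
proof -
  define R where "R = (\<lambda>z. \<Prod>e\<in>E - {e0}. 1 + \<theta> e * (\<Prod>k\<in>e. z k))"
  have p: "(\<Prod>e\<in>E. 1 + (\<theta>(e0 := c)) e * (\<Prod>k\<in>e. z k)) = (1 + c * (\<Prod>k\<in>e0. z k)) * R z" for c and z :: "nat \<Rightarrow> real"
  proof -
    have "(\<Prod>e\<in>E - {e0}. 1 + (\<theta>(e0 := c)) e * (\<Prod>k\<in>e. z k)) = R z" unfolding R_def by (intro prod.cong) auto
    then show ?thesis using prod.remove[OF assms, of "\<lambda>e. 1 + (\<theta>(e0 := c)) e * (\<Prod>k\<in>e. z k)"] by simp
  qed
  have "(\<Sum>z\<in>spins V. (1 + (a * x + (1 - a) * y) * (\<Prod>k\<in>e0. z k)) * R z * f z)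
    = (\<Sum>z\<in>spins V. a * ((1 + x * (\<Prod>k\<in>e0. z k)) * R z * f z) + (1 - a) * ((1 + y * (\<Prod>k\<in>e0. z k)) * R z * f z))"
    by (intro sum.cong refl) (simp add: algebra_simps)
  then show ?thesis unfolding ex_def p
    by (simp add: sum.distrib sum_distrib_left[symmetric] add_divide_distrib)
qed

text \<open>Both sides are affine in each \<open>\<bar>\<theta> e\<bar>\<close> up to convexity, which reduces the claim to weights in \<open>{-1, 0, 1}\<close>.\<close>

lemma flip_bound:
  assumes T: "rtree V E r" and X: "X \<subseteq> V" "X \<subseteq> S" and S: "finite S"
    and g: "\<And>k. k \<in> V \<Longrightarrow> g k = -1 \<or> g k = 1"
    and th: "\<And>e. e \<in> E \<Longrightarrow> \<bar>\<theta> e\<bar> \<le> 1"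
  shows "nrm S (\<lambda>w. dens V E \<theta> X w - dens V E \<theta> X (\<lambda>k. g k * w k))
    \<le> 2 * (\<Sum>i\<in>{i\<in>X. g i = -1}. \<Sum>j\<in>{j\<in>X. g j = 1}. \<bar>cor V E \<theta> i j\<bar>)"
  using th
proof (induction "card {e\<in>E. \<theta> e \<notin> {-1, 0, 1}}" arbitrary: \<theta> rule: less_induct)
  case less
  let ?F = "{i\<in>X. g i = -1}" and ?G = "{j\<in>X. g j = 1}"
  have finE: "finite E" and finX: "finite X" using rtree_props(2)[OF T] X S finite_subset by auto
  obtain pe where pe: "\<And>i j. i \<in> V \<Longrightarrow> j \<in> V \<Longrightarrow> pe i j \<subseteq> E \<and> (\<forall>\<theta>. cor V E \<theta> i j = (\<Prod>e\<in>pe i j. \<theta> e))"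
    using cor_path_product[OF T] by blast
  show ?case
  proof (cases "\<exists>e0\<in>E. \<theta> e0 \<notin> {-1, 0, 1}")
    case True
    then obtain e0 where e0: "e0 \<in> E" "\<theta> e0 \<notin> {-1, 0, 1}" by blast
    define a where "a = \<bar>\<theta> e0\<bar>"
    define s where "s = sgn (\<theta> e0)"
    have a: "0 \<le> a" "a \<le> 1" and s: "s = -1 \<or> s = 1" "a * s = \<theta> e0"
      using less.prems[OF e0(1)] e0(2) by (auto simp: a_def s_def sgn_if)
    have smaller: "card {e\<in>E. (\<theta>(e0 := c)) e \<notin> {-1, 0, 1}} < card {e\<in>E. \<theta> e \<notin> {-1, 0, 1}}" if "c \<in> {-1, 0, 1}" for c
      using e0 that finE by (intro psubset_card_mono) auto
    let ?D = "\<lambda>\<theta> w. dens V E \<theta> X w - dens V E \<theta> X (\<lambda>k. g k * w k)"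
    let ?R = "\<lambda>\<theta>. \<Sum>i\<in>?F. \<Sum>j\<in>?G. \<bar>cor V E \<theta> i j\<bar>"
    have IH: "nrm S (?D (\<theta>(e0 := c))) \<le> 2 * ?R (\<theta>(e0 := c))" if "c \<in> {-1, 0, 1}" for c
      by (rule less.hyps[OF smaller[OF that]]) (use that less.prems in auto)
    \<comment> \<open>The weight is the mixture of its sign and 0 with coefficients \<open>a\<close>
      and \<open>1 - a\<close>. Densities are affine in it, and the modulus of each correlation is
      exactly the same mixture, because a path uses \<open>e0\<close> at most once.\<close>
    have th: "\<theta> = \<theta>(e0 := a * s + (1 - a) * 0)" using s by auto
    have D: "?D \<theta> w = a * ?D (\<theta>(e0 := s)) w + (1 - a) * ?D (\<theta>(e0 := 0)) w" for w
      by (subst (1 2) th) (unfold dens_def ex_affine[OF finE e0(1)], simp add: algebra_simps)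
    have "nrm S (?D \<theta>) \<le> a * nrm S (?D (\<theta>(e0 := s))) + (1 - a) * nrm S (?D (\<theta>(e0 := 0)))"
      unfolding D using nrm_triangle[of S "\<lambda>w. a * ?D (\<theta>(e0 := s)) w" "\<lambda>w. (1 - a) * ?D (\<theta>(e0 := 0)) w"] a
      unfolding nrm_cmult by simp
    also have "\<dots> \<le> a * (2 * ?R (\<theta>(e0 := s))) + (1 - a) * (2 * ?R (\<theta>(e0 := 0)))"
      using a IH s(1) by (intro add_mono mult_left_mono) auto
    also have "\<dots> = 2 * (\<Sum>i\<in>?F. \<Sum>j\<in>?G. a * \<bar>cor V E (\<theta>(e0 := s)) i j\<bar> + (1 - a) * \<bar>cor V E (\<theta>(e0 := 0)) i j\<bar>)"
      by (simp add: sum.distrib sum_distrib_left[symmetric])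
    also have "\<dots> = 2 * ?R \<theta>"
    proof -
      have "a * \<bar>cor V E (\<theta>(e0 := s)) i j\<bar> + (1 - a) * \<bar>cor V E (\<theta>(e0 := 0)) i j\<bar> = \<bar>cor V E \<theta> i j\<bar>" if "i \<in> X" "j \<in> X" for i j
      proof -
        have ij: "i \<in> V" "j \<in> V" using that X by auto
        have fin: "finite (pe i j)" using pe[OF ij] finE finite_subset by blast
        have c: "cor V E \<theta>' i j = (\<Prod>e\<in>pe i j. \<theta>' e)" for \<theta>' using pe[OF ij] by blast
        show ?thesis
        proof (cases "e0 \<in> pe i j")
          case True
          have rest: "(\<Prod>e\<in>pe i j - {e0}. (\<theta>(e0 := c)) e) = (\<Prod>e\<in>pe i j - {e0}. \<theta> e)" for c by (intro prod.cong) auto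
          have "cor V E (\<theta>(e0 := c)) i j = c * (\<Prod>e\<in>pe i j - {e0}. \<theta> e)" for c
            unfolding c prod.remove[OF fin True] rest by simp
          moreover have "cor V E \<theta> i j = \<theta> e0 * (\<Prod>e\<in>pe i j - {e0}. \<theta> e)"
            unfolding c prod.remove[OF fin True] ..
          ultimately show ?thesis using s(1) by (auto simp: abs_mult a_def)
        next
          case False
          then have "(\<Prod>e\<in>pe i j. (\<theta>(e0 := c)) e) = (\<Prod>e\<in>pe i j. \<theta> e)" for c by (intro prod.cong) auto
          then show ?thesis unfolding c by (simp add: algebra_simps)
        qed
      qed
      then show ?thesis by (intro arg_cong2[of _ _ _ _ "(*)"] refl sum.cong) auto
    qed
    finally show ?thesis .
  next
    case False
    show ?thesis
    proof (cases "\<exists>i\<in>?F. \<exists>j\<in>?G. cor V E \<theta> i j \<noteq> 0")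
      \<comment> \<open>With weights in {-1, 0, 1} a nonzero correlation has modulus 1, so a single
        crossing pair makes the right side at least 2, the trivial bound for the distance of two
        densities.\<close>
      case True
      then obtain i j where ij: "i \<in> ?F" "j \<in> ?G" "cor V E \<theta> i j \<noteq> 0" by blast
      then have V: "i \<in> V" "j \<in> V" using X by auto
      have c: "cor V E \<theta> i j = (\<Prod>e\<in>pe i j. \<theta> e)" and sub: "pe i j \<subseteq> E" using pe[OF V] by auto
      have "\<bar>cor V E \<theta> i j\<bar> = (\<Prod>e\<in>pe i j. \<bar>\<theta> e\<bar>)" unfolding c by (rule abs_prod)
      also have "\<dots> = 1"
      proof (rule prod.neutral, rule ballI)
        fix e assume e: "e \<in> pe i j"
        have "finite (pe i j)" using sub finE finite_subset by blast
        then have "\<theta> e \<noteq> 0" using ij(3) e unfolding c by auto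
        moreover have "\<theta> e \<in> {-1, 0, 1}" using False e sub by blast
        ultimately show "\<bar>\<theta> e\<bar> = 1" by auto
      qed
      finally have "1 \<le> (\<Sum>j\<in>?G. \<bar>cor V E \<theta> i j\<bar>)"
        using member_le_sum[of j ?G "\<lambda>j. \<bar>cor V E \<theta> i j\<bar>"] ij(2) finX by auto
      also have "\<dots> \<le> (\<Sum>i\<in>?F. \<Sum>j\<in>?G. \<bar>cor V E \<theta> i j\<bar>)"
        using ij(1) finX by (intro member_le_sum[of i ?F "\<lambda>i. \<Sum>j\<in>?G. \<bar>cor V E \<theta> i j\<bar>"]) (auto intro: sum_nonneg)
      finally have ge: "1 \<le> (\<Sum>i\<in>?F. \<Sum>j\<in>?G. \<bar>cor V E \<theta> i j\<bar>)" .
      have "nrm S (\<lambda>w. dens V E \<theta> X (\<lambda>k. g k * w k)) = 1"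
        using nrm_dens[of V E r "\<lambda>e. \<theta> e * (\<Prod>k\<in>e. g k)" X S, OF T gauge_weight_bound[where \<theta> = \<theta>, OF T g less.prems] X S]
        by (simp add: dens_gauge[OF T X(1) g])
      then show ?thesis
        using nrm_triangle_diff[of S "dens V E \<theta> X" "\<lambda>w. dens V E \<theta> X (\<lambda>k. g k * w k)"]
          nrm_dens[of V E r \<theta> X S, OF T less.prems X S] ge by linarith
    next
      case nocross: False
      \<comment> \<open>flip a whole cluster of the nonzero edges when it contains a flipped leaf\<close>
      define h where "h = (\<lambda>v. if \<exists>i\<in>?F. cor V E \<theta> i v \<noteq> 0 then -1 else 1 :: real)"
      have h: "h k = -1 \<or> h k = 1" for k by (simp add: h_def)
      have hg: "h k = g k" if "k \<in> X" for k
      proof (cases "g k = -1")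
        case True
        then have "cor V E \<theta> k k \<noteq> 0" using cor_refl[OF T, of k] that X by auto
        then show ?thesis using True that by (auto simp: h_def)
      next
        case False
        then have "g k = 1" using g[of k] that X by auto
        then show ?thesis using nocross that by (auto simp: h_def)
      qed
      have w: "\<theta> e * (\<Prod>k\<in>e. h k) = \<theta> e" if e: "e \<in> E" for e
      proof (cases "\<theta> e = 0")
        case False
        obtain x y where xy: "e = {x, y}" "x \<noteq> y"
          "\<And>i. i \<in> V \<Longrightarrow> cor V E \<theta> i y = cor V E \<theta> i x * \<theta> e \<or> cor V E \<theta> i x = cor V E \<theta> i y * \<theta> e"
          using edge_cor[OF T e] by metis
        have "cor V E \<theta> i x \<noteq> 0 \<longleftrightarrow> cor V E \<theta> i y \<noteq> 0" if "i \<in> V" for i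
          using xy(3)[OF that] False by auto
        then have "h x = h y" using X by (auto simp: h_def)
        then show ?thesis using xy h[of y] by auto
      qed simp
      have "dens V E \<theta> X (\<lambda>k. g k * w k) = dens V E \<theta> X w" for w
      proof -
        have "dens V E \<theta> X (\<lambda>k. g k * w k) = dens V E \<theta> X (\<lambda>k. h k * w k)"
          using hg by (intro depD[OF dep_dens]) auto
        also have "\<dots> = dens V E \<theta> X w"
          unfolding dens_gauge[OF T X(1) h] unfolding dens_def by (rule ex_weight_cong[OF w])
        finally show ?thesis .
      qed
      then show ?thesis by (auto intro!: sum_nonneg)
    qed
  qed
qed

text \<open>The intermediate weights \<open>\<theta>''\<close> take their signs from
  \<open>\<theta>\<close> and their moduli from \<open>\<theta>'\<close>. Changing moduli costs
  \<open>card X ^ 2 * \<epsilon>\<close>; changing signs is a flip of leaf spins and costs twice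
  that.\<close>

lemma same_tree_bound:
  assumes T: "rtree V E r" and X: "X \<subseteq> V" "X \<subseteq> S" and S: "finite S" and \<epsilon>: "0 \<le> \<epsilon>"
    and th: "\<And>e. e \<in> E \<Longrightarrow> \<bar>\<theta> e\<bar> \<le> 1" and th': "\<And>e. e \<in> E \<Longrightarrow> \<bar>\<theta>' e\<bar> \<le> 1"
    and close: "\<And>i j. i \<in> X \<Longrightarrow> j \<in> X \<Longrightarrow> \<bar>cor V E \<theta> i j - cor V E \<theta>' i j\<bar> \<le> \<epsilon>"
  shows "nrm S (\<lambda>w. dens V E \<theta> X w - dens V E \<theta>' X w) \<le> 3 * real (card X) ^ 2 * \<epsilon>"
proof -
  have finE: "finite E" and finX: "finite X" using rtree_props(2)[OF T] X S finite_subset by auto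
  obtain pe where pe: "\<And>i j. i \<in> V \<Longrightarrow> j \<in> V \<Longrightarrow> pe i j \<subseteq> E \<and> (\<forall>\<theta>. cor V E \<theta> i j = (\<Prod>e\<in>pe i j. \<theta> e))"
    using cor_path_product[OF T] by blast
  define s where "s = (\<lambda>e. if \<theta> e < 0 then -1 else 1 :: real)"
  define s' where "s' = (\<lambda>e. if \<theta>' e < 0 then -1 else 1 :: real)"
  define \<theta>'' where "\<theta>'' = (\<lambda>e. s e * \<bar>\<theta>' e\<bar>)"
  define \<tau> where "\<tau> = (\<lambda>e. s e * s' e)"
  have th'': "\<bar>\<theta>'' e\<bar> \<le> 1" if "e \<in> E" for e using th'[OF that] by (simp add: \<theta>''_def s_def abs_mult)
  have \<theta>\<tau>: "\<theta>'' e * \<tau> e = \<theta>' e" for e by (simp add: \<theta>''_def \<tau>_def s_def s'_def)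
  have close'': "\<bar>cor V E \<theta> i j - cor V E \<theta>'' i j\<bar> \<le> \<epsilon>" if "i \<in> X" "j \<in> X" for i j
  proof -
    have V: "i \<in> V" "j \<in> V" using that X by auto
    have c: "cor V E \<theta> i j = (\<Prod>e\<in>pe i j. \<theta> e)" for \<theta> using pe[OF V] by blast
    have "\<theta> = (\<lambda>e. s e * \<bar>\<theta> e\<bar>)" by (auto simp: s_def fun_eq_iff)
    then have "cor V E \<theta> i j = (\<Prod>e\<in>pe i j. s e) * (\<Prod>e\<in>pe i j. \<bar>\<theta> e\<bar>)"
      unfolding c prod.distrib[symmetric] by metis
    then have 1: "cor V E \<theta> i j = (\<Prod>e\<in>pe i j. s e) * \<bar>cor V E \<theta> i j\<bar>" unfolding c abs_prod .
    have 2: "cor V E \<theta>'' i j = (\<Prod>e\<in>pe i j. s e) * \<bar>cor V E \<theta>' i j\<bar>"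
      unfolding c \<theta>''_def prod.distrib abs_prod ..
    have "\<bar>\<Prod>e\<in>pe i j. s e\<bar> = 1" unfolding abs_prod by (intro prod.neutral) (auto simp: s_def)
    \<comment> \<open>Both correlations carry the same product of signs, so only their moduli are
      compared, and taking moduli does not increase distances.\<close>
    then have "\<bar>cor V E \<theta> i j - cor V E \<theta>'' i j\<bar> = \<bar>\<bar>cor V E \<theta> i j\<bar> - \<bar>cor V E \<theta>' i j\<bar>\<bar>"
      by (subst 1, subst 2) (simp add: right_diff_distrib[symmetric] abs_mult)
    also have "\<dots> \<le> \<bar>cor V E \<theta> i j - cor V E \<theta>' i j\<bar>" by (rule abs_triangle_ineq3)
    finally show ?thesis using close[OF that] by simp
  qed
  have "nrm S (\<lambda>w. dens V E \<theta> X w - dens V E \<theta>'' X w) \<le> (\<Sum>i\<in>X. \<Sum>j\<in>X. \<bar>cor V E \<theta> i j - cor V E \<theta>'' i j\<bar>)"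
    by (rule weak_sign_bound[OF T X S th'' th]) (auto simp: \<theta>''_def s_def zero_le_mult_iff mult_nonpos_nonneg)
  also have "\<dots> \<le> (\<Sum>i\<in>X. \<Sum>j\<in>X. \<epsilon>)" by (intro sum_mono close'')
  also have "\<dots> = real (card X) ^ 2 * \<epsilon>" by (simp add: power2_eq_square)
  finally have step1: "nrm S (\<lambda>w. dens V E \<theta> X w - dens V E \<theta>'' X w) \<le> real (card X) ^ 2 * \<epsilon>" .
  have rV: "r \<in> V" using rtree_props(3)[OF T] .
  \<comment> \<open>On a tree every choice of edge signs comes from vertex signs: \<open>g v\<close>
    is the product of \<open>\<tau>\<close> along the path from the root.\<close>
  define g where "g = (\<lambda>v. cor V E \<tau> r v)"
  have g: "g k = -1 \<or> g k = 1" if "k \<in> V" for k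
  proof -
    have "\<bar>g k\<bar> = \<bar>\<Prod>e\<in>pe r k. \<tau> e\<bar>" unfolding g_def using pe[OF rV that] by auto
    also have "\<dots> = 1" unfolding abs_prod by (intro prod.neutral) (auto simp: \<tau>_def s_def s'_def)
    finally show ?thesis by linarith
  qed
  have gE: "(\<Prod>k\<in>e. g k) = \<tau> e" if e: "e \<in> E" for e
  proof -
    obtain x y where xy: "e = {x, y}" "x \<noteq> y" "x \<in> V" "y \<in> V"
          "g y = g x * \<tau> e \<or> g x = g y * \<tau> e"
      using edge_cor[OF T e] rV unfolding g_def by metis
    then show ?thesis using g[OF xy(3)] g[OF xy(4)] by auto
  qed
  have gauge: "\<theta>'' e * (\<Prod>k\<in>e. g k) = \<theta>' e" if "e \<in> E" for e using gE[OF that] \<theta>\<tau> by simp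
  have D: "dens V E \<theta>'' X (\<lambda>k. g k * w k) = dens V E \<theta>' X w" for w
  proof -
    have "dens V E \<theta>'' X (\<lambda>k. g k * w k) = dens V E (\<lambda>e. \<theta>'' e * (\<Prod>k\<in>e. g k)) X w"
      by (rule dens_gauge[OF T X(1)]) (rule g)
    also have "\<dots> = dens V E \<theta>' X w" unfolding dens_def by (rule ex_weight_cong[OF gauge])
    finally show ?thesis .
  qed
  have cg: "cor V E \<theta>' i j = (g i * g j) * cor V E \<theta>'' i j" if "i \<in> X" "j \<in> X" for i j
  proof -
    have "ex V E \<theta>'' (\<lambda>x. (g i * x i) * (g j * x j)) = ex V E (\<lambda>e. \<theta>'' e * (\<Prod>k\<in>e. g k)) (\<lambda>x. x i * x j)"
      using ex_gauge[of E V "\<lambda>x. x i * x j" g \<theta>''] rtree_props(4)[OF T] that X g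
        dep_mult[OF dep_coord dep_coord, of i V j] by blast
    also have "\<dots> = cor V E \<theta>' i j" unfolding cor_def by (rule ex_weight_cong[OF gauge])
    finally have "cor V E \<theta>' i j = ex V E \<theta>'' (\<lambda>x. (g i * g j) * (x i * x j))" by (simp add: mult_ac)
    then show ?thesis unfolding ex_cmult cor_def .
  qed
  let ?F = "{i\<in>X. g i = -1}" and ?G = "{j\<in>X. g j = 1}"
  have "nrm S (\<lambda>w. dens V E \<theta>'' X w - dens V E \<theta>' X w) \<le> 2 * (\<Sum>i\<in>?F. \<Sum>j\<in>?G. \<bar>cor V E \<theta>'' i j\<bar>)"
    using flip_bound[where \<theta> = \<theta>'' and g = g, OF T X S g th''] unfolding D by simp
  also have "\<dots> \<le> 2 * (\<Sum>i\<in>?F. \<Sum>j\<in>?G. \<epsilon>)"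
  proof (intro mult_left_mono sum_mono)
    fix i j assume ij: "i \<in> ?F" "j \<in> ?G"
    \<comment> \<open>The two correlations are opposite, and both lie within
      \<open>\<epsilon>\<close> of \<open>cor V E \<theta> i j\<close>; hence their modulus is at
      most \<open>\<epsilon>\<close>.\<close>
    then have "cor V E \<theta>' i j = - cor V E \<theta>'' i j" using cg[of i j] by auto
    then show "\<bar>cor V E \<theta>'' i j\<bar> \<le> \<epsilon>" using close[of i j] close''[of i j] ij by auto
  qed simp
  also have "\<dots> \<le> 2 * (\<Sum>i\<in>X. \<Sum>j\<in>X. \<epsilon>)"
    using finX \<epsilon> by (intro mult_left_mono order_trans[OF sum_mono[OF sum_mono2] sum_mono2]) (auto intro: sum_nonneg)
  also have "\<dots> = 2 * real (card X) ^ 2 * \<epsilon>" by (simp add: power2_eq_square)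
  finally have step2: "nrm S (\<lambda>w. dens V E \<theta>'' X w - dens V E \<theta>' X w) \<le> 2 * real (card X) ^ 2 * \<epsilon>" .
  have "(\<lambda>w. dens V E \<theta> X w - dens V E \<theta>' X w)
     = (\<lambda>w. (dens V E \<theta> X w - dens V E \<theta>'' X w) + (dens V E \<theta>'' X w - dens V E \<theta>' X w))" by simp
  then have "nrm S (\<lambda>w. dens V E \<theta> X w - dens V E \<theta>' X w)
    \<le> nrm S (\<lambda>w. dens V E \<theta> X w - dens V E \<theta>'' X w) + nrm S (\<lambda>w. dens V E \<theta>'' X w - dens V E \<theta>' X w)"
    using nrm_triangle[of S "\<lambda>w. dens V E \<theta> X w - dens V E \<theta>'' X w" "\<lambda>w. dens V E \<theta>'' X w - dens V E \<theta>' X w"] by simp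
  with step1 step2 show ?thesis by linarith
qed

section \<open>From graphs to rooted trees\<close>

lemma adj_sym: "(u, v) \<in> (adj E)\<^sup>* \<Longrightarrow> (v, u) \<in> (adj E)\<^sup>*"
proof -
  have "sym (adj E)" by (auto simp: sym_def adj_def insert_commute)
  then have "sym ((adj E)\<^sup>*)" by (rule sym_rtrancl)
  then show "(u, v) \<in> (adj E)\<^sup>* \<Longrightarrow> (v, u) \<in> (adj E)\<^sup>*" by (auto simp: sym_def)
qed

lemma adj_mono: "E \<subseteq> E' \<Longrightarrow> (u, v) \<in> (adj E)\<^sup>* \<Longrightarrow> (u, v) \<in> (adj E')\<^sup>*"
  by (rule subsetD[OF rtrancl_mono]) (auto simp: adj_def)

text \<open>Every edge is a bridge: \<open>U\<close> is the component of \<open>u\<close> once the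
  edge is removed and \<open>W\<close> the rest. \<open>W\<close> is connected because a path from
  \<open>u\<close> can enter it only at \<open>v\<close>.\<close>

lemma is_tree_split:
  assumes t: "is_tree V E" and e: "{u, v} \<in> E"
  obtains U W EU EW where "is_tree U EU" "is_tree W EW" "U \<inter> W = {}" "u \<in> U" "v \<in> W" "V = U \<union> W"
    "E = insert {u, v} (EU \<union> EW)"
proof -
  let ?E' = "E - {{u, v}}"
  have V: "finite V" "E \<subseteq> {{u, v} | u v. u \<in> V \<and> v \<in> V \<and> u \<noteq> v}" and con: "connected_graph V E" and acy: "acyclic_graph E"
    using t by (auto simp: is_tree_def)
  have uv: "u \<in> V" "v \<in> V" "u \<noteq> v" using V(2) e by (auto simp: doubleton_eq_iff)
  define U where "U = {z\<in>V. (u, z) \<in> (adj ?E')\<^sup>*}"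
  define W where "W = V - U"
  define EU where "EU = {f\<in>?E'. f \<subseteq> U}"
  define EW where "EW = {f\<in>?E'. f \<subseteq> W}"
  have uU: "u \<in> U" using uv by (simp add: U_def)
  have "v \<notin> U" using acy e by (auto simp: U_def acyclic_graph_def)
  then have vW: "v \<in> W" using uv by (simp add: W_def)
  have step: "x \<in> U \<longleftrightarrow> y \<in> U" if "{x, y} \<in> ?E'" for x y
  proof -
    have V': "x \<in> V" "y \<in> V" using that V(2) by (auto simp: doubleton_eq_iff)
    have a: "(x, y) \<in> adj ?E'" "(y, x) \<in> adj ?E'" using that by (auto simp: adj_def insert_commute)
    have "(u, x) \<in> (adj ?E')\<^sup>* \<longleftrightarrow> (u, y) \<in> (adj ?E')\<^sup>*"
      using a by (meson rtrancl.rtrancl_into_rtrancl)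
    then show ?thesis using V' by (simp add: U_def)
  qed
  have Eeq: "E = insert {u, v} (EU \<union> EW)"
  proof -
    have "f \<in> EU \<union> EW" if f: "f \<in> ?E'" for f
    proof -
      obtain x y where xy: "f = {x, y}" "x \<in> V" "y \<in> V" using f V(2) by blast
      have "x \<in> U \<longleftrightarrow> y \<in> U" using step f xy by blast
      then show ?thesis using f xy by (auto simp: EU_def EW_def W_def)
    qed
    then show ?thesis using e by (auto simp: EU_def EW_def)
  qed
  have reachU: "(u, z) \<in> (adj EU)\<^sup>*" if "z \<in> U" for z
  proof -
    have "(u, z) \<in> (adj ?E')\<^sup>*" using that by (simp add: U_def)
    then have "z \<in> U \<and> (u, z) \<in> (adj EU)\<^sup>*"
    proof (induction rule: rtrancl_induct)
      case base then show ?case using uU by simp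
    next
      case (step y z)
      then have yz: "{y, z} \<in> ?E'" by (simp add: adj_def)
      then have z: "z \<in> U" using step \<open>\<And>x y. {x, y} \<in> ?E' \<Longrightarrow> (x \<in> U) = (y \<in> U)\<close> by blast
      then have "(y, z) \<in> adj EU" using yz step by (auto simp: adj_def EU_def)
      then show ?case using step z by (meson rtrancl.rtrancl_into_rtrancl)
    qed
    then show ?thesis by simp
  qed
  have reachW: "(v, z) \<in> (adj EW)\<^sup>*" if "z \<in> W" for z
  proof -
    have "(u, z) \<in> (adj E)\<^sup>*" using con uv that by (auto simp: connected_graph_def W_def)
    \<comment> \<open>Invariant along a path from \<open>u\<close>: a node outside \<open>U\<close>
      is linked to \<open>v\<close> by edges inside \<open>W\<close>. Each crossing of the bridge
      resets it.\<close>
    then have "z \<in> U \<or> (z \<in> W \<and> (v, z) \<in> (adj EW)\<^sup>*)"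
    proof (induction rule: rtrancl_induct)
      case base then show ?case using uU by simp
    next
      case (step y z)
      then have yz: "{y, z} \<in> E" by (simp add: adj_def)
      show ?case
      proof (cases "{y, z} = {u, v}")
        case True
        then show ?thesis using uU vW by (auto simp: doubleton_eq_iff)
      next
        case False
        then have yz': "{y, z} \<in> ?E'" using yz by simp
        then have eq: "y \<in> U \<longleftrightarrow> z \<in> U" using \<open>\<And>x y. {x, y} \<in> ?E' \<Longrightarrow> (x \<in> U) = (y \<in> U)\<close> by blast
        show ?thesis
        proof (cases "y \<in> U")
          case True then show ?thesis using eq by simp
        next
          case False
          then have y: "y \<in> W" "(v, y) \<in> (adj EW)\<^sup>*" using step by auto
          have z: "z \<in> W" using False eq yz V(2) by (auto simp: W_def doubleton_eq_iff)
          then have "(y, z) \<in> adj EW" using yz' y by (auto simp: adj_def EW_def)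
          then show ?thesis using y z by (meson rtrancl.rtrancl_into_rtrancl)
        qed
      qed
    qed
    then show ?thesis using that by (auto simp: W_def)
  qed
  have acyc: "acyclic_graph F" if "F \<subseteq> E" for F
    unfolding acyclic_graph_def
  proof (intro ballI allI impI)
    fix f x y assume f: "f \<in> F" "f = {x, y}"
    then have "(x, y) \<notin> (adj (E - {f}))\<^sup>*" using acy that by (auto simp: acyclic_graph_def)
    then show "(x, y) \<notin> (adj (F - {f}))\<^sup>*" using adj_mono[of "F - {f}" "E - {f}" x y] that by auto
  qed
  have sub: "F \<subseteq> {{u, v} | u v. u \<in> A \<and> v \<in> A \<and> u \<noteq> v}" if "F \<subseteq> E" "\<And>f. f \<in> F \<Longrightarrow> f \<subseteq> A" for F A
  proof
    fix f assume f: "f \<in> F"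
    have "f \<in> {{u, v} | u v. u \<in> V \<and> v \<in> V \<and> u \<noteq> v}" by (rule subsetD[OF V(2) subsetD[OF that(1) f]])
    then obtain x y where "f = {x, y}" "x \<noteq> y" by blast
    then show "f \<in> {{u, v} | u v. u \<in> A \<and> v \<in> A \<and> u \<noteq> v}" using that(2)[OF f] by blast
  qed
  have "is_tree U EU"
    unfolding is_tree_def connected_graph_def
  proof (intro conjI ballI)
    show "finite U" "U \<noteq> {}" using V(1) uU by (auto simp: U_def)
    show "EU \<subseteq> {{u, v} | u v. u \<in> U \<and> v \<in> U \<and> u \<noteq> v}" by (rule sub) (auto simp: EU_def)
    show "(x, y) \<in> (adj EU)\<^sup>*" if "x \<in> U" "y \<in> U" for x y
      by (rule rtrancl_trans[OF adj_sym[OF reachU[OF that(1)]] reachU[OF that(2)]])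
    show "acyclic_graph EU" by (rule acyc) (auto simp: EU_def)
  qed
  moreover have "is_tree W EW"
    unfolding is_tree_def connected_graph_def
  proof (intro conjI ballI)
    show "finite W" "W \<noteq> {}" using V(1) vW by (auto simp: W_def)
    show "EW \<subseteq> {{u, v} | u v. u \<in> W \<and> v \<in> W \<and> u \<noteq> v}" by (rule sub) (auto simp: EW_def)
    show "(x, y) \<in> (adj EW)\<^sup>*" if "x \<in> W" "y \<in> W" for x y
      by (rule rtrancl_trans[OF adj_sym[OF reachW[OF that(1)]] reachW[OF that(2)]])
    show "acyclic_graph EW" by (rule acyc) (auto simp: EW_def)
  qed
  moreover have "U \<inter> W = {}" "V = U \<union> W" by (auto simp: U_def W_def)
  ultimately show ?thesis using that[OF _ _ _ uU vW _ Eeq] by blast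
qed

text \<open>An edge at \<open>u\<close> is a bridge, and the two components are smaller trees that
  can be rooted at its ends.\<close>

lemma is_tree_rtree:
  assumes "is_tree V E" "u \<in> V"
  shows "rtree V E u"
  using assms
proof (induction "card V" arbitrary: V E u rule: less_induct)
  case less
  have fin: "finite V" and E: "E \<subseteq> {{u, v} | u v. u \<in> V \<and> v \<in> V \<and> u \<noteq> v}" and con: "connected_graph V E"
    using less.prems(1) by (auto simp: is_tree_def)
  show ?case
  proof (cases "V = {u}")
    case True
    then have "E = {}" using E by blast
    then show ?thesis using True rtree.single by simp
  next
    case False
    then obtain z where "z \<in> V" "z \<noteq> u" using less.prems(2) by blast
    then have "(u, z) \<in> (adj E)\<^sup>*" using con less.prems(2) by (auto simp: connected_graph_def)
    then obtain v where uv: "{u, v} \<in> E" using \<open>z \<noteq> u\<close> by (auto simp: adj_def elim: converse_rtranclE)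
    obtain U W EU EW where s: "is_tree U EU" "is_tree W EW" "U \<inter> W = {}" "u \<in> U" "v \<in> W" "V = U \<union> W"
      "E = insert {u, v} (EU \<union> EW)"
      by (rule is_tree_split[OF less.prems(1) uv]) (rule that)
    have "card U < card V" "card W < card V" using s fin by (auto intro!: psubset_card_mono)
    then have "rtree U EU u" "rtree W EW v" using less.hyps s by auto
    then show ?thesis using rtree.join s by simp
  qed
qed

section \<open>The leaf law in terms of densities\<close>

lemma sum_restrict_fibers:
  assumes "finite V" "A \<subseteq> V"
  shows "(\<Sum>y\<in>spins A. \<Sum>x\<in>{x \<in> spins V. restrict x A = y}. h x) = (\<Sum>x\<in>spins V. h x)"
proof (rule sum.group)
  show "finite (spins V)" "finite (spins A)" using assms finite_subset[OF assms(2)] by auto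
  show "(\<lambda>x. restrict x A) ` spins V \<subseteq> spins A"
    using assms(2) by (auto simp: spins_def PiE_def Pi_def)
qed

text \<open>The factor 1/2 of each edge cancels between weight and partition function, and
  \<open>ex_one\<close> gives the partition function of a tree explicitly.\<close>

lemma ising_prob_eq:
  assumes T: "rtree {1..N} E r"
  shows "ising_prob N E \<theta> x = (\<Prod>e\<in>E. 1 + \<theta> e * (\<Prod>k\<in>e. x k)) / 2 ^ N"
proof -
  have w: "ising_weight E \<theta> x = (\<Prod>e\<in>E. 1 + \<theta> e * (\<Prod>k\<in>e. x k)) / 2 ^ card E" for x
    unfolding ising_weight_def by (simp add: prod_dividef)
  have "(\<Sum>z\<in>spins {1..N}. \<Prod>e\<in>E. 1 + \<theta> e * (\<Prod>k\<in>e. z k)) = 2 ^ N"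
    using ex_one[OF T, of \<theta>] by (simp add: ex_def)
  then show ?thesis unfolding ising_prob_def w sum_divide_distrib[symmetric] by simp
qed

text \<open>Each factor \<open>1 + x l * y l\<close> is 2 if the spins agree and 0 otherwise. This
  is why \<open>dens\<close> is the density with respect to the uniform law.\<close>

lemma leafprod_indicator:
  assumes "x \<in> spins V" "{1..n} \<subseteq> V" "y \<in> spins {1..n}"
  shows "leafprod {1..n} ones y x = (if restrict x {1..n} = y then 2 ^ n else 0)"
proof (cases "restrict x {1..n} = y")
  case True
  have "leafprod {1..n} ones y x = (\<Prod>l\<in>{1..n}. 2)"
    unfolding leafprod_def
  proof (rule prod.cong[OF refl])
    fix l assume l: "l \<in> {1..n}"
    then have "y l = x l" using True by auto
    then show "1 + x l * y l = 2" using spins_square[OF assms(1)] l assms(2) by auto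
  qed
  then show ?thesis using True by simp
next
  case False
  obtain l where l: "l \<in> {1..n}" "x l \<noteq> y l"
  proof (rule ccontr)
    assume "\<not> thesis"
    then have "\<forall>l\<in>{1..n}. x l = y l" using that by blast
    then have "restrict x {1..n} = y" using assms(3) by (auto simp: spins_def PiE_def extensional_def fun_eq_iff)
    then show False using False by simp
  qed
  have "x l = -1 \<or> x l = 1" "y l = -1 \<or> y l = 1"
    using spins_value[OF assms(1), of l] spins_value[OF assms(3), of l] l assms(2) by auto
  then have "1 + x l * y l = 0" using l(2) by auto
  then show ?thesis using l(1) False by (auto simp: leafprod_def)
qed

lemma leaf_dist_eq:
  assumes T: "rtree {1..n+n'} E r" and y: "y \<in> spins {1..n}"
  shows "leaf_dist n n' E \<theta> y = dens {1..n+n'} E \<theta> {1..n} y / 2 ^ n"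
proof -
  let ?w = "\<lambda>x. \<Prod>e\<in>E. 1 + \<theta> e * (\<Prod>k\<in>e. x k)"
  have "(\<Sum>x\<in>spins {1..n+n'}. ?w x * leafprod {1..n} ones y x)
    = (\<Sum>x\<in>spins {1..n+n'}. if restrict x {1..n} = y then ?w x * 2 ^ n else 0)"
    using leafprod_indicator[OF _ _ y] by (intro sum.cong) auto
  also have "\<dots> = (\<Sum>x\<in>{x \<in> spins {1..n+n'}. restrict x {1..n} = y}. ?w x * 2 ^ n)"
    by (simp add: sum.inter_filter)
  finally show ?thesis
    unfolding leaf_dist_def dens_def ex_def ising_prob_eq[OF T]
    by (simp add: sum_distrib_right[symmetric] sum_divide_distrib[symmetric])
qed

lemma leaf_corr_eq:
  assumes T: "rtree {1..n+n'} E r" and ij: "i \<in> {1..n}" "j \<in> {1..n}"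
  shows "leaf_corr n (leaf_dist n n' E \<theta>) i j = cor {1..n+n'} E \<theta> i j"
proof -
  have "leaf_corr n (leaf_dist n n' E \<theta>) i j
    = (\<Sum>y\<in>spins {1..n}. \<Sum>x\<in>{x \<in> spins {1..n+n'}. restrict x {1..n} = y}. ising_prob (n+n') E \<theta> x * (x i * x j))"
    unfolding leaf_corr_def leaf_dist_def sum_distrib_right using ij
    by (intro sum.cong refl) (auto simp: mult.assoc)
  also have "\<dots> = (\<Sum>x\<in>spins {1..n+n'}. ising_prob (n+n') E \<theta> x * (x i * x j))"
    by (rule sum_restrict_fibers) auto
  also have "\<dots> = cor {1..n+n'} E \<theta> i j"
    unfolding cor_def ex_def ising_prob_eq[OF T] by (simp add: sum_divide_distrib)
  finally show ?thesis .
qed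

lemma tv_dist_eq:
  assumes "rtree {1..n+n1} E1 r1" "rtree {1..n+n2} E2 r2"
  shows "tv_dist n (leaf_dist n n1 E1 \<theta>1) (leaf_dist n n2 E2 \<theta>2)
    = (1/2) * nrm {1..n} (\<lambda>w. dens {1..n+n1} E1 \<theta>1 {1..n} w - dens {1..n+n2} E2 \<theta>2 {1..n} w)"
  unfolding tv_dist_def nrm_def mean_def
  by (simp add: leaf_dist_eq[OF assms(1)] leaf_dist_eq[OF assms(2)] diff_divide_distrib[symmetric] sum_divide_distrib)

section \<open>Assembling the two bounds\<close>

lemma tree_isingD:
  assumes "tree_ising n n' E \<theta>"
  obtains r where "rtree {1..n+n'} E r" "\<And>e. e \<in> E \<Longrightarrow> \<bar>\<theta> e\<bar> \<le> 1" "is_tree {1..n+n'} E"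
proof -
  have t: "is_tree {1..n+n'} E" using assms by (simp add: tree_ising_def)
  then obtain r where "r \<in> {1..n+n'}" by (auto simp: is_tree_def)
  then have "rtree {1..n+n'} E r" by (rule is_tree_rtree[OF t])
  moreover have "\<bar>\<theta> e\<bar> \<le> 1" if "e \<in> E" for e using assms that by (auto simp: tree_ising_def abs_le_iff)
  ultimately show ?thesis using t that by blast
qed

lemma diameter_ge_1:
  assumes "is_tree V E" "u \<in> V" "v \<in> V" "u \<noteq> v"
  shows "1 \<le> diameter V E"
proof -
  have fin: "finite V" and "(u, v) \<in> (adj E)\<^sup>*" using assms by (auto simp: is_tree_def connected_graph_def)
  then obtain k where "(u, v) \<in> adj E ^^ k" using rtrancl_power by blast
  then have "(u, v) \<in> adj E ^^ graph_dist E u v" unfolding graph_dist_def by (rule LeastI)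
  then have "graph_dist E u v \<noteq> 0" using assms(4) by (intro notI) simp
  moreover have "graph_dist E u v \<le> diameter V E"
    unfolding diameter_def
  proof (rule Max_ge)
    have "{graph_dist E u v | u v. u \<in> V \<and> v \<in> V} = (\<lambda>(u, v). graph_dist E u v) ` (V \<times> V)" by auto
    then show "finite {graph_dist E u v | u v. u \<in> V \<and> v \<in> V}" using fin by simp
  qed (use assms in auto)
  ultimately show ?thesis by linarith
qed

text \<open>Start of the merging process: each leaf is its own cluster, with even part 1 and odd
  part its own spin, of norm 1.\<close>

lemma singleton_clusters: "finite S \<Longrightarrow> clusters S S (\<lambda>_ _. 1) (\<lambda>l w. w l) (\<lambda>l. {l}) (\<lambda>_. 1)"
proof
  fix l assume "finite S" "l \<in> S"
  have "nrm S (\<lambda>w. w l) = mean S (\<lambda>w. 1)"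
    unfolding nrm_def using \<open>l \<in> S\<close> by (intro mean_cong) (rule spins_abs)
  then show "nrm S (\<lambda>w. w l) \<le> 1" using mean_const[OF \<open>finite S\<close>] by simp
qed (auto intro: dep_coord)

text \<open>If \<open>27 * \<epsilon> * n ^ 5\<close> exceeds 1, the bound holds because a total
  variation distance is at most 1; otherwise it meets the smallness hypothesis of
  \<open>tree_comparison\<close>.\<close>

lemma different_trees_bound:
  assumes "tree_ising n n1 E1 \<theta>1" "tree_ising n n2 E2 \<theta>2" and \<epsilon>: "0 \<le> \<epsilon>"
    and close: "\<And>i j. i \<in> {1..n} \<Longrightarrow> j \<in> {1..n} \<Longrightarrow> i \<noteq> j \<Longrightarrow>
      \<bar>leaf_corr n (leaf_dist n n1 E1 \<theta>1) i j - leaf_corr n (leaf_dist n n2 E2 \<theta>2) i j\<bar> \<le> \<epsilon>"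
  shows "tv_dist n (leaf_dist n n1 E1 \<theta>1) (leaf_dist n n2 E2 \<theta>2)
     \<le> 27 * real (min (diameter {1..n+n1} E1) (diameter {1..n+n2} E2)) * real n ^ 5 * \<epsilon>"
proof -
  let ?V1 = "{1..n+n1}" and ?V2 = "{1..n+n2}" and ?S = "{1..n}"
  let ?D = "real (min (diameter ?V1 E1) (diameter ?V2 E2))"
  obtain r1 where T1: "rtree ?V1 E1 r1" and th1: "\<And>e. e \<in> E1 \<Longrightarrow> \<bar>\<theta>1 e\<bar> \<le> 1" and t1: "is_tree ?V1 E1"
    using tree_isingD[OF assms(1)] by blast
  obtain r2 where T2: "rtree ?V2 E2 r2" and th2: "\<And>e. e \<in> E2 \<Longrightarrow> \<bar>\<theta>2 e\<bar> \<le> 1" and t2: "is_tree ?V2 E2"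
    using tree_isingD[OF assms(2)] by blast
  define \<Delta> where "\<Delta> = nrm ?S (\<lambda>w. dens ?V1 E1 \<theta>1 ?S w - dens ?V2 E2 \<theta>2 ?S w)"
  have tv: "tv_dist n (leaf_dist n n1 E1 \<theta>1) (leaf_dist n n2 E2 \<theta>2) = (1/2) * \<Delta>"
    unfolding \<Delta>_def by (rule tv_dist_eq[OF T1 T2])
  have \<Delta>0: "0 \<le> \<Delta>" unfolding \<Delta>_def by (rule nrm_nonneg)
  have close': "\<bar>cor ?V1 E1 \<theta>1 i j - cor ?V2 E2 \<theta>2 i j\<bar> \<le> \<epsilon>" if ij: "i \<in> ?S" "j \<in> ?S" for i j
  proof (cases "i = j")
    case True
    then show ?thesis using cor_refl[OF T1, of i \<theta>1] cor_refl[OF T2, of i \<theta>2] ij \<epsilon> by auto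
  next
    case False
    then show ?thesis using close[OF ij] leaf_corr_eq[OF T1 ij] leaf_corr_eq[OF T2 ij] by simp
  qed
  have \<Delta>2: "\<Delta> \<le> 2"
    using nrm_triangle_diff[of ?S "dens ?V1 E1 \<theta>1 ?S" "dens ?V2 E2 \<theta>2 ?S"]
      nrm_dens[of ?V1 E1 r1 \<theta>1 ?S ?S, OF T1 th1] nrm_dens[of ?V2 E2 r2 \<theta>2 ?S ?S, OF T2 th2]
    unfolding \<Delta>_def by simp
  have bound: "\<Delta> \<le> 27 * \<epsilon> * real (n - 1) * real n ^ 4" if small: "27 * \<epsilon> * real n * real n ^ 4 \<le> 1"
  proof -
    have "nrm ?S (\<lambda>w. ev ?V1 E1 \<theta>1 (\<lambda>_ _. 1) (\<lambda>l w. w l) ?S w - ev ?V2 E2 \<theta>2 (\<lambda>_ _. 1) (\<lambda>l w. w l) ?S w)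
        \<le> 27 * \<epsilon> * real (card ?S - 1) * (sum (\<lambda>_. 1) ?S) ^ 4"
    proof (rule tree_comparison[OF T1 th1 T2 th2 \<epsilon> singleton_clusters])
      show "nrm ?S (ev ?V2 E2 \<theta>2 (\<lambda>_ _. 1) (\<lambda>l w. w l) B) \<le> 1" if "B \<subseteq> ?S" for B
      proof -
        have V2: "B \<subseteq> ?V2" using that by force
        show ?thesis using nrm_dens[of ?V2 E2 r2 \<theta>2 B ?S, OF T2 th2] that V2 by (simp add: dens_def[abs_def])
      qed
    qed (use close' small in auto)
    then show ?thesis by (simp add: \<Delta>_def dens_def)
  qed
  show ?thesis
  proof (cases "n \<le> 1")
    \<comment> \<open>The diameter may be 0 here, so the distance has to vanish. The factor
      \<open>n - 1\<close> gives this for small \<open>\<epsilon>\<close>; in the remaining case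
      \<open>n = 1\<close>, and a single spin is uniform in both models.\<close>
    case True
    show ?thesis
    proof (cases "27 * \<epsilon> * real n * real n ^ 4 \<le> 1")
      case small: True
      have "\<Delta> \<le> 0" using bound[OF small] True by simp
      moreover have "0 \<le> 27 * ?D * real n ^ 5 * \<epsilon>" using \<epsilon> by simp
      ultimately show ?thesis unfolding tv by linarith
    next
      case False
      then have n1: "n = 1" using True by (cases n) auto
      have "dens ?V1 E1 \<theta>1 ?S w = dens ?V2 E2 \<theta>2 ?S w" for w
        using ex_leafprod_single[OF T1, of 1 \<theta>1 ones w] ex_leafprod_single[OF T2, of 1 \<theta>2 ones w]
        by (simp add: dens_def n1)
      then have "\<Delta> = 0" by (simp add: \<Delta>_def)
      then show ?thesis unfolding tv using \<epsilon> by simp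
    qed
  next
    case False
    then have n2: "1 \<in> ?S" "2 \<in> ?S" by auto
    \<comment> \<open>Leaves 1 and 2 are distinct nodes of both trees, so the factor with the
      diameters is at least 1.\<close>
    have "1 \<le> diameter ?V1 E1" "1 \<le> diameter ?V2 E2"
      using diameter_ge_1[OF t1, of 1 2] diameter_ge_1[OF t2, of 1 2] n2 by auto
    then have D: "1 \<le> ?D" by simp
    have "(1/2) * \<Delta> \<le> 27 * real n ^ 5 * \<epsilon>"
    proof (cases "27 * \<epsilon> * real n * real n ^ 4 \<le> 1")
      case True
      have "\<Delta> \<le> 27 * \<epsilon> * real (n - 1) * real n ^ 4" by (rule bound[OF True])
      also have "\<dots> \<le> 27 * \<epsilon> * real n * real n ^ 4" using \<epsilon> by (intro mult_right_mono mult_left_mono) auto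
      also have "\<dots> = 27 * real n ^ 5 * \<epsilon>" by (simp add: eval_nat_numeral)
      finally show ?thesis using \<Delta>0 by linarith
    next
      case False
      have "27 * \<epsilon> * real n * real n ^ 4 = 27 * real n ^ 5 * \<epsilon>" by (simp add: eval_nat_numeral)
      then show ?thesis using False \<Delta>2 by linarith
    qed
    also have "\<dots> \<le> ?D * (27 * real n ^ 5 * \<epsilon>)" using D \<epsilon> mult_right_mono[of 1 ?D "27 * real n ^ 5 * \<epsilon>"] by simp
    finally show ?thesis unfolding tv by (simp add: mult_ac)
  qed
qed

lemma same_topology_bound:
  assumes "tree_ising n n' E \<theta>" "tree_ising n n' E \<theta>'" and \<epsilon>: "0 \<le> \<epsilon>"
    and close: "\<And>i j. i \<in> {1..n} \<Longrightarrow> j \<in> {1..n} \<Longrightarrow> i \<noteq> j \<Longrightarrow>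
      \<bar>leaf_corr n (leaf_dist n n' E \<theta>) i j - leaf_corr n (leaf_dist n n' E \<theta>') i j\<bar> \<le> \<epsilon>"
  shows "tv_dist n (leaf_dist n n' E \<theta>) (leaf_dist n n' E \<theta>') \<le> 2 * real n ^ 2 * \<epsilon>"
proof -
  let ?V = "{1..n+n'}" and ?S = "{1..n}"
  obtain r where T: "rtree ?V E r" and th: "\<And>e. e \<in> E \<Longrightarrow> \<bar>\<theta> e\<bar> \<le> 1"
    using tree_isingD[OF assms(1)] by blast
  have th': "\<And>e. e \<in> E \<Longrightarrow> \<bar>\<theta>' e\<bar> \<le> 1" using tree_isingD[OF assms(2)] by blast
  have close': "\<bar>cor ?V E \<theta> i j - cor ?V E \<theta>' i j\<bar> \<le> \<epsilon>" if ij: "i \<in> ?S" "j \<in> ?S" for i j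
  proof (cases "i = j")
    case True
    then show ?thesis using cor_refl[OF T, of i] ij \<epsilon> by auto
  next
    case False
    then show ?thesis using close[OF ij] leaf_corr_eq[OF T ij] by simp
  qed
  \<comment> \<open>The factor 1/2 in the total variation distance turns 3 into 3/2, which is below
    2.\<close>
  have "nrm ?S (\<lambda>w. dens ?V E \<theta> ?S w - dens ?V E \<theta>' ?S w) \<le> 3 * real (card ?S) ^ 2 * \<epsilon>"
    by (rule same_tree_bound[OF T _ _ _ \<epsilon> th th' close']) auto
  moreover have "0 \<le> real n ^ 2 * \<epsilon>" using \<epsilon> by simp
  ultimately show ?thesis unfolding tv_dist_eq[OF T T] by simp
qed

theorem theorem1:
  shows
   "(\<forall>(n::nat) n' E \<theta> \<theta>' (\<epsilon>::real).
       tree_ising n n' E \<theta> \<and> tree_ising n n' E \<theta>' \<and> 0 \<le> \<epsilon> \<and>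
       (\<forall>i\<in>{1..n}. \<forall>j\<in>{1..n}. i \<noteq> j \<longrightarrow>
          \<bar>leaf_corr n (leaf_dist n n' E \<theta>) i j - leaf_corr n (leaf_dist n n' E \<theta>') i j\<bar> \<le> \<epsilon>)
       \<longrightarrow> tv_dist n (leaf_dist n n' E \<theta>) (leaf_dist n n' E \<theta>') \<le> 2 * real n ^ 2 * \<epsilon>)
  \<and> (\<exists>C::real. C > 0 \<and>
      (\<forall>(n::nat) n1 E1 \<theta>1 n2 E2 \<theta>2 (\<epsilon>::real).
        tree_ising n n1 E1 \<theta>1 \<and> tree_ising n n2 E2 \<theta>2 \<and> (n1, E1) \<noteq> (n2, E2) \<and> 0 \<le> \<epsilon> \<and>
        (\<forall>i\<in>{1..n}. \<forall>j\<in>{1..n}. i \<noteq> j \<longrightarrow>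
          \<bar>leaf_corr n (leaf_dist n n1 E1 \<theta>1) i j - leaf_corr n (leaf_dist n n2 E2 \<theta>2) i j\<bar> \<le> \<epsilon>)
        \<longrightarrow> tv_dist n (leaf_dist n n1 E1 \<theta>1) (leaf_dist n n2 E2 \<theta>2)
              \<le> C * real (min (diameter {1..n+n1} E1) (diameter {1..n+n2} E2)) * real n ^ 5 * \<epsilon>))"
proof (intro conjI exI[of _ 27] allI impI)
  fix n n' E \<theta> \<theta>' and \<epsilon> :: real
  assume "tree_ising n n' E \<theta> \<and> tree_ising n n' E \<theta>' \<and> 0 \<le> \<epsilon> \<and>
       (\<forall>i\<in>{1..n}. \<forall>j\<in>{1..n}. i \<noteq> j \<longrightarrow>
          \<bar>leaf_corr n (leaf_dist n n' E \<theta>) i j - leaf_corr n (leaf_dist n n' E \<theta>') i j\<bar> \<le> \<epsilon>)"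
  then show "tv_dist n (leaf_dist n n' E \<theta>) (leaf_dist n n' E \<theta>') \<le> 2 * real n ^ 2 * \<epsilon>"
    by (intro same_topology_bound) auto
next
  fix n n1 E1 \<theta>1 n2 E2 \<theta>2 and \<epsilon> :: real
  assume "tree_ising n n1 E1 \<theta>1 \<and> tree_ising n n2 E2 \<theta>2 \<and> (n1, E1) \<noteq> (n2, E2) \<and> 0 \<le> \<epsilon> \<and>
        (\<forall>i\<in>{1..n}. \<forall>j\<in>{1..n}. i \<noteq> j \<longrightarrow>
          \<bar>leaf_corr n (leaf_dist n n1 E1 \<theta>1) i j - leaf_corr n (leaf_dist n n2 E2 \<theta>2) i j\<bar> \<le> \<epsilon>)"
  then show "tv_dist n (leaf_dist n n1 E1 \<theta>1) (leaf_dist n n2 E2 \<theta>2)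
              \<le> 27 * real (min (diameter {1..n+n1} E1) (diameter {1..n+n2} E2)) * real n ^ 5 * \<epsilon>"
    by (intro different_trees_bound) auto
qed simp

end
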